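(* Let $a\in C^\infty(\mathbb T;\mathbb R)$, let $a_0=\frac1{2\pi}\int_0^{2\pi}a(t)\,dt$, and let $L=\partial_t-a(t)\partial_x$ on $\mathbb T^2$. Let $s\in\mathbb R$, and suppose that $f\in H^s(\mathbb T^2)$. Assume that $a_0\in\mathbb R\setminus\mathbb Q$ has finite irrationality measure $\mu(a_0)$. Then every distributional solution $u\in\mathcal D'(\mathbb T^2)$ of $Lu=f$ satisfies $$u\in H^{s+1-r}(\mathbb T^2)$$ for every $r>\mu(a_0)$. If, in addition, $\widehat f(0,0)=0$, then there exists a unique distributional solution $u$ of $Lu=f$ satisfying $\widehat u(0,0)=0$. This solution belongs to $H^{s+1-r}(\mathbb T^2)$ for every $r>\mu(a_0)$.
   Context: $\mathbb T=\mathbb R/2\pi\mathbb Z$, with variables $(t,x)\in\mathbb T^2$ and dual frequencies $(\tau,\xi)\in\mathbb Z^2$. $\mathcal D'(\mathbb T^2)$ is the space of distributions on $\mathbb T^2$. Fourier coefficients are $\widehat f(\tau,\xi)=\frac1{(2\pi)^2}\int_{\mathbb T^2}f(t,x)e^{-i(t\tau+x\xi)}\,dt\,dx$ (by duality for distributions). $\langle w\rangle=(1+|w|^2)^{1/2}$. For $s\in\mathbb R$, $H^s(\mathbb T^2)$ is the isotropic Sobolev space of $f\in\mathcal D'(\mathbb T^2)$ with $\sum_{(\tau,\xi)\in\mathbb Z^2}\langle(\tau,\xi)\rangle^{2s}|\widehat f(\tau,\xi)|^2<\infty$. The irrationality measure of $\alpha\in\mathbb R\setminus\mathbb Q$ is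 $\mu(\alpha)=\sup\{\nu>0:\ |\alpha-p/q|<q^{-\nu}\text{ for infinitely many }(p,q)\in\mathbb Z\times\mathbb N\}\in[2,\infty]$. *)

theory Defs
  imports "HOL-Analysis.Analysis" "HOL-Library.FuncSet"
begin

definition dir_deriv :: "'a::real_normed_vector \<Rightarrow> ('a \<Rightarrow> 'b::real_normed_vector) \<Rightarrow> 'a \<Rightarrow> 'b" where
  "dir_deriv v f z = frechet_derivative f (at z) v"

(* C^\<infinity> on a Euclidean space: every iterated directional derivative, of any order and in
   any directions, is again differentiable everywhere (and hence continuous). *)
definition smooth_fun :: "('a::euclidean_space \<Rightarrow> 'b::real_normed_vector) \<Rightarrow> bool" where
  "smooth_fun f \<longleftrightarrow> (\<forall>vs. foldr dir_deriv vs f differentiable_on UNIV)"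

(* Functions on the torus are represented by their periodic lifts. *)
definition smooth_circle :: "(real \<Rightarrow> real) set" where
  "smooth_circle = {a. smooth_fun a \<and> (\<forall>t. a (t + 2 * pi) = a t)}"

definition test_fun :: "(real \<times> real \<Rightarrow> complex) set" where
  "test_fun = {\<phi>. smooth_fun \<phi> \<and>
     (\<forall>t x. \<phi> (t + 2 * pi, x) = \<phi> (t, x) \<and> \<phi> (t, x + 2 * pi) = \<phi> (t, x))}"

abbreviation partial_t :: "(real \<times> real \<Rightarrow> complex) \<Rightarrow> real \<times> real \<Rightarrow> complex" where
  "partial_t \<equiv> dir_deriv (1, 0)"

abbreviation partial_x :: "(real \<times> real \<Rightarrow> complex) \<Rightarrow> real \<times> real \<Rightarrow> complex" where
  "partial_x \<equiv> dir_deriv (0, 1)"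

definition Ck_norm :: "nat \<Rightarrow> (real \<times> real \<Rightarrow> complex) \<Rightarrow> real" where
  "Ck_norm k \<phi> = (\<Sum>(i, j) \<in> {(i, j). i + j \<le> k}.
     SUP z. norm ((partial_t ^^ i) ((partial_x ^^ j) \<phi>) z))"

type_synonym functional = "(real \<times> real \<Rightarrow> complex) \<Rightarrow> complex"

(* Complex-linear functionals on test functions, continuous for the Frechet topology given by
   the norms Ck_norm.  Functionals are taken to be undefined outside test_fun, so that HOL
   equality is equality of distributions. *)
definition distributions :: "functional set" where
  "distributions = {u. u \<in> extensional test_fun \<and>
     (\<forall>\<phi>\<in>test_fun. \<forall>\<psi>\<in>test_fun. u (\<lambda>z. \<phi> z + \<psi> z) = u \<phi> + u \<psi>) \<and>
     (\<forall>c. \<forall>\<phi>\<in>test_fun. u (\<lambda>z. c * \<phi> z) = c * u \<phi>) \<and>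
     (\<exists>C k. \<forall>\<phi>\<in>test_fun. norm (u \<phi>) \<le> C * Ck_norm k \<phi>)}"

definition dist_deriv_t :: "functional \<Rightarrow> functional" where
  "dist_deriv_t u = (\<lambda>\<phi>\<in>test_fun. - u (partial_t \<phi>))"

definition dist_deriv_x :: "functional \<Rightarrow> functional" where
  "dist_deriv_x u = (\<lambda>\<phi>\<in>test_fun. - u (partial_x \<phi>))"

definition dist_mult :: "(real \<times> real \<Rightarrow> complex) \<Rightarrow> functional \<Rightarrow> functional" where
  "dist_mult g u = (\<lambda>\<phi>\<in>test_fun. u (\<lambda>z. g z * \<phi> z))"

definition dist_minus :: "functional \<Rightarrow> functional \<Rightarrow> functional" where
  "dist_minus u v = (\<lambda>\<phi>\<in>test_fun. u \<phi> - v \<phi>)"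

definition transport_op :: "(real \<Rightarrow> real) \<Rightarrow> functional \<Rightarrow> functional" where
  "transport_op a u =
     dist_minus (dist_deriv_t u) (dist_mult (\<lambda>(t, x). of_real (a t)) (dist_deriv_x u))"

definition fourier_coeff :: "functional \<Rightarrow> int \<times> int \<Rightarrow> complex" where
  "fourier_coeff u = (\<lambda>(\<tau>, \<xi>).
     u (\<lambda>(t, x). exp (- \<i> * of_real (t * of_int \<tau> + x * of_int \<xi>))) / of_real ((2 * pi)\<^sup>2))"

definition bracket :: "'a::real_normed_vector \<Rightarrow> real" where
  "bracket w = sqrt (1 + (norm w)\<^sup>2)"

definition sobolev :: "real \<Rightarrow> functional set" where
  "sobolev s = {f \<in> distributions.
     (\<lambda>(\<tau>, \<xi>). bracket (real_of_int \<tau>, real_of_int \<xi>) powr (2 * s) *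
        (norm (fourier_coeff f (\<tau>, \<xi>)))\<^sup>2) summable_on (UNIV :: (int \<times> int) set)}"

definition irrationality_measure :: "real \<Rightarrow> ereal" where
  "irrationality_measure \<alpha> = Sup {ereal \<nu> |\<nu>. \<nu> > 0 \<and>
     infinite {(p :: int, q :: nat). q > 0 \<and> \<bar>\<alpha> - of_int p / of_nat q\<bar> < of_nat q powr (- \<nu>)}}"

definition circle_mean :: "(real \<Rightarrow> real) \<Rightarrow> real" where
  "circle_mean a = integral {0..2 * pi} a / (2 * pi)"

end

theory Submission imports Defs begin

text \<open>
  Let \<open>\<alpha>\<close> be the mean of \<open>a\<close> and \<open>A\<close> a periodic primitive of \<open>a - \<alpha>\<close>. Composition with the shear
  \<open>(t, x) \<mapsto> (t, x + A t)\<close> conjugates the operator to the constant coefficient operator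
  \<open>\<partial>\<^sub>t - \<alpha> \<partial>\<^sub>x\<close>, whose symbol at \<open>(\<tau>, \<xi>)\<close> is bounded below by a multiple of
  \<open>\<langle>(\<tau>, \<xi>)\<rangle>\<close> to the power \<open>1 - r\<close> away from the origin, for every \<open>r > \<mu>(\<alpha>)\<close>. Since the shear
  preserves every Sobolev space, dividing the Fourier coefficients by the symbol gives regularity,
  uniqueness and existence. A distribution lies in \<open>H\<^sup>s\<close> iff it is bounded on test functions for
  the norm of order \<open>- s\<close>, so it suffices to shear smooth functions.
\<close>

section \<open>Smooth functions\<close>

text \<open>The hard point is the invariance under shears. A shear mixes Fourier modes, so its
  effect on a weighted sum of coefficients cannot be seen term by term. At order 0 it is an
  isometry, because it preserves area. Integer orders follow by induction from the chain rule and
  from the boundedness of multiplication by smooth functions. Positive real orders need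
  interpolation between 0 and a large integer, carried out on the Fourier side, and negative orders
  need duality. The loss of \<open>r - 1\<close> derivatives comes from |\<tau> - \<alpha> \<xi>| =
  |\<xi>| |\<alpha> - \<tau> / \<xi>|, which for nonzero \<xi> is at least a multiple of |\<xi>|^(1
  - r). The passage between distributions and coefficients rests on two facts: every distribution
  has a finite Sobolev order, and smooth functions are the pointwise sums of their Fourier series.
  The latter is obtained on the circle first and then one variable at a time. Smoothness means that
  all iterated directional derivatives are differentiable, so its closure properties are proved
  coinductively.\<close>

lemma dir_deriv_eq: "(f has_derivative f') (at z) \<Longrightarrow> dir_deriv v f z = f' v"
  unfolding dir_deriv_def using frechet_derivative_at by metis

lemma dir_deriv_eqI:
  "(\<And>z. (f has_derivative f' z) (at z)) \<Longrightarrow> dir_deriv v f = (\<lambda>z. f' z v)"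
  by (simp add: dir_deriv_eq fun_eq_iff)

text \<open>\<open>foldr\<close> applies the last direction of the list first. Splitting off the
  last entry therefore exposes the innermost derivative and yields a recursive
  characterization.\<close>

lemma smooth_fun_iff:
  "smooth_fun f \<longleftrightarrow> f differentiable_on UNIV \<and> (\<forall>v. smooth_fun (dir_deriv v f))"
proof
  assume f: "smooth_fun f"
  have "foldr dir_deriv (vs @ [v]) f differentiable_on UNIV" for vs v
    using f unfolding smooth_fun_def by blast
  moreover have "foldr dir_deriv [] f differentiable_on UNIV"
    using f unfolding smooth_fun_def by blast
  ultimately show "f differentiable_on UNIV \<and> (\<forall>v. smooth_fun (dir_deriv v f))"
    by (simp add: smooth_fun_def)
next
  assume f: "f differentiable_on UNIV \<and> (\<forall>v. smooth_fun (dir_deriv v f))"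
  show "smooth_fun f" unfolding smooth_fun_def
  proof
    fix vs show "foldr dir_deriv vs f differentiable_on UNIV"
      using f by (cases vs rule: rev_exhaust) (auto simp: smooth_fun_def)
  qed
qed

lemma smooth_fun_dir_deriv: "smooth_fun f \<Longrightarrow> smooth_fun (dir_deriv v f)"
  using smooth_fun_iff by blast

lemma smooth_fun_differentiable: "smooth_fun f \<Longrightarrow> f differentiable (at z)"
  using smooth_fun_iff[of f] by (simp add: differentiable_on_def)

lemma smooth_fun_has_derivative:
  "smooth_fun f \<Longrightarrow> (f has_derivative (\<lambda>v. dir_deriv v f z)) (at z)"
  unfolding dir_deriv_def using smooth_fun_differentiable frechet_derivative_works by blast

lemma smooth_fun_continuous: "smooth_fun f \<Longrightarrow> continuous_on S f"
  by (meson smooth_fun_iff differentiable_imp_continuous_on continuous_on_subset subset_UNIV)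

text \<open>Product and chain rules turn one term into several terms of the same shape. Only after
  closing under finite sums does a set of such terms become stable under differentiation.\<close>

inductive sum_closure :: "('a \<Rightarrow> 'b::real_normed_vector) set \<Rightarrow> ('a \<Rightarrow> 'b) \<Rightarrow> bool" for S where
  base: "f \<in> S \<Longrightarrow> sum_closure S f"
| zero: "sum_closure S (\<lambda>_. 0)"
| add: "sum_closure S f \<Longrightarrow> sum_closure S g \<Longrightarrow> sum_closure S (\<lambda>z. f z + g z)"

lemma sum_closure_sum:
  "finite I \<Longrightarrow> (\<And>i. i \<in> I \<Longrightarrow> sum_closure S (f i)) \<Longrightarrow> sum_closure S (\<lambda>z. \<Sum>i\<in>I. f i z)"
  by (induction I rule: finite_induct) (auto intro: sum_closure.intros)

text \<open>Coinduction up to finite sums.\<close>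

lemma smooth_fun_coinduct:
  fixes S :: "('a::euclidean_space \<Rightarrow> 'b::real_normed_vector) set"
  assumes f: "sum_closure S f"
    and diff: "\<And>f. f \<in> S \<Longrightarrow> f differentiable_on UNIV"
    and deriv: "\<And>f v. f \<in> S \<Longrightarrow> sum_closure S (dir_deriv v f)"
  shows "smooth_fun f"
proof -
  have step: "f differentiable_on UNIV \<and> (\<forall>v. sum_closure S (dir_deriv v f))"
    if "sum_closure S f" for f
    using that
  proof induction
    case (base f)
    then show ?case using diff deriv by blast
  next
    case zero
    have "dir_deriv v (\<lambda>_. 0) = (\<lambda>_::'a. 0::'b)" for v
      by (auto intro!: dir_deriv_eq derivative_eq_intros)
    then show ?case by (auto intro: sum_closure.zero)
  next
    case (add f g)
    have "dir_deriv v (\<lambda>z. f z + g z) = (\<lambda>z. dir_deriv v f z + dir_deriv v g z)" for v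
    proof
      fix z
      have "f differentiable at z" "g differentiable at z"
        using add by (auto simp: differentiable_on_def)
      then have "((\<lambda>z. f z + g z) has_derivative
          (\<lambda>v. frechet_derivative f (at z) v + frechet_derivative g (at z) v)) (at z)"
        by (intro has_derivative_add) (auto simp: frechet_derivative_works)
      then show "dir_deriv v (\<lambda>z. f z + g z) z = dir_deriv v f z + dir_deriv v g z"
        by (simp add: dir_deriv_eq) (simp add: dir_deriv_def)
    qed
    then show ?case using add by (auto intro: sum_closure.add)
  qed
  have "sum_closure S (foldr dir_deriv vs f)" for vs
    by (induction vs) (auto simp: step f)
  then show ?thesis unfolding smooth_fun_def using step by blast
qed

lemma smooth_fun_const: "smooth_fun (\<lambda>_. c)"
proof (rule smooth_fun_coinduct[where S = "range (\<lambda>c _. c)"])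
  show "sum_closure (range (\<lambda>c _. c)) (\<lambda>_. c)"
    by (auto intro: sum_closure.base)
next
  fix f :: "'a \<Rightarrow> 'b" and v assume "f \<in> range (\<lambda>c _. c)"
  then have "dir_deriv v f = (\<lambda>_. 0)"
    by (auto intro!: dir_deriv_eq derivative_eq_intros)
  then show "sum_closure (range (\<lambda>c _. c)) (dir_deriv v f)"
    by (simp add: sum_closure.zero)
qed auto

lemma smooth_fun_linear:
  assumes "bounded_linear f" shows "smooth_fun f"
proof -
  have "dir_deriv v f = (\<lambda>_. f v)" for v
    using assms by (intro dir_deriv_eqI bounded_linear_imp_has_derivative)
  then show ?thesis
    using bounded_linear_imp_differentiable_on[OF assms]
    by (subst smooth_fun_iff) (simp add: smooth_fun_const)
qed

text \<open>By the Leibniz rule each derivative is a sum of two terms \<open>b (f z) (g z)\<close>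
  with new smooth factors, so the set \<open>?S\<close> of all such products is closed up to finite
  sums.\<close>

lemma smooth_fun_bilinear:
  assumes b: "bounded_bilinear b" and f: "smooth_fun f" and g: "smooth_fun g"
  shows "smooth_fun (\<lambda>z. b (f z) (g z))"
    and "dir_deriv v (\<lambda>z. b (f z) (g z)) =
      (\<lambda>z. b (f z) (dir_deriv v g z) + b (dir_deriv v f z) (g z))"
proof -
  let ?S = "{\<lambda>z. b (f z) (g z) |f g. smooth_fun f \<and> smooth_fun g}"
  have D: "((\<lambda>z. b (f z) (g z)) has_derivative
      (\<lambda>v. b (f z) (dir_deriv v g z) + b (dir_deriv v f z) (g z))) (at z)"
    if "smooth_fun f" "smooth_fun g" for f g z
    using bounded_bilinear.FDERIV[OF b smooth_fun_has_derivative smooth_fun_has_derivative] that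
    by blast
  have E: "dir_deriv v (\<lambda>z. b (f z) (g z)) =
      (\<lambda>z. b (f z) (dir_deriv v g z) + b (dir_deriv v f z) (g z))"
    if "smooth_fun f" "smooth_fun g" for f g v
    by (rule dir_deriv_eqI) (rule D[OF that])
  show "dir_deriv v (\<lambda>z. b (f z) (g z)) =
      (\<lambda>z. b (f z) (dir_deriv v g z) + b (dir_deriv v f z) (g z))"
    by (rule E[OF f g])
  show "smooth_fun (\<lambda>z. b (f z) (g z))"
  proof (rule smooth_fun_coinduct[where S = ?S])
    show "sum_closure ?S (\<lambda>z. b (f z) (g z))" using f g by (blast intro: sum_closure.base)
  next
    fix h assume "h \<in> ?S"
    then show "h differentiable_on UNIV"
      using D by (force simp: differentiable_on_def differentiable_def)
  next
    fix h v assume "h \<in> ?S"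
    then obtain f g where h: "h = (\<lambda>z. b (f z) (g z))" and fg: "smooth_fun f" "smooth_fun g"
      by blast
    show "sum_closure ?S (dir_deriv v h)"
      unfolding h E[OF fg]
      by (intro sum_closure.add sum_closure.base) (use fg smooth_fun_dir_deriv in blast)+
  qed
qed

lemmas smooth_fun_mult = smooth_fun_bilinear(1)[OF bounded_bilinear_mult]
lemmas dir_deriv_mult = smooth_fun_bilinear(2)[OF bounded_bilinear_mult]

lemma smooth_fun_add:
  assumes "smooth_fun f" "smooth_fun g"
  shows "smooth_fun (\<lambda>z. f z + g z)"
  by (rule smooth_fun_coinduct[where S = "Collect smooth_fun"])
     (use assms smooth_fun_iff in \<open>auto intro: sum_closure.intros smooth_fun_dir_deriv\<close>)

text \<open>The chain rule differentiates \<open>f\<close> in the direction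
  \<open>dir_deriv v g z\<close>, which moves with \<open>z\<close>, so compositions alone are not
  stable. Expanding the direction in the basis leaves fixed directions with smooth scalar
  coefficients; hence the set \<open>S\<close> of terms
  \<open>c z *\<^sub>R f (g z)\<close>.\<close>

lemma smooth_fun_compose:
  fixes f :: "'b::euclidean_space \<Rightarrow> 'c::real_normed_vector" and g :: "'a::euclidean_space \<Rightarrow> 'b"
  assumes f: "smooth_fun f" and g: "smooth_fun g"
  shows "smooth_fun (\<lambda>z. f (g z))"
    and "dir_deriv v (\<lambda>z. f (g z)) = (\<lambda>z. dir_deriv (dir_deriv v g z) f (g z))"
proof -
  have D: "((\<lambda>z. f (g z)) has_derivative (\<lambda>v. dir_deriv (dir_deriv v g z) f (g z))) (at z)"
    if "smooth_fun f" for f :: "'b \<Rightarrow> 'c" and z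
    using has_derivative_compose[OF smooth_fun_has_derivative[OF g] smooth_fun_has_derivative[OF that]]
    by simp
  show "dir_deriv v (\<lambda>z. f (g z)) = (\<lambda>z. dir_deriv (dir_deriv v g z) f (g z))"
    by (rule dir_deriv_eqI) (rule D[OF f])
  define S where "S = {\<lambda>z. c z *\<^sub>R f (g z) |c f. smooth_fun c \<and> smooth_fun (f :: 'b \<Rightarrow> 'c)}"
  have SI: "(\<lambda>z. c z *\<^sub>R f (g z)) \<in> S" if "smooth_fun c" "smooth_fun f" for c and f :: "'b \<Rightarrow> 'c"
    unfolding S_def using that by blast
  have expand: "dir_deriv w f y = (\<Sum>i\<in>Basis. (w \<bullet> i) *\<^sub>R dir_deriv i f y)"
    if "smooth_fun f" for f :: "'b \<Rightarrow> 'c" and w y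
  proof -
    have "linear (\<lambda>w. dir_deriv w f y)"
      using smooth_fun_has_derivative[OF that] has_derivative_linear by blast
    from linear_sum[OF this, of "\<lambda>i. (w \<bullet> i) *\<^sub>R i" Basis]
    show ?thesis
      using linear_scale[OF \<open>linear (\<lambda>w. dir_deriv w f y)\<close>] by (simp add: euclidean_representation)
  qed
  have D2: "((\<lambda>z. c z *\<^sub>R f (g z)) has_derivative
      (\<lambda>v. c z *\<^sub>R dir_deriv (dir_deriv v g z) f (g z) + dir_deriv v c z *\<^sub>R f (g z))) (at z)"
    if "smooth_fun f" "smooth_fun c" for f :: "'b \<Rightarrow> 'c" and c :: "'a \<Rightarrow> real" and z
    using bounded_bilinear.FDERIV[OF bounded_bilinear_scaleR
        smooth_fun_has_derivative[OF that(2)] D[OF that(1)]] .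
  have inner: "smooth_fun (\<lambda>z. h z \<bullet> i)" if "smooth_fun h" for h :: "'a \<Rightarrow> 'b" and i
    by (rule smooth_fun_bilinear(1)[OF bounded_bilinear_inner that smooth_fun_const])
  have "smooth_fun (\<lambda>z. 1 *\<^sub>R f (g z))"
  proof (rule smooth_fun_coinduct[where S = S])
    show "sum_closure S (\<lambda>z. 1 *\<^sub>R f (g z))"
      unfolding S_def using f smooth_fun_const[of 1] by (fast intro: sum_closure.base)
  next
    fix h assume "h \<in> S"
    then show "h differentiable_on UNIV"
      unfolding S_def using D2 by (force simp: differentiable_on_def differentiable_def)
  next
    fix h v assume "h \<in> S"
    then obtain c and f :: "'b \<Rightarrow> 'c" where h: "h = (\<lambda>z. c z *\<^sub>R f (g z))"
      and c: "smooth_fun c" and f: "smooth_fun f"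
      unfolding S_def by blast
    have eq: "dir_deriv v h = (\<lambda>z. (\<Sum>i\<in>Basis. (c z * (dir_deriv v g z \<bullet> i)) *\<^sub>R dir_deriv i f (g z))
        + dir_deriv v c z *\<^sub>R f (g z))"
      unfolding h
    proof
      fix z
      show "dir_deriv v (\<lambda>z. c z *\<^sub>R f (g z)) z =
          (\<Sum>i\<in>Basis. (c z * (dir_deriv v g z \<bullet> i)) *\<^sub>R dir_deriv i f (g z))
        + dir_deriv v c z *\<^sub>R f (g z)"
        using expand[OF f, of "dir_deriv v g z" "g z"]
        by (subst dir_deriv_eq[OF D2[OF f c]]) (simp add: scaleR_sum_right)
    qed
    show "sum_closure S (dir_deriv v h)"
      unfolding eq
    proof (intro sum_closure.add sum_closure_sum sum_closure.base finite_Basis)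
      fix i :: 'b
      have "smooth_fun (\<lambda>z. c z * (dir_deriv v g z \<bullet> i))"
        by (intro smooth_fun_mult c inner smooth_fun_dir_deriv g)
      then show "(\<lambda>z. (c z * (dir_deriv v g z \<bullet> i)) *\<^sub>R dir_deriv i f (g z)) \<in> S"
        by (rule SI[OF _ smooth_fun_dir_deriv[OF f]])
      show "(\<lambda>z. dir_deriv v c z *\<^sub>R f (g z)) \<in> S"
        by (rule SI[OF smooth_fun_dir_deriv[OF c] f])
    qed
  qed
  then show "smooth_fun (\<lambda>z. f (g z))" by simp
qed

section \<open>Fourier series on the circle\<close>

lemma continuous_antiderivative:
  fixes f :: "real \<Rightarrow> 'a::euclidean_space"
  assumes "continuous_on UNIV f"
  obtains F where "\<And>x. (F has_vector_derivative f x) (at x)"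
  using einterval_antiderivative[of "-\<infinity>" \<infinity> f] assms
  by (auto simp: continuous_on_eq_continuous_at)

text \<open>The increment \<open>F (t + p) - F t\<close> of an antiderivative has derivative zero by
  periodicity. It is thus one constant, and both integrals equal it.\<close>

lemma integral_periodic_shift:
  fixes h :: "real \<Rightarrow> 'a::euclidean_space"
  assumes h: "continuous_on UNIV h" and per: "\<And>t. h (t + p) = h t" and "0 \<le> p"
  shows "integral {a..a + p} (\<lambda>t. h (t + c)) = integral {0..p} h"
proof -
  obtain F where F: "\<And>x. (F has_vector_derivative h x) (at x)"
    using continuous_antiderivative[OF h] by blast
  have shift: "((\<lambda>t. F (t + c)) has_vector_derivative h (t + c)) (at t)" for c t
    using vector_diff_chain_at[of "\<lambda>t. t + c" 1 t F "h (t + c)"] F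
    by (simp add: o_def has_vector_derivative_add_const has_vector_derivative_id)
  have int: "((\<lambda>t. h (t + c)) has_integral F (b + c) - F (a + c)) {a..b}" if "a \<le> b" for a b c
    using that shift by (intro fundamental_theorem_of_calculus)
      (auto intro: has_vector_derivative_at_within)
  have "((\<lambda>t. F (t + p) - F t) has_vector_derivative 0) (at t within UNIV)" for t
    using has_vector_derivative_diff[OF shift[of p] F] per by simp
  then obtain d where d: "\<And>t. F (t + p) - F t = d"
    using has_vector_derivative_zero_constant[of UNIV "\<lambda>t. F (t + p) - F t"] by auto
  have "integral {a..a + p} (\<lambda>t. h (t + c)) = F (a + c + p) - F (a + c)"
    using integral_unique[OF int[of a "a + p" c]] \<open>0 \<le> p\<close> by (simp add: add_ac)
  also have "\<dots> = F (0 + p) - F 0" by (simp add: d del: add_0)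
  also have "\<dots> = integral {0..p} h"
    using integral_unique[OF int[of 0 p 0]] \<open>0 \<le> p\<close> by simp
  finally show ?thesis .
qed

lemma has_vector_derivative_cis:
  "((\<lambda>t. cis (c * t)) has_vector_derivative \<i> * of_real c * cis (c * t)) (at t within S)"
  using exp_scaleR_has_vector_derivative_right[of "\<i> * of_real c" t S]
  by (simp add: cis_conv_exp scaleR_conv_of_real mult_ac)

lemma has_vector_derivative_imp_quotient_tendsto:
  fixes f :: "real \<Rightarrow> complex"
  assumes "(f has_vector_derivative d) (at x)"
  shows "((\<lambda>t. (f t - f x) / of_real (t - x)) \<longlongrightarrow> d) (at x)"
proof -
  have "((\<lambda>t. norm (f t - f x - (t - x) *\<^sub>R d) / norm (t - x)) \<longlongrightarrow> 0) (at x)"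
    using assms unfolding has_vector_derivative_def has_derivative_iff_norm by (rule conjunct2)
  moreover have "eventually (\<lambda>t. norm (f t - f x - (t - x) *\<^sub>R d) / norm (t - x)
      = norm ((f t - f x) / of_real (t - x) - d)) (at x)"
    unfolding eventually_at_filter
  proof (intro always_eventually allI impI)
    fix t assume "t \<noteq> x"
    then have "(f t - f x) / of_real (t - x) - d = (f t - f x - (t - x) *\<^sub>R d) / of_real (t - x)"
      by (simp add: diff_divide_distrib scaleR_conv_of_real del: of_real_diff)
    then show "norm (f t - f x - (t - x) *\<^sub>R d) / norm (t - x) = norm ((f t - f x) / of_real (t - x) - d)"
      by (simp only: norm_divide norm_of_real real_norm_def)
  qed
  ultimately have "((\<lambda>t. norm ((f t - f x) / of_real (t - x) - d)) \<longlongrightarrow> 0) (at x)"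
    by (rule Lim_transform_eventually)
  then show ?thesis
    by (rule LIM_zero_cancel[OF tendsto_norm_zero_cancel])
qed

lemma cis_2pi_int: "cis (2 * pi * of_int n) = 1"
  by (metis cis_multiple_2pi Ints_of_int)

lemma integral_cis_int:
  "integral {-pi..pi} (\<lambda>t. cis (of_int n * t)) = (if n = 0 then 2 * of_real pi else 0)"
proof (cases "n = 0")
  case False
  have "((\<lambda>t. cis (of_int n * t)) has_integral
      cis (of_int n * pi) / (\<i> * of_int n) - cis (of_int n * (-pi)) / (\<i> * of_int n)) {-pi..pi}"
  proof (rule fundamental_theorem_of_calculus)
    fix t assume "t \<in> {-pi..pi}"
    show "((\<lambda>t. cis (of_int n * t) / (\<i> * of_int n)) has_vector_derivative cis (of_int n * t))
        (at t within {-pi..pi})"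
      using has_vector_derivative_divide[OF has_vector_derivative_cis[of "of_int n" t "{-pi..pi}"],
          of "\<i> * of_int n"] False by simp
  qed simp
  moreover have "cis (of_int n * pi) = cis (of_int n * (-pi))"
    using cis_mult[of "of_int n * (-pi)" "2 * pi * of_int n"] cis_2pi_int[of n]
    by (simp add: algebra_simps)
  ultimately show ?thesis using False by (simp add: integral_unique)
qed (simp add: scaleR_conv_of_real)

text \<open>The trigonometric polynomial \<open>S\<close> is the orthogonal projection of
  \<open>g\<close>. The pairings of \<open>S\<close> with \<open>g\<close> and with itself have the
  common value \<open>D\<close>, so the squared norm of \<open>g - S\<close> is that of
  \<open>g\<close> minus \<open>D\<close>, and it is nonnegative.\<close>

lemma Bessel_inequality:
  fixes g :: "real \<Rightarrow> complex"
  assumes g: "continuous_on {-pi..pi} g" and F: "finite F"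
  defines "G \<equiv> \<lambda>n::int. integral {-pi..pi} (\<lambda>t. g t * cis (- of_int n * t))"
  shows "(\<Sum>n\<in>F. (cmod (G n))\<^sup>2) \<le> 2 * pi * integral {-pi..pi} (\<lambda>t. (cmod (g t))\<^sup>2)"
proof -
  define S where "S t = (\<Sum>n\<in>F. G n / (2 * of_real pi) * cis (of_int n * t))" for t
  have ci: "f integrable_on {-pi..pi}" if "continuous_on {-pi..pi} f" for f :: "real \<Rightarrow> complex"
    using that by (rule integrable_continuous_real)
  have Gn: "integral {-pi..pi} (\<lambda>t. g t * cis (- of_int n * t)) = G n" for n
    by (simp add: G_def)
  have ofr: "integral {-pi..pi} (\<lambda>t. complex_of_real (f t)) = of_real (integral {-pi..pi} f)"
    if "continuous_on {-pi..pi} f" for f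
    using integral_linear[OF integrable_continuous_real[OF that] bounded_linear_of_real]
    by (simp add: o_def)
  have cS: "continuous_on {-pi..pi} S"
    unfolding S_def by (intro continuous_intros)
  have coS: "integral {-pi..pi} (\<lambda>t. S t * cis (- of_int m * t)) = (if m \<in> F then G m else 0)" for m
  proof -
    have "integral {-pi..pi} (\<lambda>t. S t * cis (- of_int m * t))
        = integral {-pi..pi} (\<lambda>t. \<Sum>n\<in>F. G n / (2 * of_real pi) * cis (of_int (n - m) * t))"
    proof (intro integral_cong)
      fix t :: real
      have "cis (of_int (n - m) * t) = cis (of_int n * t) * cis (- of_int m * t)" for n
        by (simp add: cis_mult algebra_simps)
      then show "S t * cis (- of_int m * t)
          = (\<Sum>n\<in>F. G n / (2 * of_real pi) * cis (of_int (n - m) * t))"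
        by (simp add: S_def sum_distrib_right mult.assoc)
    qed
    also have "\<dots> = (\<Sum>n\<in>F. G n / (2 * of_real pi) * integral {-pi..pi} (\<lambda>t. cis (of_int (n - m) * t)))"
      by (subst integral_sum[OF F]) (auto intro!: ci continuous_intros)
    also have "\<dots> = (\<Sum>n\<in>F. if n = m then G n else 0)"
      by (intro sum.cong) (auto simp: integral_cis_int simp del: of_int_diff)
    finally show ?thesis using F by simp
  qed
  have pair: "integral {-pi..pi} (\<lambda>t. f t * cnj (S t))
      = (\<Sum>n\<in>F. cnj (G n) / (2 * of_real pi) * integral {-pi..pi} (\<lambda>t. f t * cis (- of_int n * t)))"
    if f: "continuous_on {-pi..pi} f" for f
  proof -
    have "integral {-pi..pi} (\<lambda>t. f t * cnj (S t))
        = integral {-pi..pi} (\<lambda>t. \<Sum>n\<in>F. cnj (G n) / (2 * of_real pi) * (f t * cis (- of_int n * t)))"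
      unfolding S_def by (intro integral_cong) (simp add: sum_distrib_left cis_cnj mult_ac)
    also have "\<dots> = (\<Sum>n\<in>F. cnj (G n) / (2 * of_real pi) * integral {-pi..pi} (\<lambda>t. f t * cis (- of_int n * t)))"
      by (subst integral_sum[OF F]) (auto intro!: ci continuous_intros f)
    finally show ?thesis .
  qed
  define D where "D = (\<Sum>n\<in>F. (cmod (G n))\<^sup>2) / (2 * pi)"
  have gS: "integral {-pi..pi} (\<lambda>t. g t * cnj (S t)) = of_real D"
    unfolding pair[OF g] D_def Gn
    by (simp add: sum_divide_distrib complex_norm_square mult_ac del: of_real_power)
  have SS: "integral {-pi..pi} (\<lambda>t. S t * cnj (S t)) = of_real D"
    unfolding pair[OF cS] coS D_def
    by (simp add: sum_divide_distrib complex_norm_square mult_ac del: of_real_power)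
  have "integral {-pi..pi} (\<lambda>t. S t * cnj (g t)) = cnj (integral {-pi..pi} (\<lambda>t. g t * cnj (S t)))"
    by (simp add: integral_cnj mult.commute)
  then have Sg: "integral {-pi..pi} (\<lambda>t. S t * cnj (g t)) = of_real D"
    by (simp add: gS)
  have gg: "integral {-pi..pi} (\<lambda>t. g t * cnj (g t)) = of_real (integral {-pi..pi} (\<lambda>t. (cmod (g t))\<^sup>2))"
    by (simp add: complex_norm_square[symmetric] ofr continuous_intros g del: of_real_power)
  have "of_real (integral {-pi..pi} (\<lambda>t. (cmod (g t - S t))\<^sup>2))
      = integral {-pi..pi} (\<lambda>t. g t * cnj (g t) - g t * cnj (S t) - (S t * cnj (g t) - S t * cnj (S t)))"
    by (subst ofr[symmetric], intro continuous_intros g cS, intro integral_cong)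
       (simp add: complex_norm_square algebra_simps del: of_real_power)
  also have "\<dots> = of_real (integral {-pi..pi} (\<lambda>t. (cmod (g t))\<^sup>2)) - of_real D - (of_real D - of_real D)"
    by (subst integral_diff integral_diff[OF ci ci],
        (intro ci continuous_intros g cS)+)+ (simp add: gg gS SS Sg)
  finally have "of_real (integral {-pi..pi} (\<lambda>t. (cmod (g t - S t))\<^sup>2))
      = (of_real (integral {-pi..pi} (\<lambda>t. (cmod (g t))\<^sup>2) - D) :: complex)" by simp
  then have "integral {-pi..pi} (\<lambda>t. (cmod (g t - S t))\<^sup>2)
      = integral {-pi..pi} (\<lambda>t. (cmod (g t))\<^sup>2) - D"
    using of_real_eq_iff by blast
  moreover have "0 \<le> integral {-pi..pi} (\<lambda>t. (cmod (g t - S t))\<^sup>2)"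
    by (rule integral_nonneg) (auto intro!: integrable_continuous_real continuous_intros g cS)
  ultimately have "D \<le> integral {-pi..pi} (\<lambda>t. (cmod (g t))\<^sup>2)" by simp
  then show ?thesis
    by (simp add: D_def pos_divide_le_eq mult_ac)
qed

text \<open>Chernoff's trick: since \<open>h t - h 0 = (cis t - 1) * g t\<close> with \<open>g\<close> continuous, the Fourier
  series of \<open>h\<close> at \<open>0\<close> telescopes up to coefficients of \<open>g\<close>, which tend to \<open>0\<close>.\<close>

lemma Fourier_inversion_at_0:
  fixes h :: "real \<Rightarrow> complex"
  assumes h: "continuous_on {-pi..pi} h" and h': "(h has_vector_derivative d) (at 0)"
    and summ: "H summable_on (UNIV :: int set)"
    and H_def: "\<And>n. H n = integral {-pi..pi} (\<lambda>t. h t * cis (- of_int n * t))"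
  shows "(H has_sum (2 * of_real pi * h 0)) UNIV"
proof -
  \<comment> \<open>The value at 0 is the limit of the quotient: numerator and denominator vanish
    there with derivatives \<open>d\<close> and \<i>.\<close>
  define g where "g t = (if t = 0 then d / \<i> else (h t - h 0) / (cis t - 1))" for t
  \<comment> \<open>On the interval from -pi to pi the only zero of \<open>cis t - 1\<close> is 0,
    so the singularity is interior and one derivative of \<open>h\<close> removes it.\<close>
  have cis1: "cis t \<noteq> 1" if "t \<in> {-pi..pi}" "t \<noteq> 0" for t
  proof
    assume "cis t = 1"
    then have "cos t = 1" by (simp add: complex_eq_iff)
    then have "cos \<bar>t\<bar> = cos 0" by simp
    moreover have "\<bar>t\<bar> \<le> pi" using that by auto
    ultimately show False using cos_inj_pi[of "\<bar>t\<bar>" 0] that by simp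
  qed
  have gt: "g t * (cis t - 1) = h t - h 0" if "t \<in> {-pi..pi}" for t
    using cis1[OF that] by (simp add: g_def)
  have quot: "((\<lambda>t. (h t - h 0) / of_real t / ((cis t - 1) / of_real t)) \<longlongrightarrow> d / \<i>) (at 0)"
  proof (rule tendsto_divide)
    show "((\<lambda>t. (h t - h 0) / of_real t) \<longlongrightarrow> d) (at 0)"
      using has_vector_derivative_imp_quotient_tendsto[OF h'] by simp
    show "((\<lambda>t. (cis t - 1) / of_real t) \<longlongrightarrow> \<i>) (at 0)"
      using has_vector_derivative_imp_quotient_tendsto[OF has_vector_derivative_cis[of 1 0 UNIV]]
      by simp
  qed simp
  have g0: "(g \<longlongrightarrow> g 0) (at 0)"
  proof -
    have "eventually (\<lambda>t. (h t - h 0) / of_real t / ((cis t - 1) / of_real t) = g t) (at 0)"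
      by (simp add: eventually_at_filter g_def)
    from Lim_transform_eventually[OF quot this] show ?thesis
      by (simp only: g_def[of 0] simp_thms if_True)
  qed
  have cg: "continuous_on {-pi..pi} g"
    unfolding continuous_on_def
  proof
    fix t assume t: "t \<in> {-pi..pi}"
    show "(g \<longlongrightarrow> g t) (at t within {-pi..pi})"
    proof (cases "t = 0")
      case True
      then show ?thesis using tendsto_within_subset[OF g0 subset_UNIV] by simp
    next
      case False
      have "((\<lambda>t. (h t - h 0) / (cis t - 1)) \<longlongrightarrow> (h t - h 0) / (cis t - 1)) (at t within {-pi..pi})"
        using h t cis1[OF t False]
        by (auto simp: continuous_on_def intro!: tendsto_intros)
      moreover have "eventually (\<lambda>t. (h t - h 0) / (cis t - 1) = g t) (at t within {-pi..pi})"
        using False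
        by (auto simp: g_def eventually_at intro!: exI[of _ "\<bar>t\<bar>"])
      ultimately have "(g \<longlongrightarrow> (h t - h 0) / (cis t - 1)) (at t within {-pi..pi})"
        by (rule Lim_transform_eventually)
      then show ?thesis using False by (simp add: g_def)
    qed
  qed
  define G where "G n = integral {-pi..pi} (\<lambda>t. g t * cis (- of_int n * t))" for n :: int
  \<comment> \<open>Multiplication by \<open>cis t\<close> shifts the index of a coefficient by one,
    and subtracting the constant \<open>h 0\<close> changes only the coefficient of index 0.\<close>
  have tele: "H n - (if n = 0 then 2 * of_real pi * h 0 else 0) = G (n - 1) - G n" for n
  proof -
    have "G (n - 1) - G n
        = integral {-pi..pi} (\<lambda>t. g t * cis (- of_int (n - 1) * t) - g t * cis (- of_int n * t))"
      unfolding G_def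
      by (intro integral_diff[symmetric] integrable_continuous_real continuous_intros cg)
    also have "\<dots> = integral {-pi..pi} (\<lambda>t. h t * cis (- of_int n * t) - h 0 * cis (of_int (-n) * t))"
    proof (rule integral_cong)
      fix t assume t: "t \<in> {-pi..pi}"
      have "cis (- of_int (n - 1) * t) = cis t * cis (- of_int n * t)"
        by (simp add: cis_mult algebra_simps)
      then have "g t * cis (- of_int (n - 1) * t) - g t * cis (- of_int n * t)
          = g t * (cis t - 1) * cis (- of_int n * t)"
        by (simp only:) (simp add: algebra_simps)
      also have "\<dots> = h t * cis (- of_int n * t) - h 0 * cis (of_int (-n) * t)"
        by (simp only: gt[OF t]) (simp add: algebra_simps)
      finally show "g t * cis (- of_int (n - 1) * t) - g t * cis (- of_int n * t)
          = h t * cis (- of_int n * t) - h 0 * cis (of_int (-n) * t)" .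
    qed
    also have "\<dots> = H n - integral {-pi..pi} (\<lambda>t. h 0 * cis (of_int (-n) * t))"
      unfolding H_def
      by (intro integral_diff integrable_continuous_real continuous_intros h)
    also have "integral {-pi..pi} (\<lambda>t. h 0 * cis (of_int (-n) * t)) = (if n = 0 then 2 * of_real pi * h 0 else 0)"
      by (subst integral_mult_right) (subst integral_cis_int, simp)
    finally show ?thesis by simp
  qed
  have partial: "(\<Sum>n=-int N..int N. H n) = 2 * of_real pi * h 0 + G (- int N - 1) - G (int N)" for N
  proof -
    have "(\<Sum>n=-int N..int N. G (n - 1) - G n) = G (- int N - 1) - G (int N)"
    proof (induction N)
      case (Suc N)
      have "{- int (Suc N)..int (Suc N)} = insert (int (Suc N)) (insert (- int (Suc N)) {- int N..int N})"
        by auto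
      then have step: "(\<Sum>n=-int (Suc N)..int (Suc N). F n)
          = F (int (Suc N)) + (F (- int (Suc N)) + (\<Sum>n=-int N..int N. F n))" for F :: "int \<Rightarrow> complex"
        by simp
      have e: "int (Suc N) - 1 = int N" "- int (Suc N) = - int N - 1" by auto
      show ?case unfolding step by (simp only: e Suc.IH) algebra
    qed simp
    moreover have "(\<Sum>n=-int N..int N. H n - (if n = 0 then 2 * of_real pi * h 0 else 0))
        = (\<Sum>n=-int N..int N. H n) - 2 * of_real pi * h 0"
      by (simp add: sum_subtractf)
    ultimately show ?thesis unfolding tele by algebra
  qed
  have "(\<lambda>n. (cmod (G n))\<^sup>2) summable_on UNIV"
    using Bessel_inequality[OF cg]
    by (intro nonneg_bdd_above_summable_on)
       (auto simp: G_def intro!: bdd_aboveI[where M = "2 * pi * integral {-pi..pi} (\<lambda>t. (cmod (g t))\<^sup>2)"])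
  \<comment> \<open>Square summability, from Bessel's inequality, forces the coefficients to tend to
    0 along every sequence of distinct indices.\<close>
  then have G0: "(\<lambda>N. G (f N)) \<longlonglongrightarrow> 0" if "inj f" for f :: "nat \<Rightarrow> int"
  proof -
    assume "(\<lambda>n. (cmod (G n))\<^sup>2) summable_on UNIV"
    then have "(\<lambda>n. (cmod (G n))\<^sup>2) summable_on range f"
      by (rule summable_on_subset_banach) simp
    then have "(\<lambda>N. (cmod (G (f N)))\<^sup>2) summable_on UNIV"
      using summable_on_reindex[OF that, of "\<lambda>n. (cmod (G n))\<^sup>2"] by (simp add: o_def)
    then have "(\<lambda>N. (cmod (G (f N)))\<^sup>2) \<longlonglongrightarrow> 0"
      by (intro summable_LIMSEQ_zero summable_on_imp_summable)
    from tendsto_real_sqrt[OF this] show ?thesis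
      by (simp add: tendsto_norm_zero_iff)
  qed
  have "(\<lambda>N. 2 * of_real pi * h 0 + G (- int N - 1) - G (int N)) \<longlonglongrightarrow> 2 * of_real pi * h 0 + 0 - 0"
    by (intro tendsto_intros G0) (auto simp: inj_def)
  then have lim: "(\<lambda>N. \<Sum>n=-int N..int N. H n) \<longlonglongrightarrow> 2 * of_real pi * h 0"
    by (simp add: partial)
  \<comment> \<open>Summability already gives a limit over all finite index sets. The symmetric
    intervals are cofinal among these, so the telescoped sums identify that limit.\<close>
  have "filterlim (\<lambda>N. {-int N..int N}) (finite_subsets_at_top UNIV) sequentially"
    unfolding filterlim_finite_subsets_at_top
  proof (intro allI impI)
    fix X :: "int set" assume "finite X \<and> X \<subseteq> UNIV"
    then have fin: "finite (insert 0 (abs ` X))" by simp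
    define M where "M = Max (insert 0 (abs ` X))"
    have M: "\<bar>x\<bar> \<le> M" if "x \<in> X" for x
      unfolding M_def using fin that by (intro Max_ge) auto
    have "X \<subseteq> {-int N..int N}" if "nat M \<le> N" for N
      using M that by fastforce
    then show "\<forall>\<^sub>F N in sequentially. finite {-int N..int N} \<and> X \<subseteq> {-int N..int N} \<and> {-int N..int N} \<subseteq> UNIV"
      by (intro eventually_sequentiallyI[of "nat M"]) auto
  qed
  then have "(\<lambda>N. \<Sum>n=-int N..int N. H n) \<longlonglongrightarrow> infsum H UNIV"
    by (rule filterlim_compose[OF infsum_tendsto[OF summ]])
  then have "infsum H UNIV = 2 * of_real pi * h 0"
    using lim by (rule LIMSEQ_unique)
  then show ?thesis using has_sum_infsum[OF summ] by simp
qed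

definition circle_coeff :: "(real \<Rightarrow> complex) \<Rightarrow> int \<Rightarrow> complex" where
  "circle_coeff h n = integral {0..2 * pi} (\<lambda>t. h t * cis (- of_int n * t)) / (2 * of_real pi)"

lemma circle_coeff_bound:
  assumes "continuous_on UNIV h" and B: "\<And>t. cmod (h t) \<le> B"
  shows "cmod (circle_coeff h n) \<le> B"
proof -
  have "norm (integral {0..2 * pi} (\<lambda>t. h t * cis (- of_int n * t))) \<le> integral {0..2 * pi} (\<lambda>t. B)"
    using assms
    by (intro integral_norm_bound_integral integrable_continuous_real continuous_intros)
       (auto simp: norm_mult intro: continuous_on_subset)
  then show ?thesis
    by (simp add: circle_coeff_def norm_divide norm_mult divide_simps mult_ac)
qed

lemma circle_coeff_deriv:
  fixes h :: "real \<Rightarrow> complex"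
  assumes h: "\<And>t. (h has_vector_derivative h' t) (at t)" and h': "continuous_on UNIV h'"
    and per: "\<And>t. h (t + 2 * pi) = h t"
  shows "circle_coeff h' n = \<i> * of_int n * circle_coeff h n"
proof -
  have ch: "continuous_on S h" for S
    using h by (intro continuous_at_imp_continuous_on) (auto intro: has_vector_derivative_continuous)
  have ch': "continuous_on S h'" for S
    using h' by (rule continuous_on_subset) simp
  have "((\<lambda>t. h t * (\<i> * of_real (- of_int n) * cis (- of_int n * t)) + h' t * cis (- of_int n * t)) has_integral
      h (2 * pi) * cis (- of_int n * (2 * pi)) - h 0 * cis (- of_int n * 0)) {0..2 * pi}"
    by (intro fundamental_theorem_of_calculus has_vector_derivative_mult has_vector_derivative_cis)
       (auto intro: has_vector_derivative_at_within h)
  moreover have "h (2 * pi) * cis (- of_int n * (2 * pi)) - h 0 * cis (- of_int n * 0) = 0"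
    using per[of 0] cis_2pi_int[of "-n"] by (simp add: mult_ac)
  ultimately have "integral {0..2 * pi} (\<lambda>t. - (\<i> * of_int n) * (h t * cis (- of_int n * t))
      + h' t * cis (- of_int n * t)) = 0"
    by (simp add: integral_unique mult_ac)
  moreover have "integral {0..2 * pi} (\<lambda>t. - (\<i> * of_int n) * (h t * cis (- of_int n * t))
      + h' t * cis (- of_int n * t)) = - (\<i> * of_int n) * integral {0..2 * pi} (\<lambda>t. h t * cis (- of_int n * t))
      + integral {0..2 * pi} (\<lambda>t. h' t * cis (- of_int n * t))"
    by (subst integral_add)
       (auto intro!: integrable_continuous_real continuous_intros ch ch')
  ultimately show ?thesis
    by (simp add: circle_coeff_def add_eq_0_iff)
qed

text \<open>Integrating by parts twice shows that the coefficient of \<open>h - h''\<close> is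
  \<open>1 + n^2\<close> times that of \<open>h\<close>. Using this combination instead of
  \<open>h''\<close> alone covers \<open>n = 0\<close> as well.\<close>

lemma circle_coeff_decay:
  fixes h :: "real \<Rightarrow> complex"
  assumes h: "\<And>t. (h has_vector_derivative h' t) (at t)"
    and h': "\<And>t. (h' has_vector_derivative h'' t) (at t)" and h'': "continuous_on UNIV h''"
    and per: "\<And>t. h (t + 2 * pi) = h t" and per': "\<And>t. h' (t + 2 * pi) = h' t"
    and B: "\<And>t. cmod (h t - h'' t) \<le> B"
  shows "cmod (circle_coeff h n) \<le> B / (1 + (of_int n)\<^sup>2)"
proof -
  have ch: "continuous_on S h" for S
    using h by (intro continuous_at_imp_continuous_on) (auto intro: has_vector_derivative_continuous)
  have ch': "continuous_on S h'" for S
    using h' by (intro continuous_at_imp_continuous_on) (auto intro: has_vector_derivative_continuous)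
  have ch'': "continuous_on S h''" for S
    using h'' by (rule continuous_on_subset) simp
  have "circle_coeff (\<lambda>t. h t - h'' t) n = circle_coeff h n - circle_coeff h'' n"
    unfolding circle_coeff_def left_diff_distrib
    by (subst integral_diff)
       (auto intro!: integrable_continuous_real continuous_intros ch ch'' simp: diff_divide_distrib)
  also have "\<dots> = of_real (1 + (of_int n)\<^sup>2) * circle_coeff h n"
    by (simp add: circle_coeff_deriv[OF h' h'' per'] circle_coeff_deriv[OF h ch' per]
        power2_eq_square algebra_simps)
  finally have "of_real (1 + (of_int n)\<^sup>2) * circle_coeff h n = circle_coeff (\<lambda>t. h t - h'' t) n" by simp
  then have "(1 + (of_int n)\<^sup>2) * cmod (circle_coeff h n) = cmod (circle_coeff (\<lambda>t. h t - h'' t) n)"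
    by (metis norm_mult norm_of_real abs_of_nonneg add_nonneg_nonneg zero_le_one zero_le_power2)
  also have "\<dots> \<le> B"
    by (rule circle_coeff_bound) (auto intro!: continuous_intros ch ch'' B)
  finally show ?thesis
    by (simp add: pos_le_divide_eq mult.commute add_pos_nonneg)
qed

lemma summable_on_inverse_square_int: "(\<lambda>n::int. 1 / (1 + (real_of_int n)\<^sup>2)) summable_on UNIV"
proof -
  have *: "(\<lambda>n::int. 1 / (1 + (real_of_int n)\<^sup>2)) summable_on range f"
    if f: "inj f" "\<And>n. \<bar>f n\<bar> = int n" for f :: "nat \<Rightarrow> int"
  proof -
    have "summable (\<lambda>n. 1 / (1 + (real n)\<^sup>2))"
    proof (rule summable_comparison_test)
      show "\<exists>N. \<forall>n\<ge>N. norm (1 / (1 + (real n)\<^sup>2)) \<le> inverse (real n ^ 2)"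
        by (intro exI[of _ 1] allI impI) (simp add: inverse_eq_divide frac_le)
      show "summable (\<lambda>n. inverse (real n ^ 2))"
        by (rule inverse_power_summable) simp
    qed
    then have "(\<lambda>n. 1 / (1 + (real n)\<^sup>2)) summable_on UNIV"
      by (intro summable_nonneg_imp_summable_on) auto
    moreover have "(real_of_int (f n))\<^sup>2 = (real n)\<^sup>2" for n
    proof -
      have "(real_of_int (f n))\<^sup>2 = (real_of_int \<bar>f n\<bar>)\<^sup>2" by simp
      then show ?thesis by (simp only: f(2) of_int_of_nat_eq)
    qed
    ultimately have "((\<lambda>n::int. 1 / (1 + (real_of_int n)\<^sup>2)) \<circ> f) summable_on UNIV"
      by (simp add: o_def)
    then show ?thesis
      by (simp only: summable_on_reindex[OF f(1)])
  qed
  have "(\<lambda>n::int. 1 / (1 + (real_of_int n)\<^sup>2)) summable_on (range int \<union> range (\<lambda>n. - int n))"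
    by (intro summable_on_union *) (auto simp: inj_def)
  moreover have "range int \<union> range (\<lambda>n. - int n) = UNIV"
    by (auto simp: image_iff) (metis int_cases2)
  ultimately show ?thesis by simp
qed

text \<open>Translating by \<open>t\<close> reduces the claim to inversion at 0: it multiplies the
  coefficient of index \<open>n\<close> by \<open>cis (n * t)\<close>, and periodicity moves the
  integral to the interval from -pi to pi.\<close>

lemma circle_Fourier_inversion:
  fixes h :: "real \<Rightarrow> complex"
  assumes h: "\<And>t. (h has_vector_derivative h' t) (at t)"
    and per: "\<And>t. h (t + 2 * pi) = h t" and summ: "circle_coeff h summable_on UNIV"
  shows "((\<lambda>n. circle_coeff h n * cis (of_int n * t)) has_sum h t) UNIV"
proof -
  have ch: "continuous_on S h" for S
    using h by (intro continuous_at_imp_continuous_on) (auto intro: has_vector_derivative_continuous)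
  define H where "H n = 2 * of_real pi * (circle_coeff h n * cis (of_int n * t))" for n
  have H: "H n = integral {-pi..pi} (\<lambda>u. h (u + t) * cis (- of_int n * u))" for n
  proof -
    have cis: "cis (- of_int n * (u + 2 * pi)) = cis (- of_int n * u)" for u
      using cis_mult[of "- of_int n * u" "2 * pi * of_int (-n)"] cis_2pi_int[of "-n"]
      by (simp add: algebra_simps)
    have "integral {0..2 * pi} (\<lambda>u. h u * cis (- of_int n * u))
        = integral {-pi..-pi + 2 * pi} (\<lambda>u. h (u + t) * cis (- of_int n * (u + t)))"
      by (rule integral_periodic_shift[symmetric])
         (use cis in \<open>auto intro!: continuous_intros ch simp: per\<close>)
    also have "\<dots> = integral {-pi..pi} (\<lambda>u. cis (- of_int n * t) * (h (u + t) * cis (- of_int n * u)))"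
      by (intro arg_cong2[where f = integral] ext) (auto simp: cis_mult algebra_simps)
    also have "\<dots> = cis (- of_int n * t) * integral {-pi..pi} (\<lambda>u. h (u + t) * cis (- of_int n * u))"
      by simp
    finally show ?thesis
      by (simp add: H_def circle_coeff_def cis_mult)
  qed
  have "(\<lambda>n. norm (circle_coeff h n)) summable_on UNIV"
    using summ by (simp add: summable_on_iff_abs_summable_on_complex)
  then have "(\<lambda>n. norm (circle_coeff h n * cis (of_int n * t))) summable_on UNIV"
    by (simp add: norm_mult)
  then have "H summable_on UNIV"
    unfolding H_def by (rule summable_on_cmult_right[OF abs_summable_summable])
  moreover have "((\<lambda>u. h (u + t)) has_vector_derivative h' t) (at 0)"
    using vector_diff_chain_at[of "\<lambda>u. u + t" 1 0 h "h' t"] h[of t]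
    by (simp add: o_def has_vector_derivative_add_const has_vector_derivative_id)
  moreover have "continuous_on {-pi..pi} (\<lambda>u. h (u + t))"
    by (intro continuous_on_compose2[OF ch[of UNIV]] continuous_intros) auto
  ultimately have "(H has_sum (2 * of_real pi * h (0 + t))) UNIV"
    by (intro Fourier_inversion_at_0[of "\<lambda>u. h (u + t)" "h' t" H] H)
  from has_sum_cmult_right[OF this, of "1 / (2 * of_real pi)"] show ?thesis
    by (simp add: H_def)
qed

section \<open>Mean values over the torus\<close>

definition torus_mean :: "(real \<times> real \<Rightarrow> 'a::euclidean_space) \<Rightarrow> 'a" where
  "torus_mean \<phi> = (1 / (2 * pi)\<^sup>2) *\<^sub>R integral (cbox (0, 0) (2 * pi, 2 * pi)) \<phi>"

lemma integrable_torus: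
  fixes \<phi> :: "real \<times> real \<Rightarrow> 'a::euclidean_space"
  shows "continuous_on UNIV \<phi> \<Longrightarrow> \<phi> integrable_on cbox (0, 0) (2 * pi, 2 * pi :: real)"
  by (rule integrable_continuous) (rule continuous_on_subset[OF _ subset_UNIV])

lemma torus_mean_add:
  assumes "continuous_on UNIV \<phi>" "continuous_on UNIV \<psi>"
  shows "torus_mean (\<lambda>z. \<phi> z + \<psi> z) = torus_mean \<phi> + torus_mean \<psi>"
  unfolding torus_mean_def by (simp add: integral_add integrable_torus assms scaleR_right_distrib)

lemma torus_mean_cmult: "torus_mean (\<lambda>z. c * \<phi> z) = c * torus_mean \<phi>" for c :: complex
  unfolding torus_mean_def by simp

lemma torus_mean_const: "torus_mean (\<lambda>z. c) = c"
  unfolding torus_mean_def by (simp add: content_Pair power2_eq_square)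

lemma torus_mean_sum:
  assumes "finite F" "\<And>k. k \<in> F \<Longrightarrow> continuous_on UNIV (\<phi> k)"
  shows "torus_mean (\<lambda>z. \<Sum>k\<in>F. \<phi> k z) = (\<Sum>k\<in>F. torus_mean (\<phi> k))"
  unfolding torus_mean_def
  using assms by (simp add: integral_sum integrable_torus scaleR_sum_right)

lemma torus_mean_cnj: "torus_mean (\<lambda>z. cnj (\<phi> z)) = cnj (torus_mean \<phi>)"
  unfolding torus_mean_def by (simp add: integral_cnj)

lemma torus_mean_of_real:
  assumes "continuous_on UNIV f"
  shows "torus_mean (\<lambda>z. complex_of_real (f z)) = of_real (torus_mean f)"
  unfolding torus_mean_def
  using integral_linear[OF integrable_torus[OF assms] bounded_linear_of_real]
  by (simp add: o_def scaleR_conv_of_real)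

lemma torus_mean_mono:
  fixes f g :: "real \<times> real \<Rightarrow> real"
  assumes "continuous_on UNIV f" "continuous_on UNIV g" "\<And>z. f z \<le> g z"
  shows "torus_mean f \<le> torus_mean g"
  unfolding torus_mean_def
  by (intro scaleR_left_mono integral_le integrable_torus assms) simp

lemma torus_mean_bound:
  assumes "continuous_on UNIV \<phi>" "\<And>z. norm (\<phi> z) \<le> B"
  shows "norm (torus_mean \<phi>) \<le> B"
proof -
  have "norm (integral (cbox (0, 0) (2 * pi, 2 * pi)) \<phi>) \<le> integral (cbox (0, 0) (2 * pi, 2 * pi :: real)) (\<lambda>z. B)"
    using assms by (intro integral_norm_bound_integral integrable_torus) auto
  then have "(1 / (2 * pi)\<^sup>2) * norm (integral (cbox (0, 0) (2 * pi, 2 * pi)) \<phi>) \<le> torus_mean (\<lambda>_. B)"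
    unfolding torus_mean_def real_scaleR_def by (rule mult_left_mono) simp
  then show ?thesis
    by (simp add: torus_mean_const) (simp add: torus_mean_def)
qed

lemma torus_mean_iterated:
  fixes \<phi> :: "real \<times> real \<Rightarrow> 'a::euclidean_space"
  assumes "continuous_on UNIV \<phi>"
  shows "torus_mean \<phi> = (1 / (2 * pi)\<^sup>2) *\<^sub>R
      integral {0..2 * pi} (\<lambda>t. integral {0..2 * pi} (\<lambda>x. \<phi> (t, x)))"
    and "torus_mean \<phi> = (1 / (2 * pi)\<^sup>2) *\<^sub>R
      integral {0..2 * pi} (\<lambda>x. integral {0..2 * pi} (\<lambda>t. \<phi> (t, x)))"
proof -
  have c: "continuous_on (cbox (0, 0) (2 * pi, 2 * pi)) (\<lambda>(t, x). \<phi> (t, x))"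
    using assms continuous_on_subset by auto
  show *: "torus_mean \<phi> = (1 / (2 * pi)\<^sup>2) *\<^sub>R
      integral {0..2 * pi} (\<lambda>t. integral {0..2 * pi} (\<lambda>x. \<phi> (t, x)))"
    unfolding torus_mean_def using integral_prod_continuous[OF c] by simp
  show "torus_mean \<phi> = (1 / (2 * pi)\<^sup>2) *\<^sub>R
      integral {0..2 * pi} (\<lambda>x. integral {0..2 * pi} (\<lambda>t. \<phi> (t, x)))"
    unfolding * using integral_swap_continuous[OF c] by simp
qed

lemma torus_mean_tendsto:
  assumes "uniform_limit UNIV f \<phi> F" "\<And>n. continuous_on UNIV (f n)" "F \<noteq> bot"
  shows "((\<lambda>n. torus_mean (f n)) \<longlongrightarrow> torus_mean \<phi>) F"
proof -
  obtain I J where *: "\<And>n. (f n has_integral I n) (cbox (0, 0) (2 * pi, 2 * pi))"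
    "(\<phi> has_integral J) (cbox (0, 0) (2 * pi, 2 * pi))" "(I \<longlongrightarrow> J) F"
    using uniform_limit_integral_cbox[OF uniform_limit_on_subset[OF assms(1) subset_UNIV]
        continuous_on_subset[OF assms(2) subset_UNIV] assms(3)] by metis
  have "integral (cbox (0, 0) (2 * pi, 2 * pi)) (f n) = I n" for n
    by (rule integral_unique[OF *(1)])
  then show ?thesis
    unfolding torus_mean_def integral_unique[OF *(2)] using *(3) by (simp add: tendsto_scaleR)
qed

text \<open>For fixed \<open>t\<close> the shear is a translation in \<open>x\<close> by
  \<open>A t\<close>, which does not change the integral over a period.\<close>

lemma torus_mean_shear:
  fixes \<phi> :: "real \<times> real \<Rightarrow> 'a::euclidean_space"
  assumes \<phi>: "continuous_on UNIV \<phi>" and A: "continuous_on UNIV A"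
    and per: "\<And>t x. \<phi> (t, x + 2 * pi) = \<phi> (t, x)"
  shows "torus_mean (\<lambda>(t, x). \<phi> (t, x + A t)) = torus_mean \<phi>"
proof -
  have c: "continuous_on UNIV (\<lambda>z. \<phi> (fst z, snd z + A (fst z)))"
    by (intro continuous_on_compose2[OF \<phi>] continuous_intros continuous_on_compose2[OF A]) auto
  have "integral {0..2 * pi} (\<lambda>x. \<phi> (t, x + A t)) = integral {0..2 * pi} (\<lambda>x. \<phi> (t, x))" for t
  proof -
    have "continuous_on UNIV (\<lambda>x. \<phi> (t, x))"
      by (intro continuous_on_compose2[OF \<phi>] continuous_intros) auto
    from integral_periodic_shift[OF this, of "2 * pi" 0 "A t"] show ?thesis
      by (simp add: per)
  qed
  moreover have "(\<lambda>(t, x). \<phi> (t, x + A t)) = (\<lambda>z. \<phi> (fst z, snd z + A (fst z)))"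
    by auto
  ultimately show ?thesis
    using torus_mean_iterated(1)[OF c] torus_mean_iterated(1)[OF \<phi>] by simp
qed

section \<open>Test functions and their Fourier coefficients\<close>

definition trig :: "int \<times> int \<Rightarrow> real \<times> real \<Rightarrow> complex" where
  "trig k z = cis (fst z * of_int (fst k) + snd z * of_int (snd k))"

lemma trig_mult: "trig k z * trig l z = trig (k + l) z"
  by (simp add: trig_def cis_mult algebra_simps)

lemma norm_trig [simp]: "cmod (trig k z) = 1"
  by (simp add: trig_def)

lemma trig_0 [simp]: "trig 0 z = 1"
  by (simp add: trig_def)

lemma cnj_trig: "cnj (trig k z) = trig (- k) z"
  by (simp add: trig_def cis_cnj)

lemma trig_has_derivative:
  "(trig k has_derivative (\<lambda>v. \<i> * of_real (fst v * of_int (fst k) + snd v * of_int (snd k)) * trig k z)) (at z)"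
proof -
  have l: "((\<lambda>z. \<i> * of_real (fst z * of_int (fst k) + snd z * of_int (snd k))) has_derivative
      (\<lambda>v. \<i> * of_real (fst v * of_int (fst k) + snd v * of_int (snd k)))) (at z)"
    by (auto intro!: derivative_eq_intros)
  have "(exp has_derivative (\<lambda>w. exp y * w)) (at y)" for y :: complex
    using DERIV_exp[of y] by (simp add: has_field_derivative_def mult_commute_abs)
  from has_derivative_compose[OF l this] show ?thesis
    by (simp add: trig_def[abs_def] cis_conv_exp mult.commute)
qed

lemma dir_deriv_trig:
  "dir_deriv v (trig k) = (\<lambda>z. \<i> * of_real (fst v * of_int (fst k) + snd v * of_int (snd k)) * trig k z)"
  by (rule dir_deriv_eqI) (rule trig_has_derivative)

lemma smooth_fun_trig: "smooth_fun (trig k)"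
proof (rule smooth_fun_coinduct[where S = "range (\<lambda>c z. c * trig k z)"])
  have "(\<lambda>z. 1 * trig k z) \<in> range (\<lambda>c z. c * trig k z)" by blast
  then show "sum_closure (range (\<lambda>c z. c * trig k z)) (trig k)"
    by (intro sum_closure.base) simp
next
  have D: "((\<lambda>z. c * trig k z) has_derivative (\<lambda>v. c * (\<i> * of_real (fst v * of_int (fst k)
      + snd v * of_int (snd k)) * trig k z))) (at z)" for c z
    by (intro has_derivative_mult_right trig_has_derivative)
  fix f v assume "f \<in> range (\<lambda>c z. c * trig k z)"
  then obtain c where f: "f = (\<lambda>z. c * trig k z)" by blast
  show "f differentiable_on UNIV"
    using D by (force simp: f differentiable_on_def differentiable_def)
  have "dir_deriv v f = (\<lambda>z. (c * \<i> * of_real (fst v * of_int (fst k) + snd v * of_int (snd k))) * trig k z)"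
    unfolding f by (subst dir_deriv_eqI[OF D]) (simp add: mult.assoc)
  then show "sum_closure (range (\<lambda>c z. c * trig k z)) (dir_deriv v f)"
    by (intro sum_closure.base) blast
qed

lemma test_funD:
  assumes "\<phi> \<in> test_fun"
  shows "smooth_fun \<phi>" "\<phi> (t + 2 * pi, x) = \<phi> (t, x)" "\<phi> (t, x + 2 * pi) = \<phi> (t, x)"
  using assms by (auto simp: test_fun_def)

lemma test_fun_continuous: "\<phi> \<in> test_fun \<Longrightarrow> continuous_on S \<phi>"
  using test_funD(1) smooth_fun_continuous by blast

lemma test_fun_const: "(\<lambda>_. c) \<in> test_fun"
  by (simp add: test_fun_def smooth_fun_const)

lemma test_fun_add: "\<phi> \<in> test_fun \<Longrightarrow> \<psi> \<in> test_fun \<Longrightarrow> (\<lambda>z. \<phi> z + \<psi> z) \<in> test_fun"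
  by (simp add: test_fun_def smooth_fun_add)

lemma test_fun_mult: "\<phi> \<in> test_fun \<Longrightarrow> \<psi> \<in> test_fun \<Longrightarrow> (\<lambda>z. \<phi> z * \<psi> z) \<in> test_fun"
  by (simp add: test_fun_def smooth_fun_mult)

lemma test_fun_cmult: "\<phi> \<in> test_fun \<Longrightarrow> (\<lambda>z. c * \<phi> z) \<in> test_fun"
  by (rule test_fun_mult[OF test_fun_const])

lemma test_fun_sum:
  "(\<And>k. k \<in> F \<Longrightarrow> \<phi> k \<in> test_fun) \<Longrightarrow> (\<lambda>z. \<Sum>k\<in>F. \<phi> k z) \<in> test_fun"
  by (induction F rule: infinite_finite_induct) (simp_all add: test_fun_const test_fun_add)

lemma test_fun_trig: "trig k \<in> test_fun"
proof -
  have cis: "cis (y + 2 * pi * of_int n) = cis y" for y n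
    by (simp add: cis_mult[symmetric] cis_2pi_int)
  have "trig k (t + 2 * pi, x) = trig k (t, x)" for t x
    using cis[of "t * of_int (fst k) + x * of_int (snd k)" "fst k"]
    by (simp add: trig_def algebra_simps)
  moreover have "trig k (t, x + 2 * pi) = trig k (t, x)" for t x
    using cis[of "t * of_int (fst k) + x * of_int (snd k)" "snd k"]
    by (simp add: trig_def algebra_simps)
  ultimately show ?thesis
    by (simp add: test_fun_def smooth_fun_trig)
qed

lemma dir_deriv_periodic:
  assumes "smooth_fun f" "\<And>z. f (z + p) = f z"
  shows "dir_deriv v f (z + p) = dir_deriv v f z"
proof -
  have "((\<lambda>z. z + p) has_derivative (\<lambda>v. v)) (at z)"
    by (auto intro!: derivative_eq_intros)
  from has_derivative_compose[OF this smooth_fun_has_derivative[OF assms(1)]]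
  have "(f has_derivative (\<lambda>v. dir_deriv v f (z + p))) (at z)"
    by (simp add: assms(2))
  then show ?thesis by (simp add: dir_deriv_eq)
qed

lemma test_fun_dir_deriv:
  assumes "\<phi> \<in> test_fun" shows "dir_deriv v \<phi> \<in> test_fun"
proof -
  have "\<phi> (z + (2 * pi, 0)) = \<phi> z" "\<phi> (z + (0, 2 * pi)) = \<phi> z" for z
    using test_funD[OF assms] by (cases z; simp)+
  then have "dir_deriv v \<phi> (z + (2 * pi, 0)) = dir_deriv v \<phi> z"
    "dir_deriv v \<phi> (z + (0, 2 * pi)) = dir_deriv v \<phi> z" for z
    using dir_deriv_periodic test_funD(1)[OF assms] by blast+
  from this[of "(t, x)" for t x] show ?thesis
    using smooth_fun_dir_deriv[OF test_funD(1)[OF assms]] by (simp add: test_fun_def)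
qed

lemma test_fun_partials: "\<phi> \<in> test_fun \<Longrightarrow> (partial_t ^^ i) ((partial_x ^^ j) \<phi>) \<in> test_fun"
proof (induction i)
  case 0
  then show ?case by (induction j) (auto intro: test_fun_dir_deriv)
qed (auto intro: test_fun_dir_deriv)

lemma test_fun_circle:
  assumes "b \<in> smooth_circle" shows "(\<lambda>z. of_real (b (fst z))) \<in> test_fun"
  using assms smooth_fun_compose(1)[OF _ smooth_fun_linear[OF bounded_linear_fst], of b]
    smooth_fun_compose(1)[OF smooth_fun_linear[OF bounded_linear_of_real], of "\<lambda>z. b (fst z)"]
  by (auto simp: smooth_circle_def test_fun_def)

lemma smooth_fun_shear:
  assumes "smooth_fun A" shows "smooth_fun (\<lambda>z :: real \<times> real. (fst z, snd z + A (fst z)))"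
    and "dir_deriv v (\<lambda>z. (fst z, snd z + A (fst z))) =
      (\<lambda>z. (fst v, snd v + fst v * dir_deriv 1 A (fst z)))"
proof -
  have l1: "bounded_linear (\<lambda>t::real. (t, 0::real))" and l2: "bounded_linear (\<lambda>x::real. (0::real, x))"
    by (auto intro!: bounded_linear_intros)
  have "smooth_fun (\<lambda>z. z + (0, A (fst z)))"
    by (intro smooth_fun_add smooth_fun_linear bounded_linear_ident
        smooth_fun_compose(1)[OF smooth_fun_linear[OF l2]] smooth_fun_compose(1)[OF assms])
       (auto intro: smooth_fun_linear bounded_linear_fst)
  moreover have "(\<lambda>z :: real \<times> real. z + (0, A (fst z))) = (\<lambda>z. (fst z, snd z + A (fst z)))"
    by (auto simp: fun_eq_iff)
  ultimately show "smooth_fun (\<lambda>z :: real \<times> real. (fst z, snd z + A (fst z)))" by simp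
  show "dir_deriv v (\<lambda>z. (fst z, snd z + A (fst z))) =
      (\<lambda>z. (fst v, snd v + fst v * dir_deriv 1 A (fst z)))"
  proof (rule dir_deriv_eqI)
    fix z :: "real \<times> real"
    have lin: "dir_deriv v A y = v * dir_deriv 1 A y" for v y :: real
      using linear_scale[OF has_derivative_linear[OF smooth_fun_has_derivative[OF assms]], of v 1 y]
      by simp
    have "((\<lambda>z. A (fst z)) has_derivative (\<lambda>v. fst v * dir_deriv 1 A (fst z))) (at z)"
      using has_derivative_compose[OF bounded_linear_imp_has_derivative[OF bounded_linear_fst]
          smooth_fun_has_derivative[OF assms], of z UNIV] by (simp add: lin[of "fst v" for v])
    then show "((\<lambda>z. (fst z, snd z + A (fst z))) has_derivative
        (\<lambda>v. (fst v, snd v + fst v * dir_deriv 1 A (fst z)))) (at z)"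
      by (intro has_derivative_Pair has_derivative_add
          bounded_linear_imp_has_derivative[OF bounded_linear_fst]
          bounded_linear_imp_has_derivative[OF bounded_linear_snd])
  qed
qed

lemma periodic_mod_2pi:
  fixes f :: "real \<Rightarrow> 'a"
  assumes "\<And>t. f (t + 2 * pi) = f t"
  obtains s where "s \<in> {0..2 * pi}" "f s = f t"
proof -
  interpret periodic_fun_simple f "2 * pi" by standard (rule assms)
  define n where "n = \<lfloor>t / (2 * pi)\<rfloor>"
  have "of_int n \<le> t / (2 * pi)" "t / (2 * pi) < of_int n + 1"
    by (auto simp: n_def)
  then have "of_int n * (2 * pi) \<le> t" "t < of_int n * (2 * pi) + 2 * pi"
    by (auto simp: field_simps)
  then have "t - of_int n * (2 * pi) \<in> {0..2 * pi}" by auto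
  moreover have "f (t - of_int n * (2 * pi)) = f t" by (rule minus_of_int)
  ultimately show ?thesis using that by blast
qed

lemma test_fun_bounded:
  assumes "\<phi> \<in> test_fun" obtains B where "\<And>z. cmod (\<phi> z) \<le> B"
proof -
  let ?Q = "cbox (0, 0) (2 * pi, 2 * pi :: real)"
  have "bounded (\<phi> ` ?Q)"
    using compact_continuous_image[OF test_fun_continuous[OF assms] compact_cbox] compact_imp_bounded
    by blast
  then obtain B where B: "\<And>z. z \<in> ?Q \<Longrightarrow> cmod (\<phi> z) \<le> B"
    by (auto simp: bounded_iff)
  have "cmod (\<phi> (t, x)) \<le> B" for t x
  proof -
    obtain s where s: "s \<in> {0..2 * pi}" "\<phi> (s, x) = \<phi> (t, x)"
      using periodic_mod_2pi[of "\<lambda>t. \<phi> (t, x)" t] test_funD(2)[OF assms] by metis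
    obtain y where y: "y \<in> {0..2 * pi}" "\<phi> (s, y) = \<phi> (s, x)"
      using periodic_mod_2pi[of "\<lambda>x. \<phi> (s, x)" x] test_funD(3)[OF assms] by metis
    show ?thesis using B[of "(s, y)"] s y by simp
  qed
  then show ?thesis using that by (metis surj_pair)
qed

lemma partial_has_vector_derivative:
  assumes "smooth_fun \<phi>"
  shows "((\<lambda>t. \<phi> (t, x)) has_vector_derivative partial_t \<phi> (t, x)) (at t)"
    and "((\<lambda>x. \<phi> (t, x)) has_vector_derivative partial_x \<phi> (t, x)) (at x)"
proof -
  note D = smooth_fun_has_derivative[OF assms, of "(t, x)"]
  have lin: "r *\<^sub>R dir_deriv v \<phi> (t, x) = dir_deriv (r *\<^sub>R v) \<phi> (t, x)" for r v
    using linear_scale[OF has_derivative_linear[OF D]] by simp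
  have "((\<lambda>t. (t, x)) has_derivative (\<lambda>r. (r, 0))) (at t)"
    "((\<lambda>x. (t, x)) has_derivative (\<lambda>r. (0, r))) (at x)"
    by (auto intro!: derivative_eq_intros)
  from has_derivative_compose[OF this(1) D] has_derivative_compose[OF this(2) D]
  show "((\<lambda>t. \<phi> (t, x)) has_vector_derivative partial_t \<phi> (t, x)) (at t)"
    "((\<lambda>x. \<phi> (t, x)) has_vector_derivative partial_x \<phi> (t, x)) (at x)"
    by (simp_all add: has_vector_derivative_def lin)
qed

text \<open>With the differentiated variable innermost, the inner integral is a difference of
  endpoint values one period apart.\<close>

lemma torus_mean_partial:
  assumes "\<phi> \<in> test_fun"
  shows "torus_mean (partial_t \<phi>) = 0" "torus_mean (partial_x \<phi>) = 0"
proof -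
  note D = partial_has_vector_derivative[OF test_funD(1)[OF assms]]
  have "integral {0..2 * pi} (\<lambda>t. partial_t \<phi> (t, x)) = \<phi> (2 * pi, x) - \<phi> (0, x)" for x
    by (intro integral_unique fundamental_theorem_of_calculus)
       (auto intro: has_vector_derivative_at_within D)
  moreover have "integral {0..2 * pi} (\<lambda>x. partial_x \<phi> (t, x)) = \<phi> (t, 2 * pi) - \<phi> (t, 0)" for t
    by (intro integral_unique fundamental_theorem_of_calculus)
       (auto intro: has_vector_derivative_at_within D)
  ultimately show "torus_mean (partial_t \<phi>) = 0" "torus_mean (partial_x \<phi>) = 0"
    unfolding torus_mean_iterated(2)[OF test_fun_continuous[OF test_fun_dir_deriv[OF assms]], of "(1, 0)"]
      torus_mean_iterated(1)[OF test_fun_continuous[OF test_fun_dir_deriv[OF assms]], of "(0, 1)"]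
    using test_funD(2)[OF assms, of 0] test_funD(3)[OF assms, of _ 0] by simp_all
qed

definition torus_coeff :: "(real \<times> real \<Rightarrow> complex) \<Rightarrow> int \<times> int \<Rightarrow> complex" where
  "torus_coeff \<phi> k = torus_mean (\<lambda>z. \<phi> z * trig (- k) z)"

lemma torus_coeff_add:
  "\<phi> \<in> test_fun \<Longrightarrow> \<psi> \<in> test_fun \<Longrightarrow>
    torus_coeff (\<lambda>z. \<phi> z + \<psi> z) k = torus_coeff \<phi> k + torus_coeff \<psi> k"
  unfolding torus_coeff_def distrib_right
  by (rule torus_mean_add) (intro test_fun_continuous test_fun_mult test_fun_trig; assumption)+

lemma torus_coeff_cmult: "torus_coeff (\<lambda>z. c * \<phi> z) k = c * torus_coeff \<phi> k"
  unfolding torus_coeff_def mult.assoc by (rule torus_mean_cmult)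

lemma torus_coeff_sum:
  "finite F \<Longrightarrow> (\<And>j. j \<in> F \<Longrightarrow> \<phi> j \<in> test_fun) \<Longrightarrow>
    torus_coeff (\<lambda>z. \<Sum>j\<in>F. \<phi> j z) k = (\<Sum>j\<in>F. torus_coeff (\<phi> j) k)"
  unfolding torus_coeff_def sum_distrib_right
  by (rule torus_mean_sum) (auto intro: test_fun_continuous test_fun_mult test_fun_trig)

text \<open>For a nonzero frequency some partial derivative of \<open>trig k\<close> is a nonzero
  multiple of \<open>trig k\<close>, and derivatives have mean zero.\<close>

lemma torus_mean_trig: "torus_mean (trig k) = (if k = 0 then 1 else 0)"
proof (cases "k = 0")
  case True
  then show ?thesis using torus_mean_const[of 1] by (simp add: trig_def[abs_def])
next
  case False
  then have "fst k \<noteq> 0 \<or> snd k \<noteq> 0" by (auto simp: prod_eq_iff)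
  then show ?thesis
    using torus_mean_partial[OF test_fun_trig[of k]] False
    by (auto simp: dir_deriv_trig torus_mean_cmult)
qed

lemma torus_coeff_trig: "torus_coeff (trig l) k = (if k = l then 1 else 0)"
  by (auto simp: torus_coeff_def trig_mult torus_mean_trig)

text \<open>Integration by parts, expressed as the vanishing mean of the derivative of the product
  of \<phi> and \<open>trig (- k)\<close>.\<close>

lemma torus_coeff_partial:
  assumes "\<phi> \<in> test_fun"
  shows "torus_coeff (partial_t \<phi>) k = \<i> * of_int (fst k) * torus_coeff \<phi> k"
    and "torus_coeff (partial_x \<phi>) k = \<i> * of_int (snd k) * torus_coeff \<phi> k"
proof -
  note c = test_fun_continuous[OF test_fun_mult[OF _ test_fun_trig]]
  have parts: "torus_coeff (dir_deriv v \<phi>) k =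
      \<i> * of_real (fst v * of_int (fst k) + snd v * of_int (snd k)) * torus_coeff \<phi> k"
    if "torus_mean (dir_deriv v (\<lambda>z. \<phi> z * trig (- k) z)) = 0" for v
  proof -
    define c where "c = \<i> * of_real (fst v * of_int (fst k) + snd v * of_int (snd k))"
    have eq: "dir_deriv v (\<lambda>z. \<phi> z * trig (- k) z) =
        (\<lambda>z. (- c) * (\<phi> z * trig (- k) z) + dir_deriv v \<phi> z * trig (- k) z)"
      by (subst dir_deriv_mult[OF test_funD(1)[OF assms] smooth_fun_trig])
         (simp add: fun_eq_iff dir_deriv_trig c_def algebra_simps)
    have "torus_mean (dir_deriv v (\<lambda>z. \<phi> z * trig (- k) z)) = - c * torus_coeff \<phi> k + torus_coeff (dir_deriv v \<phi>) k"
      unfolding eq torus_coeff_def torus_mean_cmult[symmetric]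
      by (intro torus_mean_add continuous_on_mult_left c test_fun_dir_deriv assms)
    then show ?thesis using that by (simp add: add_eq_0_iff c_def)
  qed
  show "torus_coeff (partial_t \<phi>) k = \<i> * of_int (fst k) * torus_coeff \<phi> k"
    "torus_coeff (partial_x \<phi>) k = \<i> * of_int (snd k) * torus_coeff \<phi> k"
    using parts torus_mean_partial[OF test_fun_mult[OF assms test_fun_trig]] by simp_all
qed

lemma torus_coeff_partials:
  assumes "\<phi> \<in> test_fun"
  shows "torus_coeff ((partial_t ^^ i) ((partial_x ^^ j) \<phi>)) k =
    (\<i> * of_int (fst k)) ^ i * (\<i> * of_int (snd k)) ^ j * torus_coeff \<phi> k"
proof (induction i)
  case 0
  show ?case
  proof (induction j)
    case (Suc j)
    then show ?case
      using torus_coeff_partial(2)[OF test_fun_partials[OF assms, of 0 j]] by simp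
  qed simp
next
  case (Suc i)
  then show ?case
    using torus_coeff_partial(1)[OF test_fun_partials[OF assms, of i j]] by simp
qed

lemma Ck_norm_ge:
  assumes "\<phi> \<in> test_fun" "i + j \<le> m"
  shows "cmod ((partial_t ^^ i) ((partial_x ^^ j) \<phi>) z) \<le> Ck_norm m \<phi>"
proof -
  define S where "S = (\<lambda>(i, j). SUP z. cmod ((partial_t ^^ i) ((partial_x ^^ j) \<phi>) z))"
  have bdd: "bdd_above (range (\<lambda>z. cmod ((partial_t ^^ i) ((partial_x ^^ j) \<phi>) z)))" for i j
    using test_fun_bounded[OF test_fun_partials[OF assms(1)]] by (metis bdd_aboveI2)
  have ge: "cmod ((partial_t ^^ i) ((partial_x ^^ j) \<phi>) z) \<le> S (i, j)" for i j z
    unfolding S_def using bdd by (auto intro: cSUP_upper)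
  have "{(i, j). i + j \<le> m} \<subseteq> {..m} \<times> {..m}" by auto
  then have "finite {(i, j). i + j \<le> m}" using finite_subset by blast
  moreover have "0 \<le> S p" for p
    using ge[of "fst p" "snd p" z] by (smt (verit) norm_ge_zero prod.collapse)
  ultimately have "S (i, j) \<le> sum S {(i, j). i + j \<le> m}"
    using assms(2) by (intro member_le_sum) auto
  then show ?thesis
    using ge[of i j z] by (simp add: Ck_norm_def S_def)
qed

lemma torus_coeff_bound:
  assumes "\<phi> \<in> test_fun" "\<And>z. cmod (\<phi> z) \<le> B" shows "cmod (torus_coeff \<phi> k) \<le> B"
  unfolding torus_coeff_def using assms
  by (intro torus_mean_bound) (auto intro!: test_fun_continuous test_fun_mult test_fun_trig simp: norm_mult)

text \<open>This is the square of \<open>bracket\<close> at the frequency. Unlike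
  \<open>bracket\<close> it is a polynomial, so one factor of it corresponds exactly to the identity
  and the two first derivatives.\<close>

definition weight :: "int \<times> int \<Rightarrow> real" where
  "weight k = 1 + (of_int (fst k))\<^sup>2 + (of_int (snd k))\<^sup>2"

lemma weight_ge_1: "1 \<le> weight k"
  by (simp add: weight_def)

lemma weight_pos [simp]: "0 < weight k" "0 \<le> weight k" "weight k \<noteq> 0"
  using weight_ge_1[of k] by auto

lemma weight_uminus [simp]: "weight (- k) = weight k"
  by (simp add: weight_def)

text \<open>Up to the factor 3, \<open>weight k\<close> is the largest \<open>M\<close> of its three
  summands. The power \<open>M ^ m\<close> is then the absolute value of the symbol of a single pure
  derivative of order 0 or \<open>2 * m\<close>, which accounts for both constants.\<close>

lemma torus_coeff_decay:
  assumes "\<phi> \<in> test_fun"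
  shows "weight k ^ m * cmod (torus_coeff \<phi> k) \<le> 3 ^ m * Ck_norm (2 * m) \<phi>"
proof -
  define M where "M = max 1 (max ((real_of_int (fst k))\<^sup>2) ((real_of_int (snd k))\<^sup>2))"
  have bound: "\<bar>of_int (fst k)\<bar> ^ i * \<bar>of_int (snd k)\<bar> ^ j * cmod (torus_coeff \<phi> k) \<le> Ck_norm (2 * m) \<phi>"
    if "i + j \<le> 2 * m" for i j
    using torus_coeff_bound[OF test_fun_partials[OF assms] Ck_norm_ge[OF assms that]]
    by (simp add: torus_coeff_partials[OF assms] norm_mult norm_power)
  have "weight k \<le> 3 * M"
    unfolding weight_def M_def by linarith
  then have "weight k ^ m \<le> (3 * M) ^ m"
    by (intro power_mono) auto
  from mult_right_mono[OF this norm_ge_zero[of "torus_coeff \<phi> k"]]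
  have "weight k ^ m * cmod (torus_coeff \<phi> k) \<le> 3 ^ m * (M ^ m * cmod (torus_coeff \<phi> k))"
    by (simp add: power_mult_distrib mult.assoc)
  also have "M ^ m * cmod (torus_coeff \<phi> k) \<le> Ck_norm (2 * m) \<phi>"
  proof -
    consider "M = 1" | "M = (real_of_int (fst k))\<^sup>2" | "M = (real_of_int (snd k))\<^sup>2"
      unfolding M_def by linarith
    then show ?thesis
      using bound[of 0 0] bound[of "2 * m" 0] bound[of 0 "2 * m"]
      by cases (simp_all add: power_even_abs flip: power_mult)
  qed
  finally show ?thesis by simp
qed

text \<open>The square of \<open>1 + a + b\<close> dominates \<open>(1 + a) * (1 + b)\<close> for
  nonnegative \<open>a\<close> and \<open>b\<close>, so the double series is bounded by a product of
  two convergent series over the integers.\<close>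

lemma summable_on_weight: "(\<lambda>k. 1 / weight k ^ 2) summable_on UNIV"
proof -
  let ?f = "\<lambda>n::int. 1 / (1 + (real_of_int n)\<^sup>2)"
  have "(\<lambda>(m, n). ?f m * ?f n) summable_on UNIV \<times> UNIV"
  proof (rule summable_on_SigmaI)
    show "((\<lambda>n. case (m, n) of (m, n) \<Rightarrow> ?f m * ?f n) has_sum ?f m * infsum ?f UNIV) UNIV" for m
      unfolding prod.case
      by (rule has_sum_cmult_right[OF has_sum_infsum[OF summable_on_inverse_square_int]])
    show "(\<lambda>m. ?f m * infsum ?f UNIV) summable_on UNIV"
      by (rule summable_on_cmult_left[OF summable_on_inverse_square_int])
  qed auto
  then have "(\<lambda>(m, n). ?f m * ?f n) summable_on UNIV" by simp
  then show ?thesis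
  proof (rule summable_on_comparison_test)
    fix k :: "int \<times> int"
    show "1 / weight k ^ 2 \<le> (case k of (m, n) \<Rightarrow> ?f m * ?f n)"
    proof -
      define a b where "a = (real_of_int (fst k))\<^sup>2" and "b = (real_of_int (snd k))\<^sup>2"
      have "0 \<le> a" "0 \<le> b" by (auto simp: a_def b_def)
      then have "(1 + a) * (1 + b) \<le> (1 + a + b)\<^sup>2"
        by (simp add: power2_eq_square algebra_simps add_nonneg_nonneg)
      then show ?thesis
        using \<open>0 \<le> a\<close> \<open>0 \<le> b\<close>
        by (simp add: weight_def case_prod_beta frac_le flip: a_def b_def)
    qed
  qed auto
qed

lemma summable_torus_coeff:
  assumes "\<phi> \<in> test_fun" shows "(\<lambda>k. cmod (torus_coeff \<phi> k)) summable_on UNIV"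
proof (rule summable_on_comparison_test)
  \<comment> \<open>The decay estimate with \<open>m = 2\<close>, the exponent at which the weights
    become summable.\<close>
  show "(\<lambda>k. (9 * Ck_norm 4 \<phi>) * (1 / weight k ^ 2)) summable_on UNIV"
    by (rule summable_on_cmult_right[OF summable_on_weight])
  show "cmod (torus_coeff \<phi> k) \<le> (9 * Ck_norm 4 \<phi>) * (1 / weight k ^ 2)" for k
    using torus_coeff_decay[OF assms, of k 2] by (simp add: pos_le_divide_eq mult.commute)
qed simp

section \<open>Fourier inversion on the torus\<close>

text \<open>Half of the inversion: expand in the first variable at the point \<open>t\<close>, then
  integrate this series in \<open>x\<close> against the exponential of frequency
  \<open>- \<xi>\<close>. Integrating term by term turns the one-variable coefficients into
  coefficients on the torus.\<close>

lemma circle_coeff_partial_tendsto: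
  assumes \<phi>: "\<phi> \<in> test_fun"
  shows "((\<lambda>\<tau>. torus_coeff \<phi> (\<tau>, \<xi>) * cis (of_int \<tau> * t)) has_sum
    circle_coeff (\<lambda>x. \<phi> (t, x)) \<xi>) UNIV"
proof -
  define c where "c \<tau> x = circle_coeff (\<lambda>s. \<phi> (s, x)) \<tau>" for \<tau> x
  note cont = test_fun_continuous[OF \<phi>]
  have cont1: "continuous_on UNIV (\<lambda>s. \<phi> (s, x))" for x
    by (intro continuous_on_compose2[OF cont[of UNIV]] continuous_intros) auto
  have cc: "continuous_on S (c \<tau>)" for \<tau> S
  proof -
    have "continuous_on (S \<times> cbox 0 (2 * pi)) (\<lambda>(x, s). \<phi> (s, x) * cis (- of_int \<tau> * s))"
      unfolding case_prod_beta
      by (intro continuous_intros continuous_on_compose2[OF cont[of UNIV]]) auto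
    from integral_continuous_on_param[OF this]
    have "continuous_on S (\<lambda>x. integral {0..2 * pi} (\<lambda>s. \<phi> (s, x) * cis (- of_int \<tau> * s)))"
      by simp
    then show ?thesis
      unfolding c_def circle_coeff_def by (rule continuous_on_divide[OF _ continuous_on_const]) simp
  qed
  obtain B where B: "cmod (\<phi> z + (-1) * partial_t (partial_t \<phi>) z) \<le> B" for z
    using test_fun_bounded[OF test_fun_add[OF \<phi> test_fun_cmult[OF test_fun_dir_deriv[OF test_fun_dir_deriv[OF \<phi>]]]]]
    by metis
  \<comment> \<open>The bound does not depend on \<open>x\<close>; this makes the series converge
    uniformly in \<open>x\<close> and justifies the termwise integration.\<close>
  have c_le: "cmod (c \<tau> x) \<le> B / (1 + (of_int \<tau>)\<^sup>2)" for \<tau> x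
    unfolding c_def
  proof (rule circle_coeff_decay)
    show "continuous_on UNIV (\<lambda>s. partial_t (partial_t \<phi>) (s, x))"
      by (intro continuous_on_compose2[OF test_fun_continuous[OF test_fun_dir_deriv[OF test_fun_dir_deriv[OF \<phi>]], where S = UNIV]] continuous_intros) auto
    show "cmod (\<phi> (s, x) - partial_t (partial_t \<phi>) (s, x)) \<le> B" for s
      using B[of "(s, x)"] by simp
  qed (rule partial_has_vector_derivative[OF test_funD(1)] test_funD(2) test_fun_dir_deriv \<phi>)+
  have summ: "(\<lambda>\<tau>. B / (1 + (real_of_int \<tau>)\<^sup>2)) summable_on UNIV"
    using summable_on_cmult_right[OF summable_on_inverse_square_int, of B] by simp
  have exp: "((\<lambda>\<tau>. c \<tau> x * cis (of_int \<tau> * t)) has_sum \<phi> (t, x)) UNIV" for x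
  proof -
    have "(\<lambda>\<tau>. norm (c \<tau> x)) summable_on UNIV"
      by (rule summable_on_comparison_test[OF summ]) (auto intro: c_le)
    then have "c' summable_on UNIV" if "c' = (\<lambda>\<tau>. c \<tau> x)" for c'
      unfolding that by (rule abs_summable_summable)
    then have "circle_coeff (\<lambda>s. \<phi> (s, x)) summable_on UNIV"
      by (simp add: c_def)
    then show ?thesis
      unfolding c_def
      using circle_Fourier_inversion[OF partial_has_vector_derivative(1)[OF test_funD(1)[OF \<phi>]] test_funD(2)[OF \<phi>]]
      by blast
  qed
  define T where "T F x = (\<Sum>\<tau>\<in>F. (c \<tau> x * cis (of_int \<tau> * t)) * cis (- of_int \<xi> * x))" for F x
  have T_lim: "uniform_limit {0..2 * pi} T (\<lambda>x. \<phi> (t, x) * cis (- of_int \<xi> * x)) (finite_subsets_at_top UNIV)"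
    unfolding T_def
  proof (rule Weierstrass_m_test_general')
    show "((\<lambda>\<tau>. (c \<tau> x * cis (of_int \<tau> * t)) * cis (- of_int \<xi> * x)) has_sum
        \<phi> (t, x) * cis (- of_int \<xi> * x)) UNIV" for x
      by (rule has_sum_cmult_left[OF exp])
    show "norm (c \<tau> x * cis (of_int \<tau> * t) * cis (- of_int \<xi> * x)) \<le> B / (1 + (of_int \<tau>)\<^sup>2)" for \<tau> x
      using c_le by (simp add: norm_mult)
    show "(\<lambda>\<tau>. B / (1 + (real_of_int \<tau>)\<^sup>2)) summable_on UNIV" by (rule summ)
  qed
  have T_cont: "continuous_on {0..2 * pi} (T F)" for F
    unfolding T_def by (intro continuous_intros cc)
  obtain I J where I: "\<And>F. (T F has_integral I F) {0..2 * pi}"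
    and J: "((\<lambda>x. \<phi> (t, x) * cis (- of_int \<xi> * x)) has_integral J) {0..2 * pi}"
    and lim: "(I \<longlongrightarrow> J) (finite_subsets_at_top UNIV)"
    by (rule uniform_limit_integral[OF T_lim T_cont finite_subsets_at_top_neq_bot]) (rule that)
  have coeff: "integral {0..2 * pi} (\<lambda>x. c \<tau> x * cis (- of_int \<xi> * x)) = 2 * of_real pi * torus_coeff \<phi> (\<tau>, \<xi>)" for \<tau>
  proof -
    have trig: "trig (- (\<tau>, \<xi>)) (s, x) = cis (- of_int \<tau> * s) * cis (- of_int \<xi> * x)" for s x
      by (simp add: trig_def cis_mult algebra_simps)
    have "torus_coeff \<phi> (\<tau>, \<xi>) = (1 / (2 * pi)\<^sup>2) *\<^sub>R integral {0..2 * pi} (\<lambda>x. integral {0..2 * pi}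
        (\<lambda>s. \<phi> (s, x) * trig (- (\<tau>, \<xi>)) (s, x)))"
      unfolding torus_coeff_def
      by (rule torus_mean_iterated(2)[OF test_fun_continuous[OF test_fun_mult[OF \<phi> test_fun_trig]]])
    also have "(\<lambda>x. integral {0..2 * pi} (\<lambda>s. \<phi> (s, x) * trig (- (\<tau>, \<xi>)) (s, x)))
        = (\<lambda>x. 2 * of_real pi * (c \<tau> x * cis (- of_int \<xi> * x)))"
    proof
      fix x
      have "integral {0..2 * pi} (\<lambda>s. \<phi> (s, x) * trig (- (\<tau>, \<xi>)) (s, x))
          = integral {0..2 * pi} (\<lambda>s. (\<phi> (s, x) * cis (- of_int \<tau> * s)) * cis (- of_int \<xi> * x))"
        by (simp only: trig mult.assoc)
      then show "integral {0..2 * pi} (\<lambda>s. \<phi> (s, x) * trig (- (\<tau>, \<xi>)) (s, x))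
          = 2 * of_real pi * (c \<tau> x * cis (- of_int \<xi> * x))"
        by (simp add: c_def circle_coeff_def)
    qed
    finally show ?thesis
      by (simp add: scaleR_conv_of_real power2_eq_square)
  qed
  have "I F / (2 * of_real pi) = (\<Sum>\<tau>\<in>F. torus_coeff \<phi> (\<tau>, \<xi>) * cis (of_int \<tau> * t))" for F
  proof (cases "finite F")
    case True
    have "I F = integral {0..2 * pi} (T F)"
      by (rule integral_unique[OF I, symmetric])
    also have "\<dots> = (\<Sum>\<tau>\<in>F. integral {0..2 * pi} (\<lambda>x. cis (of_int \<tau> * t) * (c \<tau> x * cis (- of_int \<xi> * x))))"
      unfolding T_def
      by (subst integral_sum[OF True])
         (auto intro!: integrable_continuous_real continuous_intros cc simp: mult_ac)
    also have "\<dots> = (\<Sum>\<tau>\<in>F. cis (of_int \<tau> * t) * (2 * of_real pi * torus_coeff \<phi> (\<tau>, \<xi>)))"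
      by (simp only: integral_mult_right coeff)
    finally show ?thesis by (simp add: sum_divide_distrib mult_ac)
  next
    \<comment> \<open>A sum over an infinite set is 0 by convention, and so is \<open>T F\<close>.
      The identity thus holds for every \<open>F\<close>, which allows rewriting under the
      limit.\<close>
    case False
    then have "T F x = 0" for x by (simp add: T_def)
    then have "(T F has_integral 0) {0..2 * pi}" by (intro has_integral_is_0)
    with I[of F] have "I F = 0" by (rule has_integral_unique)
    then show ?thesis using False by simp
  qed
  moreover have "((\<lambda>F. I F / (2 * of_real pi)) \<longlongrightarrow> J / (2 * of_real pi)) (finite_subsets_at_top UNIV)"
    by (intro tendsto_intros lim) simp
  moreover have "J / (2 * of_real pi) = circle_coeff (\<lambda>x. \<phi> (t, x)) \<xi>"
    using J by (simp add: circle_coeff_def integral_unique)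
  ultimately show ?thesis
    by (simp add: has_sum_def)
qed

text \<open>Absolute summability permits an iterated summation. The sum over the first frequency
  gives circle coefficients in \<open>x\<close>, and circle inversion in \<open>x\<close> then
  recovers the value.\<close>

theorem torus_Fourier_inversion:
  assumes \<phi>: "\<phi> \<in> test_fun"
  shows "((\<lambda>k. torus_coeff \<phi> k * trig k z) has_sum \<phi> z) UNIV"
proof (cases z)
  case (Pair t x)
  \<comment> \<open>The two frequencies are swapped because sums over a product are iterated with
    the second component innermost, and the first frequency has to be summed first.\<close>
  define f where "f = (\<lambda>(\<xi>, \<tau>). torus_coeff \<phi> (\<tau>, \<xi>) * trig (\<tau>, \<xi>) (t, x))"
  have "(\<lambda>k. norm (torus_coeff \<phi> k * trig k (t, x))) summable_on UNIV"
    using summable_torus_coeff[OF \<phi>] by (simp add: norm_mult)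
  then have summ: "(\<lambda>k. torus_coeff \<phi> k * trig k (t, x)) summable_on UNIV"
    by (rule abs_summable_summable)
  have swap: "bij (prod.swap :: int \<times> int \<Rightarrow> int \<times> int)" by (rule bij_swap)
  have f_eq: "f = (\<lambda>k. torus_coeff \<phi> k * trig k (t, x)) \<circ> prod.swap"
    by (auto simp: f_def fun_eq_iff)
  have f_summ: "f summable_on UNIV"
    using summable_on_reindex_bij_betw[OF swap, of "\<lambda>k. torus_coeff \<phi> k * trig k (t, x)"] summ
    by (simp add: f_eq o_def)
  have c_summ: "circle_coeff (\<lambda>x. \<phi> (t, x)) summable_on UNIV"
  proof -
    have "(\<lambda>(\<xi>, \<tau>). torus_coeff \<phi> (\<tau>, \<xi>) * cis (of_int \<tau> * t)) summable_on UNIV \<times> UNIV"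
    proof -
      have "(\<lambda>k. norm (torus_coeff \<phi> k * cis (of_int (fst k) * t))) summable_on UNIV"
        using summable_torus_coeff[OF \<phi>] by (simp add: norm_mult)
      then have "(\<lambda>k. torus_coeff \<phi> k * cis (of_int (fst k) * t)) summable_on UNIV"
        by (rule abs_summable_summable)
      then show ?thesis
        using summable_on_reindex_bij_betw[OF swap, of "\<lambda>k. torus_coeff \<phi> k * cis (of_int (fst k) * t)"]
        by (simp add: case_prod_unfold prod.swap_def)
    qed
    then obtain S where "((\<lambda>(\<xi>, \<tau>). torus_coeff \<phi> (\<tau>, \<xi>) * cis (of_int \<tau> * t)) has_sum S) (UNIV \<times> UNIV)"
      by (auto simp: summable_on_def)
    from has_sum_SigmaD[OF this, of "circle_coeff (\<lambda>x. \<phi> (t, x))"] show ?thesis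
      using circle_coeff_partial_tendsto[OF \<phi>] by (auto simp: summable_on_def)
  qed
  have "((\<lambda>\<xi>. circle_coeff (\<lambda>x. \<phi> (t, x)) \<xi> * cis (of_int \<xi> * x)) has_sum \<phi> (t, x)) UNIV"
    using circle_Fourier_inversion[OF partial_has_vector_derivative(2)[OF test_funD(1)[OF \<phi>]] test_funD(3)[OF \<phi>] c_summ] .
  moreover have "((\<lambda>\<tau>. f (\<xi>, \<tau>)) has_sum circle_coeff (\<lambda>x. \<phi> (t, x)) \<xi> * cis (of_int \<xi> * x)) UNIV" for \<xi>
  proof -
    have "f (\<xi>, \<tau>) = torus_coeff \<phi> (\<tau>, \<xi>) * cis (of_int \<tau> * t) * cis (of_int \<xi> * x)" for \<tau>
      by (simp add: f_def trig_def cis_mult mult_ac)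
    then show ?thesis
      using has_sum_cmult_left[OF circle_coeff_partial_tendsto[OF \<phi>]] by simp
  qed
  ultimately have "(f has_sum \<phi> (t, x)) (UNIV \<times> UNIV)"
    using f_summ by (intro has_sum_SigmaI) auto
  then show ?thesis
    using has_sum_reindex_bij_betw[OF swap, of "\<lambda>k. torus_coeff \<phi> k * trig k (t, x)"] Pair
    by (simp add: f_eq o_def)
qed

text \<open>Parseval's identity in bilinear form: without a conjugation, frequency \<open>k\<close>
  pairs with \<open>- k\<close>. The series of \<phi> converges uniformly, also after multiplication
  by the bounded \<psi>, so the mean is taken term by term.\<close>

lemma torus_mean_mult:
  assumes \<phi>: "\<phi> \<in> test_fun" and \<psi>: "\<psi> \<in> test_fun"
  shows "((\<lambda>k. torus_coeff \<phi> k * torus_coeff \<psi> (- k)) has_sum torus_mean (\<lambda>z. \<phi> z * \<psi> z)) UNIV"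
proof -
  obtain B where B: "\<And>z. cmod (\<psi> z) \<le> B" using test_fun_bounded[OF \<psi>] by blast
  have "uniform_limit UNIV (\<lambda>F z. \<Sum>k\<in>F. torus_coeff \<phi> k * trig k z * \<psi> z) (\<lambda>z. \<phi> z * \<psi> z)
      (finite_subsets_at_top UNIV)"
  proof (rule Weierstrass_m_test_general')
    show "((\<lambda>k. torus_coeff \<phi> k * trig k z * \<psi> z) has_sum \<phi> z * \<psi> z) UNIV" for z
      by (rule has_sum_cmult_left[OF torus_Fourier_inversion[OF \<phi>]])
    show "norm (torus_coeff \<phi> k * trig k z * \<psi> z) \<le> cmod (torus_coeff \<phi> k) * B" for k z
      using B by (simp add: norm_mult mult_left_mono)
    show "(\<lambda>k. cmod (torus_coeff \<phi> k) * B) summable_on UNIV"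
      by (rule summable_on_cmult_left[OF summable_torus_coeff[OF \<phi>]])
  qed
  then have "((\<lambda>F. torus_mean (\<lambda>z. \<Sum>k\<in>F. torus_coeff \<phi> k * trig k z * \<psi> z)) \<longlongrightarrow>
      torus_mean (\<lambda>z. \<phi> z * \<psi> z)) (finite_subsets_at_top UNIV)"
    by (rule torus_mean_tendsto)
       (auto intro!: test_fun_continuous test_fun_sum test_fun_mult test_fun_const test_fun_trig \<psi>)
  moreover have "eventually (\<lambda>F. torus_mean (\<lambda>z. \<Sum>k\<in>F. torus_coeff \<phi> k * trig k z * \<psi> z)
      = (\<Sum>k\<in>F. torus_coeff \<phi> k * torus_coeff \<psi> (- k))) (finite_subsets_at_top UNIV)"
  proof (rule eventually_finite_subsets_at_top_weakI)
    fix F :: "(int \<times> int) set" assume "finite F"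
    have "torus_mean (\<lambda>z. torus_coeff \<phi> k * trig k z * \<psi> z) = torus_coeff \<phi> k * torus_coeff \<psi> (- k)" for k
      using torus_mean_cmult[of "torus_coeff \<phi> k" "\<lambda>z. trig k z * \<psi> z"]
      by (simp add: torus_coeff_def mult_ac)
    then show "torus_mean (\<lambda>z. \<Sum>k\<in>F. torus_coeff \<phi> k * trig k z * \<psi> z)
      = (\<Sum>k\<in>F. torus_coeff \<phi> k * torus_coeff \<psi> (- k))"
      by (subst torus_mean_sum[OF \<open>finite F\<close>])
         (auto intro!: test_fun_continuous test_fun_mult test_fun_const test_fun_trig \<psi>)
  qed
  ultimately have "((\<lambda>F. \<Sum>k\<in>F. torus_coeff \<phi> k * torus_coeff \<psi> (- k)) \<longlongrightarrow>
      torus_mean (\<lambda>z. \<phi> z * \<psi> z)) (finite_subsets_at_top UNIV)"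
    by (rule Lim_transform_eventually)
  then show ?thesis by (simp add: has_sum_def)
qed

section \<open>Sobolev norms and distributions\<close>

lemma infsum_Cauchy_Schwarz:
  fixes f g :: "'a \<Rightarrow> real"
  assumes f: "(\<lambda>k. (f k)\<^sup>2) summable_on A" and g: "(\<lambda>k. (g k)\<^sup>2) summable_on A"
    and nonneg: "\<And>k. k \<in> A \<Longrightarrow> 0 \<le> f k" "\<And>k. k \<in> A \<Longrightarrow> 0 \<le> g k"
  shows "(\<lambda>k. f k * g k) summable_on A"
    and "(infsum (\<lambda>k. f k * g k) A)\<^sup>2 \<le> infsum (\<lambda>k. (f k)\<^sup>2) A * infsum (\<lambda>k. (g k)\<^sup>2) A"
proof -
  have "(\<lambda>k. norm (f k * g k)) summable_on A"
    by (rule abs_summable_product) (use f g in \<open>auto simp: power2_eq_square\<close>)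
  then show s: "(\<lambda>k. f k * g k) summable_on A"
    by (rule abs_summable_summable)
  define B where "B = infsum (\<lambda>k. (f k)\<^sup>2) A * infsum (\<lambda>k. (g k)\<^sup>2) A"
  have "infsum (\<lambda>k. f k * g k) A \<le> sqrt B"
  proof (rule infsum_le_finite_sums[OF s])
    fix F assume F: "finite F" "F \<subseteq> A"
    have "(\<Sum>k\<in>F. f k * g k)\<^sup>2 \<le> (\<Sum>k\<in>F. (f k)\<^sup>2) * (\<Sum>k\<in>F. (g k)\<^sup>2)"
      by (rule Cauchy_Schwarz_ineq_sum)
    also have "\<dots> \<le> B"
      unfolding B_def using F f g
      by (intro mult_mono finite_sum_le_infsum sum_nonneg infsum_nonneg) auto
    finally show "(\<Sum>k\<in>F. f k * g k) \<le> sqrt B" by (rule real_le_rsqrt)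
  qed
  moreover have "0 \<le> infsum (\<lambda>k. f k * g k) A"
    using nonneg by (intro infsum_nonneg) auto
  moreover have "0 \<le> B" unfolding B_def by (intro mult_nonneg_nonneg infsum_nonneg) auto
  ultimately have "(infsum (\<lambda>k. f k * g k) A)\<^sup>2 \<le> (sqrt B)\<^sup>2"
    by (intro power_mono)
  then show "(infsum (\<lambda>k. f k * g k) A)\<^sup>2 \<le> infsum (\<lambda>k. (f k)\<^sup>2) A * infsum (\<lambda>k. (g k)\<^sup>2) A"
    using \<open>0 \<le> B\<close> by (simp add: B_def)
qed

lemma Ck_norm_nonneg: "\<phi> \<in> test_fun \<Longrightarrow> 0 \<le> Ck_norm m \<phi>"
  by (rule order_trans[OF norm_ge_zero Ck_norm_ge[of \<phi> 0 0 m 0]]) auto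

lemma torus_coeff_trig_sum:
  assumes "finite F"
  shows "torus_coeff (\<lambda>z. \<Sum>k\<in>F. a k * trig k z) l = (if l \<in> F then a l else 0)"
proof -
  have "torus_coeff (\<lambda>z. \<Sum>k\<in>F. a k * trig k z) l = (\<Sum>k\<in>F. if l = k then a k else 0)"
    by (subst torus_coeff_sum[OF assms test_fun_cmult[OF test_fun_trig]])
       (simp add: torus_coeff_cmult torus_coeff_trig if_distrib cong: if_cong)
  then show ?thesis using assms by simp
qed

text \<open>The squared Sobolev norm of order \<open>s\<close>. The exponent is \<open>s\<close> and
  not \<open>2 * s\<close> because \<open>weight\<close> is already the square of the
  bracket.\<close>

definition sob_sq :: "real \<Rightarrow> (real \<times> real \<Rightarrow> complex) \<Rightarrow> real" where
  "sob_sq s \<phi> = (\<Sum>\<^sub>\<infinity>k. weight k powr s * (cmod (torus_coeff \<phi> k))\<^sup>2)"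

lemma sob_sq_le_Ck_norm:
  obtains C m where
    "\<And>\<phi>. \<phi> \<in> test_fun \<Longrightarrow> (\<lambda>k. weight k powr s * (cmod (torus_coeff \<phi> k))\<^sup>2) summable_on UNIV"
    "\<And>\<phi>. \<phi> \<in> test_fun \<Longrightarrow> sob_sq s \<phi> \<le> C * (Ck_norm m \<phi>)\<^sup>2"
proof -
  obtain n :: nat where n: "s \<le> real n" using real_arch_simple by blast
  \<comment> \<open>With this choice \<open>2 * m\<close> is at least \<open>n + 2\<close>. The
    squared decay estimate of order \<open>m\<close> absorbs \<open>weight k powr s\<close> and
    leaves a summable factor \<open>1 / weight k ^ 2\<close>.\<close>
  define m where "m = n + 1"
  define K where "K \<phi> = (3 ^ m * Ck_norm (2 * m) \<phi>)\<^sup>2" for \<phi>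
  have le: "weight k powr s * (cmod (torus_coeff \<phi> k))\<^sup>2 \<le> K \<phi> * (1 / weight k ^ 2)"
    if \<phi>: "\<phi> \<in> test_fun" for \<phi> k
  proof -
    define w where "w = weight k"
    have w: "1 \<le> w" using weight_ge_1 by (simp add: w_def)
    have "w powr s \<le> w ^ n"
      using powr_mono[OF n w] w by (simp add: powr_realpow)
    then have "w powr s * w ^ 2 \<le> w ^ n * w ^ 2"
      by (intro mult_right_mono) auto
    also have "\<dots> \<le> w ^ (2 * m)"
      unfolding power_add[symmetric] using w by (intro power_increasing) (auto simp: m_def)
    finally have "w powr s * w ^ 2 \<le> w ^ (2 * m)" .
    then have "w powr s * w ^ 2 * (cmod (torus_coeff \<phi> k))\<^sup>2 \<le> w ^ (2 * m) * (cmod (torus_coeff \<phi> k))\<^sup>2"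
      by (intro mult_right_mono) auto
    also have "\<dots> = (w ^ m * cmod (torus_coeff \<phi> k))\<^sup>2"
      by (simp add: power_mult_distrib power_even_eq)
    also have "\<dots> \<le> K \<phi>"
      unfolding K_def using torus_coeff_decay[OF \<phi>, of k m] w
      by (intro power_mono) (auto simp: w_def)
    finally show ?thesis
      using w by (simp add: w_def[symmetric] pos_le_divide_eq mult_ac)
  qed
  have summ: "(\<lambda>k. weight k powr s * (cmod (torus_coeff \<phi> k))\<^sup>2) summable_on UNIV" if "\<phi> \<in> test_fun" for \<phi>
    by (rule summable_on_comparison_test[OF summable_on_cmult_right[OF summable_on_weight]])
       (use le[OF that] in auto)
  have "sob_sq s \<phi> \<le> (infsum (\<lambda>k. 1 / weight k ^ 2) UNIV * (3 ^ m)\<^sup>2) * (Ck_norm (2 * m) \<phi>)\<^sup>2"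
    if "\<phi> \<in> test_fun" for \<phi>
  proof -
    have "sob_sq s \<phi> \<le> (\<Sum>\<^sub>\<infinity>k. K \<phi> * (1 / weight k ^ 2))"
      unfolding sob_sq_def
      by (rule infsum_mono[OF summ[OF that] summable_on_cmult_right[OF summable_on_weight] le[OF that]])
    also have "\<dots> = K \<phi> * (\<Sum>\<^sub>\<infinity>k. 1 / weight k ^ 2)"
      by (rule infsum_cmult_right')
    finally show ?thesis by (simp add: K_def power_mult_distrib mult_ac)
  qed
  with summ show ?thesis using that by blast
qed

lemma summable_sob_sq:
  "\<phi> \<in> test_fun \<Longrightarrow> (\<lambda>k. weight k powr s * (cmod (torus_coeff \<phi> k))\<^sup>2) summable_on UNIV"
  by (rule sob_sq_le_Ck_norm[of s]) blast

lemma sob_sq_nonneg: "0 \<le> sob_sq s \<phi>"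
  unfolding sob_sq_def by (rule infsum_nonneg) simp

text \<open>A crude Sobolev embedding. Each derivative is charged a full factor
  \<open>weight k\<close>; then \<open>weight k ^ m\<close> is written as
  \<open>1 / weight k\<close> times \<open>weight k ^ (m + 1)\<close> and Cauchy-Schwarz is applied.
  Squaring the second factor produces the order \<open>2 * m + 2\<close>.\<close>

lemma norm_partials_le_sob_sq:
  assumes \<phi>: "\<phi> \<in> test_fun" and "i + j \<le> m"
  shows "(cmod ((partial_t ^^ i) ((partial_x ^^ j) \<phi>) z))\<^sup>2
    \<le> infsum (\<lambda>k. 1 / weight k ^ 2) UNIV * sob_sq (2 * real m + 2) \<phi>"
proof -
  let ?c = "\<lambda>k. cmod (torus_coeff \<phi> k)" and ?d = "(partial_t ^^ i) ((partial_x ^^ j) \<phi>)"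
  define f g where "f k = 1 / weight k" and "g k = weight k ^ (m + 1) * ?c k" for k
  have f: "(\<lambda>k. (f k)\<^sup>2) = (\<lambda>k. 1 / weight k ^ 2)"
    by (simp add: f_def power_divide)
  have g: "(\<lambda>k. (g k)\<^sup>2) = (\<lambda>k. weight k powr (2 * real m + 2) * (?c k)\<^sup>2)"
  proof
    fix k
    have "weight k powr (2 * real m + 2) = weight k ^ (2 * (m + 1))"
      by (subst powr_realpow[symmetric]) (auto simp: algebra_simps)
    also have "\<dots> = (weight k ^ (m + 1))\<^sup>2" by (rule power_even_eq)
    finally show "(g k)\<^sup>2 = weight k powr (2 * real m + 2) * (?c k)\<^sup>2"
      by (simp only: g_def power_mult_distrib)
  qed
  have summ: "(\<lambda>k. (f k)\<^sup>2) summable_on UNIV" "(\<lambda>k. (g k)\<^sup>2) summable_on UNIV"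
    unfolding f g using summable_on_weight summable_sob_sq[OF \<phi>] by auto
  have fg: "f k * g k = weight k ^ m * ?c k" for k
    by (simp add: f_def g_def)
  have le: "cmod (torus_coeff ?d k) \<le> f k * g k" for k
  proof -
    have a: "\<bar>of_int (fst k)\<bar> \<le> weight k" "\<bar>of_int (snd k)\<bar> \<le> weight k"
    proof -
      have "\<bar>y\<bar> \<le> 1 + y\<^sup>2" for y :: real
        using zero_le_power2[of "\<bar>y\<bar> - 1"] zero_le_power2[of y] by (simp add: power2_diff)
      from this[of "of_int (fst k)"] this[of "of_int (snd k)"]
      show "\<bar>of_int (fst k)\<bar> \<le> weight k" "\<bar>of_int (snd k)\<bar> \<le> weight k"
        unfolding weight_def by (smt (verit) zero_le_power2)+
    qed
    have "\<bar>of_int (fst k)\<bar> ^ i * \<bar>of_int (snd k)\<bar> ^ j \<le> weight k ^ i * weight k ^ j"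
      by (intro mult_mono power_mono a) auto
    also have "\<dots> \<le> weight k ^ m"
      unfolding power_add[symmetric] using weight_ge_1 assms(2) by (intro power_increasing)
    finally show ?thesis
      unfolding fg by (simp add: torus_coeff_partials[OF \<phi>] norm_mult norm_power mult_right_mono)
  qed
  have s: "(\<lambda>k. f k * g k) summable_on UNIV"
    by (rule infsum_Cauchy_Schwarz(1)[OF summ]) (auto simp: f_def g_def)
  have "cmod (?d z) = cmod (\<Sum>\<^sub>\<infinity>k. torus_coeff ?d k * trig k z)"
    by (simp only: infsumI[OF torus_Fourier_inversion[OF test_fun_partials[OF \<phi>]]])
  also have "\<dots> \<le> (\<Sum>\<^sub>\<infinity>k. f k * g k)"
    by (rule norm_infsum_le[OF has_sum_infsum[OF has_sum_imp_summable[OF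
          torus_Fourier_inversion[OF test_fun_partials[OF \<phi>]]]] has_sum_infsum[OF s]])
       (simp add: norm_mult le)
  finally have "(cmod (?d z))\<^sup>2 \<le> (\<Sum>\<^sub>\<infinity>k. f k * g k)\<^sup>2"
    by (rule power_mono) simp
  also have "\<dots> \<le> infsum (\<lambda>k. 1 / weight k ^ 2) UNIV * sob_sq (2 * real m + 2) \<phi>"
    using infsum_Cauchy_Schwarz(2)[OF summ] unfolding f g sob_sq_def by (auto simp: f_def g_def)
  finally show ?thesis .
qed

lemma Ck_norm_le_sob_sq:
  obtains C where "\<And>\<phi>. \<phi> \<in> test_fun \<Longrightarrow> (Ck_norm m \<phi>)\<^sup>2 \<le> C * sob_sq (2 * real m + 2) \<phi>"
proof -
  define K where "K = infsum (\<lambda>k. 1 / weight k ^ 2) UNIV"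
  have K: "0 \<le> K" unfolding K_def by (rule infsum_nonneg) simp
  define N where "N = real (card {(i, j). i + j \<le> m})"
  have "(Ck_norm m \<phi>)\<^sup>2 \<le> (N\<^sup>2 * K) * sob_sq (2 * real m + 2) \<phi>" if \<phi>: "\<phi> \<in> test_fun" for \<phi>
  proof -
    define R where "R = sqrt (K * sob_sq (2 * real m + 2) \<phi>)"
    have le: "cmod ((partial_t ^^ i) ((partial_x ^^ j) \<phi>) z) \<le> R" if "i + j \<le> m" for i j z
      unfolding R_def K_def by (rule real_le_rsqrt[OF norm_partials_le_sob_sq[OF \<phi> that]])
    have "Ck_norm m \<phi> \<le> (\<Sum>(i, j) \<in> {(i, j). i + j \<le> m}. R)"
      unfolding Ck_norm_def by (rule sum_mono) (auto intro!: cSUP_least le)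
    also have "\<dots> = N * R" by (simp add: N_def)
    finally have "Ck_norm m \<phi> \<le> N * R" .
    moreover have "0 \<le> Ck_norm m \<phi>"
      by (rule Ck_norm_nonneg[OF \<phi>])
    ultimately have "(Ck_norm m \<phi>)\<^sup>2 \<le> (N * R)\<^sup>2" by (rule power_mono)
    then show ?thesis
      using K sob_sq_nonneg[of "2 * real m + 2" \<phi>] by (simp add: R_def power_mult_distrib mult_ac)
  qed
  then show ?thesis using that by blast
qed

section \<open>Functionals bounded in a Sobolev norm\<close>

definition linear_functional :: "functional \<Rightarrow> bool" where
  "linear_functional u \<longleftrightarrow>
    (\<forall>\<phi>\<in>test_fun. \<forall>\<psi>\<in>test_fun. u (\<lambda>z. \<phi> z + \<psi> z) = u \<phi> + u \<psi>) \<and>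
    (\<forall>c. \<forall>\<phi>\<in>test_fun. u (\<lambda>z. c * \<phi> z) = c * u \<phi>)"

text \<open>Membership in the dual of the space of order \<open>s\<close>, that is, in the Sobolev
  space of order \<open>- s\<close>. Extensionality is left out so that functionals given by a bare
  formula, such as a series of coefficients, qualify.\<close>

definition sob_bounded :: "real \<Rightarrow> functional \<Rightarrow> bool" where
  "sob_bounded s u \<longleftrightarrow> linear_functional u \<and>
    (\<exists>C. \<forall>\<phi>\<in>test_fun. (cmod (u \<phi>))\<^sup>2 \<le> C * sob_sq s \<phi>)"

lemma linear_functionalD:
  assumes "linear_functional u" "\<phi> \<in> test_fun"
  shows "\<psi> \<in> test_fun \<Longrightarrow> u (\<lambda>z. \<phi> z + \<psi> z) = u \<phi> + u \<psi>" "u (\<lambda>z. c * \<phi> z) = c * u \<phi>"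
  using assms by (auto simp: linear_functional_def)

lemma linear_functional_sum:
  assumes u: "linear_functional u" and "finite F" "\<And>k. k \<in> F \<Longrightarrow> \<phi> k \<in> test_fun"
  shows "u (\<lambda>z. \<Sum>k\<in>F. \<phi> k z) = (\<Sum>k\<in>F. u (\<phi> k))"
  using assms(2,3)
proof (induction F rule: finite_induct)
  case empty
  show ?case using linear_functionalD(2)[OF u test_fun_const, of 0] by simp
next
  case (insert k F)
  then show ?case
    using linear_functionalD(1)[OF u _ test_fun_sum, of "\<phi> k" F \<phi>] by simp
qed

lemma sob_boundedE:
  assumes "sob_bounded s u"
  obtains C where "0 \<le> C" "\<And>\<phi>. \<phi> \<in> test_fun \<Longrightarrow> (cmod (u \<phi>))\<^sup>2 \<le> C * sob_sq s \<phi>"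
proof -
  obtain C where C: "\<And>\<phi>. \<phi> \<in> test_fun \<Longrightarrow> (cmod (u \<phi>))\<^sup>2 \<le> C * sob_sq s \<phi>"
    using assms by (auto simp: sob_bounded_def)
  have "(cmod (u \<phi>))\<^sup>2 \<le> max C 0 * sob_sq s \<phi>" if "\<phi> \<in> test_fun" for \<phi>
    using C[OF that] mult_right_mono[OF max.cobounded1[of C 0] sob_sq_nonneg[of s \<phi>]] by linarith
  then show ?thesis using that[of "max C 0"] by simp
qed

text \<open>The norms \<open>Ck_norm\<close> and \<open>sob_sq\<close> dominate each other after a
  shift of the order, so continuity for either family is the same. From here on distributions are
  handled through Hilbert norms alone.\<close>

lemma distributions_iff:
  "u \<in> distributions \<longleftrightarrow> u \<in> extensional test_fun \<and> (\<exists>s. sob_bounded s u)"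
proof
  assume u: "u \<in> distributions"
  then have "\<exists>C m. \<forall>\<phi>\<in>test_fun. cmod (u \<phi>) \<le> C * Ck_norm m \<phi>"
    by (simp add: distributions_def)
  then obtain C m where C: "\<And>\<phi>. \<phi> \<in> test_fun \<Longrightarrow> cmod (u \<phi>) \<le> C * Ck_norm m \<phi>"
    by blast
  obtain D where D: "\<And>\<phi>. \<phi> \<in> test_fun \<Longrightarrow> (Ck_norm m \<phi>)\<^sup>2 \<le> D * sob_sq (2 * real m + 2) \<phi>"
    using Ck_norm_le_sob_sq by blast
  have "(cmod (u \<phi>))\<^sup>2 \<le> (C\<^sup>2 * D) * sob_sq (2 * real m + 2) \<phi>" if "\<phi> \<in> test_fun" for \<phi>
  proof -
    have "(cmod (u \<phi>))\<^sup>2 \<le> (C * Ck_norm m \<phi>)\<^sup>2"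
      using C[OF that] by (rule power_mono) simp
    also have "\<dots> = C\<^sup>2 * (Ck_norm m \<phi>)\<^sup>2" by (rule power_mult_distrib)
    also have "\<dots> \<le> C\<^sup>2 * (D * sob_sq (2 * real m + 2) \<phi>)"
      by (rule mult_left_mono[OF D[OF that]]) simp
    finally show ?thesis by simp
  qed
  then show "u \<in> extensional test_fun \<and> (\<exists>s. sob_bounded s u)"
    using u by (auto simp: distributions_def sob_bounded_def linear_functional_def)
next
  assume u: "u \<in> extensional test_fun \<and> (\<exists>s. sob_bounded s u)"
  then obtain s where s: "sob_bounded s u" by blast
  obtain C where C: "0 \<le> C" "\<And>\<phi>. \<phi> \<in> test_fun \<Longrightarrow> (cmod (u \<phi>))\<^sup>2 \<le> C * sob_sq s \<phi>"
    using sob_boundedE[OF s] by blast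
  obtain D m where D: "\<And>\<phi>. \<phi> \<in> test_fun \<Longrightarrow> sob_sq s \<phi> \<le> D * (Ck_norm m \<phi>)\<^sup>2"
    using sob_sq_le_Ck_norm[of s] by metis
  have "cmod (u \<phi>) \<le> sqrt (C * \<bar>D\<bar>) * Ck_norm m \<phi>" if \<phi>: "\<phi> \<in> test_fun" for \<phi>
  proof -
    have "(cmod (u \<phi>))\<^sup>2 \<le> C * (\<bar>D\<bar> * (Ck_norm m \<phi>)\<^sup>2)"
      using C(2)[OF \<phi>] mult_left_mono[OF D[OF \<phi>] C(1)]
        mult_left_mono[OF mult_right_mono[OF abs_ge_self[of D] zero_le_power2[of "Ck_norm m \<phi>"]] C(1)]
      by linarith
    then have "cmod (u \<phi>) \<le> sqrt (C * \<bar>D\<bar> * (Ck_norm m \<phi>)\<^sup>2)"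
      by (intro real_le_rsqrt) (simp add: mult.assoc)
    moreover have "0 \<le> Ck_norm m \<phi>"
      by (rule Ck_norm_nonneg[OF \<phi>])
    ultimately show ?thesis by (simp add: real_sqrt_mult)
  qed
  then show "u \<in> distributions"
    using u s by (auto simp: distributions_def sob_bounded_def linear_functional_def)
qed

text \<open>Subtracting a partial sum from \<phi> deletes finitely many coefficients, so the
  remainder measured by \<open>sob_sq s\<close> is the tail of a convergent series. A bounded
  functional therefore passes to the limit, and it is determined by its values on the
  exponentials.\<close>

lemma sob_bounded_has_sum:
  assumes u: "sob_bounded s u" and \<phi>: "\<phi> \<in> test_fun"
  shows "((\<lambda>k. torus_coeff \<phi> k * u (trig k)) has_sum u \<phi>) UNIV"
proof -
  note lin = u[unfolded sob_bounded_def, THEN conjunct1]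
  obtain C where C: "0 \<le> C" "\<And>\<phi>. \<phi> \<in> test_fun \<Longrightarrow> (cmod (u \<phi>))\<^sup>2 \<le> C * sob_sq s \<phi>"
    using sob_boundedE[OF u] by blast
  let ?q = "\<lambda>k. weight k powr s * (cmod (torus_coeff \<phi> k))\<^sup>2"
  have bound: "(cmod (u \<phi> - (\<Sum>k\<in>F. torus_coeff \<phi> k * u (trig k))))\<^sup>2 \<le> C * (sob_sq s \<phi> - sum ?q F)"
    if F: "finite F" for F
  proof -
    define p where "p = (\<lambda>z. \<Sum>k\<in>F. (- torus_coeff \<phi> k) * trig k z)"
    have p: "p \<in> test_fun"
      unfolding p_def by (intro test_fun_sum test_fun_cmult test_fun_trig)
    have "u p = (\<Sum>k\<in>F. u (\<lambda>z. (- torus_coeff \<phi> k) * trig k z))"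
      unfolding p_def by (rule linear_functional_sum[OF lin F test_fun_cmult[OF test_fun_trig]])
    then have "u (\<lambda>z. \<phi> z + p z) = u \<phi> + (\<Sum>k\<in>F. u (\<lambda>z. (- torus_coeff \<phi> k) * trig k z))"
      by (simp only: linear_functionalD(1)[OF lin \<phi> p])
    also have "\<dots> = u \<phi> - (\<Sum>k\<in>F. torus_coeff \<phi> k * u (trig k))"
      by (simp only: linear_functionalD(2)[OF lin test_fun_trig]) (simp add: sum_negf)
    finally have u_eq: "u (\<lambda>z. \<phi> z + p z) = u \<phi> - (\<Sum>k\<in>F. torus_coeff \<phi> k * u (trig k))" .
    have "torus_coeff p l = (if l \<in> F then - torus_coeff \<phi> l else 0)" for l
      unfolding p_def by (rule torus_coeff_trig_sum[OF F])
    then have co: "torus_coeff (\<lambda>z. \<phi> z + p z) l = (if l \<in> F then 0 else torus_coeff \<phi> l)" for l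
      by (simp add: torus_coeff_add[OF \<phi> p])
    have "sob_sq s (\<lambda>z. \<phi> z + p z) = infsum ?q (UNIV - F)"
      unfolding sob_sq_def by (rule infsum_cong_neutral) (auto simp: co)
    also have "\<dots> = sob_sq s \<phi> - sum ?q F"
      using infsum_Diff[OF summable_sob_sq[OF \<phi>] summable_on_finite[OF F]] F by (simp add: sob_sq_def)
    finally show ?thesis
      using C(2)[OF test_fun_add[OF \<phi> p]] by (simp add: u_eq)
  qed
  have lim: "((\<lambda>F. C * (sob_sq s \<phi> - sum ?q F)) \<longlongrightarrow> C * (sob_sq s \<phi> - sob_sq s \<phi>)) (finite_subsets_at_top UNIV)"
    unfolding sob_sq_def by (intro tendsto_intros infsum_tendsto summable_sob_sq[OF \<phi>])
  have "((\<lambda>F. (cmod (u \<phi> - (\<Sum>k\<in>F. torus_coeff \<phi> k * u (trig k))))\<^sup>2) \<longlongrightarrow> 0) (finite_subsets_at_top UNIV)"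
  proof (rule tendsto_sandwich[OF _ _ tendsto_const])
    show "\<forall>\<^sub>F F in finite_subsets_at_top UNIV.
        (cmod (u \<phi> - (\<Sum>k\<in>F. torus_coeff \<phi> k * u (trig k))))\<^sup>2 \<le> C * (sob_sq s \<phi> - sum ?q F)"
      by (rule eventually_finite_subsets_at_top_weakI) (rule bound)
    show "((\<lambda>F. C * (sob_sq s \<phi> - sum ?q F)) \<longlongrightarrow> 0) (finite_subsets_at_top UNIV)"
      using lim by simp
  qed simp
  from tendsto_real_sqrt[OF this]
  have "((\<lambda>F. u \<phi> - (\<Sum>k\<in>F. torus_coeff \<phi> k * u (trig k))) \<longlongrightarrow> 0) (finite_subsets_at_top UNIV)"
    by (simp add: tendsto_norm_zero_iff)
  from tendsto_diff[OF tendsto_const[of "u \<phi>"] this] show ?thesis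
    by (simp add: has_sum_def)
qed

text \<open>Orders \<open>s\<close> and \<open>- s\<close> are dual: the powers \<open>s / 2\<close>
  and \<open>- s / 2\<close> of the weight are distributed over the two factors before
  Cauchy-Schwarz is applied.\<close>

lemma Cauchy_Schwarz_weight:
  fixes c :: "int \<times> int \<Rightarrow> complex"
  assumes \<phi>: "\<phi> \<in> test_fun" and c: "(\<lambda>k. weight k powr s * (cmod (c k))\<^sup>2) summable_on UNIV"
  shows "(\<lambda>k. torus_coeff \<phi> k * c k) summable_on UNIV"
    and "(cmod (\<Sum>\<^sub>\<infinity>k. torus_coeff \<phi> k * c k))\<^sup>2
      \<le> (\<Sum>\<^sub>\<infinity>k. weight k powr s * (cmod (c k))\<^sup>2) * sob_sq (- s) \<phi>"
proof -
  define f g where "f k = weight k powr (s / 2) * cmod (c k)"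
    and "g k = weight k powr (- s / 2) * cmod (torus_coeff \<phi> k)" for k
  have powr: "(weight k powr (r / 2))\<^sup>2 = weight k powr r" for k r
    by (simp add: power2_eq_square flip: powr_add)
  have f: "(\<lambda>k. (f k)\<^sup>2) = (\<lambda>k. weight k powr s * (cmod (c k))\<^sup>2)"
    by (simp only: f_def power_mult_distrib powr)
  have g: "(\<lambda>k. (g k)\<^sup>2) = (\<lambda>k. weight k powr (- s) * (cmod (torus_coeff \<phi> k))\<^sup>2)"
    by (simp only: g_def power_mult_distrib powr)
  have fg: "f k * g k = norm (torus_coeff \<phi> k * c k)" for k
    by (simp add: f_def g_def norm_mult mult_ac flip: powr_add)
  have summ: "(\<lambda>k. (f k)\<^sup>2) summable_on UNIV" "(\<lambda>k. (g k)\<^sup>2) summable_on UNIV"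
    unfolding f g using c summable_sob_sq[OF \<phi>] by auto
  have nonneg: "0 \<le> f k" "0 \<le> g k" for k by (auto simp: f_def g_def)
  have s: "(\<lambda>k. norm (torus_coeff \<phi> k * c k)) summable_on UNIV"
    using infsum_Cauchy_Schwarz(1)[OF summ nonneg] by (simp only: fg)
  then show "(\<lambda>k. torus_coeff \<phi> k * c k) summable_on UNIV"
    by (rule abs_summable_summable)
  have "(cmod (\<Sum>\<^sub>\<infinity>k. torus_coeff \<phi> k * c k))\<^sup>2 \<le> (\<Sum>\<^sub>\<infinity>k. norm (torus_coeff \<phi> k * c k))\<^sup>2"
    by (intro power_mono norm_infsum_bound s) simp
  also have "\<dots> \<le> (\<Sum>\<^sub>\<infinity>k. weight k powr s * (cmod (c k))\<^sup>2) * sob_sq (- s) \<phi>"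
    using infsum_Cauchy_Schwarz(2)[OF summ nonneg] unfolding f g sob_sq_def by (simp only: fg)
  finally show "(cmod (\<Sum>\<^sub>\<infinity>k. torus_coeff \<phi> k * c k))\<^sup>2
      \<le> (\<Sum>\<^sub>\<infinity>k. weight k powr s * (cmod (c k))\<^sup>2) * sob_sq (- s) \<phi>" .
qed

text \<open>The coefficients \<open>a\<close> are the extremal choice in Cauchy-Schwarz. For the
  resulting polynomial \<open>p\<close>, both \<open>u p\<close> and \<open>sob_sq (- s) p\<close>
  equal the sum in question, so the assumed bound says that its square is at most \<open>C\<close>
  times itself.\<close>

lemma sum_weight_le:
  assumes lin: "linear_functional u" and C: "0 \<le> C"
    "\<And>\<phi>. \<phi> \<in> test_fun \<Longrightarrow> (cmod (u \<phi>))\<^sup>2 \<le> C * sob_sq (- s) \<phi>" and F: "finite F"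
  shows "(\<Sum>k\<in>F. weight k powr s * (cmod (u (trig k)))\<^sup>2) \<le> C" (is "sum ?q F \<le> C")
proof -
  define a where "a k = of_real (weight k powr s) * cnj (u (trig k))" for k
  define p where "p = (\<lambda>z. \<Sum>k\<in>F. a k * trig k z)"
  have p: "p \<in> test_fun"
    unfolding p_def by (intro test_fun_sum test_fun_cmult test_fun_trig)
  have "u p = (\<Sum>k\<in>F. a k * u (trig k))"
    unfolding p_def
    by (subst linear_functional_sum[OF lin F], intro test_fun_cmult test_fun_trig)
       (simp add: linear_functionalD(2)[OF lin test_fun_trig])
  also have "\<dots> = of_real (sum ?q F)"
    by (simp add: a_def complex_norm_square mult_ac del: of_real_power)
  finally have "cmod (u p) = \<bar>sum ?q F\<bar>" by (simp only: norm_of_real)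
  then have up: "cmod (u p) = sum ?q F" by (simp add: sum_nonneg)
  have co: "torus_coeff p l = (if l \<in> F then a l else 0)" for l
    unfolding p_def by (rule torus_coeff_trig_sum[OF F])
  have "sob_sq (- s) p = (\<Sum>\<^sub>\<infinity>k\<in>F. ?q k)"
    unfolding sob_sq_def
  proof (rule infsum_cong_neutral)
    fix k assume "k \<in> UNIV \<inter> F"
    then show "weight k powr (- s) * (cmod (torus_coeff p k))\<^sup>2 = ?q k"
      by (simp add: co a_def norm_mult power_mult_distrib power2_eq_square powr_minus divide_simps)
  qed (auto simp: co)
  also have "\<dots> = sum ?q F" using F by simp
  finally have "(sum ?q F)\<^sup>2 \<le> C * sum ?q F"
    using C(2)[OF p] by (simp add: up)
  moreover have "0 \<le> sum ?q F" by (simp add: sum_nonneg)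
  ultimately show ?thesis
    using C(1) by (cases "sum ?q F = 0") (auto simp: power2_eq_square)
qed

text \<open>The a priori order \<open>r\<close> is what makes the Fourier expansion of
  \<open>u\<close> available. The values on exponentials alone then decide whether \<open>u\<close>
  has the possibly much better order \<open>- s\<close>.\<close>

lemma sob_bounded_iff:
  assumes u: "sob_bounded r u"
  shows "sob_bounded (- s) u \<longleftrightarrow> (\<lambda>k. weight k powr s * (cmod (u (trig k)))\<^sup>2) summable_on UNIV"
    (is "_ \<longleftrightarrow> ?q summable_on UNIV")
proof
  assume "sob_bounded (- s) u"
  then obtain C where C: "0 \<le> C" "\<And>\<phi>. \<phi> \<in> test_fun \<Longrightarrow> (cmod (u \<phi>))\<^sup>2 \<le> C * sob_sq (- s) \<phi>"
    using sob_boundedE by blast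
  have "sum ?q F \<le> C" if "finite F" for F
    using sum_weight_le[OF _ C that] u by (simp add: sob_bounded_def)
  then show "?q summable_on UNIV"
    by (intro nonneg_bdd_above_summable_on) (auto intro!: bdd_aboveI[where M = C])
next
  assume q: "?q summable_on UNIV"
  have "(cmod (u \<phi>))\<^sup>2 \<le> infsum ?q UNIV * sob_sq (- s) \<phi>" if "\<phi> \<in> test_fun" for \<phi>
    using Cauchy_Schwarz_weight(2)[OF that q] infsumI[OF sob_bounded_has_sum[OF u that]] by simp
  then show "sob_bounded (- s) u"
    using u by (auto simp: sob_bounded_def)
qed

lemma bracket_powr: "bracket (real_of_int \<tau>, real_of_int \<xi>) powr (2 * s) = weight (\<tau>, \<xi>) powr s"
proof -
  have "bracket (real_of_int \<tau>, real_of_int \<xi>) = weight (\<tau>, \<xi>) powr (1 / 2)"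
    by (simp add: bracket_def weight_def norm_prod_def powr_half_sqrt add.assoc)
  then show ?thesis by (simp add: powr_powr)
qed

lemma fourier_coeff_eq: "fourier_coeff u k = u (trig (- k)) / of_real ((2 * pi)\<^sup>2)"
proof -
  have "(\<lambda>(t, x). exp (- \<i> * of_real (t * of_int \<tau> + x * of_int \<xi>))) = trig (- (\<tau>, \<xi>))" for \<tau> \<xi>
    by (auto simp: fun_eq_iff trig_def cis_conv_exp algebra_simps)
  then show ?thesis by (cases k) (simp add: fourier_coeff_def)
qed

text \<open>Fourier coefficients evaluate \<open>u\<close> at \<open>trig (- k)\<close>. Since the
  weight is even, neither this reflection nor the normalizing constant affects summability.\<close>

lemma sobolev_iff: "u \<in> sobolev s \<longleftrightarrow> u \<in> extensional test_fun \<and> sob_bounded (- s) u"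
proof -
  let ?q = "\<lambda>k. weight k powr s * (cmod (u (trig k)))\<^sup>2"
  have "(\<lambda>(\<tau>, \<xi>). bracket (real_of_int \<tau>, real_of_int \<xi>) powr (2 * s) * (norm (fourier_coeff u (\<tau>, \<xi>)))\<^sup>2)
      = (\<lambda>k. (1 / (2 * pi) ^ 4) * ?q (- k))"
    by (auto simp: fun_eq_iff bracket_powr fourier_coeff_eq norm_divide power_divide weight_def norm_power
        simp flip: power_mult)
  then have "u \<in> sobolev s \<longleftrightarrow> u \<in> distributions \<and> (\<lambda>k. (1 / (2 * pi) ^ 4) * ?q (- k)) summable_on UNIV"
    by (simp add: sobolev_def)
  also have "(\<lambda>k. (1 / (2 * pi) ^ 4) * ?q (- k)) summable_on UNIV \<longleftrightarrow> (\<lambda>k. ?q (- k)) summable_on UNIV"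
    by (intro summable_on_cmult_right') simp
  also have "\<dots> \<longleftrightarrow> ?q summable_on UNIV"
    by (intro summable_on_reindex_bij_betw bij_betwI[where g = uminus]) auto
  finally show ?thesis
    unfolding distributions_iff using sob_bounded_iff by blast
qed

section \<open>Shears of the torus\<close>

text \<open>Defined on functions only. A distribution \<open>u\<close> is sheared by passing to
  \<open>u (shear A \<phi>)\<close>; there is no Jacobian factor, as the change of variables
  preserves area.\<close>

definition shear :: "(real \<Rightarrow> real) \<Rightarrow> (real \<times> real \<Rightarrow> complex) \<Rightarrow> real \<times> real \<Rightarrow> complex" where
  "shear A \<phi> z = \<phi> (fst z, snd z + A (fst z))"

lemma smooth_circleD:
  assumes "A \<in> smooth_circle" shows "smooth_fun A" "A (t + 2 * pi) = A t"
  using assms by (auto simp: smooth_circle_def)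

lemma smooth_circle_deriv: "A \<in> smooth_circle \<Longrightarrow> dir_deriv v A \<in> smooth_circle"
  using dir_deriv_periodic by (auto simp: smooth_circle_def smooth_fun_dir_deriv)

lemma smooth_circle_uminus:
  assumes "A \<in> smooth_circle" shows "(\<lambda>t. - A t) \<in> smooth_circle"
proof -
  have "smooth_fun (\<lambda>t. (-1) * A t)"
    using assms by (intro smooth_fun_mult smooth_fun_const) (simp add: smooth_circle_def)
  then show ?thesis using assms by (simp add: smooth_circle_def)
qed

lemma test_fun_shear:
  assumes A: "A \<in> smooth_circle" and \<phi>: "\<phi> \<in> test_fun" shows "shear A \<phi> \<in> test_fun"
proof -
  have "smooth_fun (shear A \<phi>)"
    unfolding shear_def[abs_def]
    by (rule smooth_fun_compose(1)[OF test_funD(1)[OF \<phi>] smooth_fun_shear(1)[OF smooth_circleD(1)[OF A]]])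
  moreover have "\<phi> (t, x + 2 * pi + y) = \<phi> (t, x + y)" for t x y
    using test_funD(3)[OF \<phi>, of t "x + y"] by (simp add: add_ac)
  ultimately show ?thesis
    by (simp add: test_fun_def shear_def smooth_circleD(2)[OF A] test_funD(2)[OF \<phi>])
qed

lemma shear_uminus_shear: "shear (\<lambda>t. - A t) (shear A \<phi>) = \<phi>" "shear A (shear (\<lambda>t. - A t) \<phi>) = \<phi>"
  by (auto simp: shear_def fun_eq_iff)

lemma dir_deriv_linear:
  assumes "smooth_fun f"
  shows "dir_deriv (v + w) f z = dir_deriv v f z + dir_deriv w f z"
    and "dir_deriv (r *\<^sub>R v) f z = r *\<^sub>R dir_deriv v f z"
  by (rule linear_add[OF has_derivative_linear[OF smooth_fun_has_derivative[OF assms]]],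
      rule linear_scale[OF has_derivative_linear[OF smooth_fun_has_derivative[OF assms]]])

text \<open>The additional term in the derivative along \<open>t\<close> is the purpose of the
  shear: when \<open>A\<close> has derivative \<open>a - \<alpha>\<close>, it replaces the variable
  coefficient by its mean.\<close>

lemma partial_shear:
  assumes A: "A \<in> smooth_circle" and \<phi>: "\<phi> \<in> test_fun"
  shows "partial_x (shear A \<phi>) = shear A (partial_x \<phi>)"
    and "partial_t (shear A \<phi>) =
      (\<lambda>z. shear A (partial_t \<phi>) z + of_real (dir_deriv 1 A (fst z)) * shear A (partial_x \<phi>) z)"
proof -
  have D: "dir_deriv v (shear A \<phi>) z =
      dir_deriv (fst v, snd v + fst v * dir_deriv 1 A (fst z)) \<phi> (fst z, snd z + A (fst z))" for v z
    unfolding shear_def[abs_def]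
    by (subst smooth_fun_compose(2)[OF test_funD(1)[OF \<phi>] smooth_fun_shear(1)[OF smooth_circleD(1)[OF A]]])
       (simp add: smooth_fun_shear(2)[OF smooth_circleD(1)[OF A]])
  show "partial_x (shear A \<phi>) = shear A (partial_x \<phi>)"
    by (simp add: fun_eq_iff D) (simp add: shear_def)
  have "dir_deriv (1, r) \<phi> z = partial_t \<phi> z + of_real r * partial_x \<phi> z" for r z
    using dir_deriv_linear(1)[OF test_funD(1)[OF \<phi>], of "(1, 0)" "r *\<^sub>R (0, 1)" z]
      dir_deriv_linear(2)[OF test_funD(1)[OF \<phi>], of r "(0, 1)" z]
    by (simp add: scaleR_conv_of_real)
  from this[of "dir_deriv 1 A (fst z)" "(fst z, snd z + A (fst z))" for z]
  show "partial_t (shear A \<phi>) =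
      (\<lambda>z. shear A (partial_t \<phi>) z + of_real (dir_deriv 1 A (fst z)) * shear A (partial_x \<phi>) z)"
    by (intro ext) (simp add: D, simp add: shear_def)
qed

lemma torus_mean_shear_test_fun:
  assumes "A \<in> smooth_circle" "\<phi> \<in> test_fun"
  shows "torus_mean (shear A \<phi>) = torus_mean \<phi>"
proof -
  have "shear A \<phi> = (\<lambda>(t, x). \<phi> (t, x + A t))" by (auto simp: shear_def)
  then show ?thesis
    using torus_mean_shear[OF test_fun_continuous[OF assms(2)]
        smooth_fun_continuous[OF smooth_circleD(1)[OF assms(1)]] test_funD(3)[OF assms(2)]] by simp
qed

lemma infsum_add_le:
  fixes w :: "'a \<Rightarrow> real" and f g :: "'a \<Rightarrow> complex"
  assumes "\<And>k. 0 \<le> w k" "(\<lambda>k. w k * (cmod (f k))\<^sup>2) summable_on A" "(\<lambda>k. w k * (cmod (g k))\<^sup>2) summable_on A"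
  shows "(\<Sum>\<^sub>\<infinity>k\<in>A. w k * (cmod (f k + g k))\<^sup>2)
    \<le> 2 * (\<Sum>\<^sub>\<infinity>k\<in>A. w k * (cmod (f k))\<^sup>2) + 2 * (\<Sum>\<^sub>\<infinity>k\<in>A. w k * (cmod (g k))\<^sup>2)"
proof -
  have le: "w k * (cmod (f k + g k))\<^sup>2 \<le> 2 * (w k * (cmod (f k))\<^sup>2) + 2 * (w k * (cmod (g k))\<^sup>2)" for k
  proof -
    have "(cmod (f k + g k))\<^sup>2 \<le> (cmod (f k) + cmod (g k))\<^sup>2"
      by (intro power_mono norm_triangle_ineq) simp
    also have "\<dots> \<le> 2 * (cmod (f k))\<^sup>2 + 2 * (cmod (g k))\<^sup>2"
      using zero_le_power2[of "cmod (f k) - cmod (g k)"] by (simp add: power2_sum power2_diff)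
    finally have "w k * (cmod (f k + g k))\<^sup>2 \<le> w k * (2 * (cmod (f k))\<^sup>2 + 2 * (cmod (g k))\<^sup>2)"
      by (rule mult_left_mono[OF _ assms(1)])
    then show ?thesis by (simp add: algebra_simps)
  qed
  have s: "(\<lambda>k. 2 * (w k * (cmod (f k))\<^sup>2) + 2 * (w k * (cmod (g k))\<^sup>2)) summable_on A"
    by (intro summable_on_add summable_on_cmult_right assms)
  have "(\<Sum>\<^sub>\<infinity>k\<in>A. w k * (cmod (f k + g k))\<^sup>2)
      \<le> (\<Sum>\<^sub>\<infinity>k\<in>A. 2 * (w k * (cmod (f k))\<^sup>2) + 2 * (w k * (cmod (g k))\<^sup>2))"
    by (rule infsum_mono[OF summable_on_comparison_test[OF s le] s le]) (simp add: assms(1))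
  also have "\<dots> = 2 * (\<Sum>\<^sub>\<infinity>k\<in>A. w k * (cmod (f k))\<^sup>2) + 2 * (\<Sum>\<^sub>\<infinity>k\<in>A. w k * (cmod (g k))\<^sup>2)"
    by (subst infsum_add) (auto intro!: summable_on_cmult_right assms simp: infsum_cmult_right')
  finally show ?thesis .
qed

lemma sob_sq_add:
  assumes "\<phi> \<in> test_fun" "\<psi> \<in> test_fun"
  shows "sob_sq s (\<lambda>z. \<phi> z + \<psi> z) \<le> 2 * sob_sq s \<phi> + 2 * sob_sq s \<psi>"
  unfolding sob_sq_def torus_coeff_add[OF assms]
  by (rule infsum_add_le) (simp_all add: summable_sob_sq assms)

text \<open>One factor of \<open>weight k\<close> is 1 plus the squared moduli of the symbols of the
  two partial derivatives. This exact identity drives the inductions on integer orders.\<close>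

lemma sob_sq_Suc:
  assumes \<phi>: "\<phi> \<in> test_fun"
  shows "sob_sq (s + 1) \<phi> = sob_sq s \<phi> + sob_sq s (partial_t \<phi>) + sob_sq s (partial_x \<phi>)"
proof -
  have eq: "weight k powr (s + 1) * (cmod (torus_coeff \<phi> k))\<^sup>2 =
      weight k powr s * (cmod (torus_coeff \<phi> k))\<^sup>2
      + weight k powr s * (cmod (torus_coeff (partial_t \<phi>) k))\<^sup>2
      + weight k powr s * (cmod (torus_coeff (partial_x \<phi>) k))\<^sup>2" for k
  proof -
    have "weight k powr (s + 1) = weight k powr s * (1 + (of_int (fst k))\<^sup>2 + (of_int (snd k))\<^sup>2)"
      by (simp add: powr_add) (simp add: weight_def)
    then show ?thesis
      by (simp add: torus_coeff_partial[OF \<phi>] norm_mult power_mult_distrib algebra_simps)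
  qed
  note s = summable_sob_sq[OF \<phi>] summable_sob_sq[OF test_fun_dir_deriv[OF \<phi>]]
  show ?thesis
    unfolding sob_sq_def eq by (simp add: infsum_add summable_on_add s)
qed

lemma sob_sq_Suc_ge:
  assumes "\<phi> \<in> test_fun"
  shows "sob_sq s \<phi> \<le> sob_sq (s + 1) \<phi>" "sob_sq s (partial_t \<phi>) \<le> sob_sq (s + 1) \<phi>"
    "sob_sq s (partial_x \<phi>) \<le> sob_sq (s + 1) \<phi>"
  using sob_sq_nonneg[of s \<phi>] sob_sq_nonneg[of s "partial_t \<phi>"] sob_sq_nonneg[of s "partial_x \<phi>"]
  by (simp_all add: sob_sq_Suc[OF assms])

text \<open>Parseval's identity, obtained by pairing \<phi> with its conjugate. It brings order 0
  back to pointwise values, where products and shears are directly controlled.\<close>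

lemma sob_sq_0:
  assumes \<phi>: "\<phi> \<in> test_fun"
  shows "sob_sq 0 \<phi> = torus_mean (\<lambda>z. (cmod (\<phi> z))\<^sup>2)"
proof -
  have "smooth_fun (\<lambda>z. cnj (\<phi> z))"
    by (rule smooth_fun_compose(1)[OF smooth_fun_linear[OF bounded_linear_cnj] test_funD(1)[OF \<phi>]])
  then have c: "(\<lambda>z. cnj (\<phi> z)) \<in> test_fun"
    using test_funD(2,3)[OF \<phi>] by (simp add: test_fun_def)
  have "torus_coeff (\<lambda>z. cnj (\<phi> z)) (- k) = cnj (torus_coeff \<phi> k)" for k
    unfolding torus_coeff_def torus_mean_cnj[symmetric] by (simp add: cnj_trig)
  then have "((\<lambda>k. torus_coeff \<phi> k * cnj (torus_coeff \<phi> k)) has_sum torus_mean (\<lambda>z. \<phi> z * cnj (\<phi> z))) UNIV"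
    using torus_mean_mult[OF \<phi> c] by simp
  then have "((\<lambda>k. complex_of_real ((cmod (torus_coeff \<phi> k))\<^sup>2)) has_sum
      torus_mean (\<lambda>z. complex_of_real ((cmod (\<phi> z))\<^sup>2))) UNIV"
    by (simp only: complex_norm_square)
  moreover have "continuous_on UNIV (\<lambda>z. (cmod (\<phi> z))\<^sup>2)"
    by (intro continuous_intros test_fun_continuous \<phi>)
  ultimately have "((\<lambda>k. (cmod (torus_coeff \<phi> k))\<^sup>2) has_sum torus_mean (\<lambda>z. (cmod (\<phi> z))\<^sup>2)) UNIV"
    by (simp only: torus_mean_of_real has_sum_of_real_iff)
  then show ?thesis
    by (simp add: sob_sq_def infsumI)
qed

text \<open>Induction on the order with the Leibniz rule. The factor \<open>b\<close> is generalized
  because the hypothesis is applied to its derivatives too.\<close>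

lemma sob_sq_mult_le:
  assumes "b \<in> test_fun"
  shows "\<exists>C\<ge>0. \<forall>\<phi>\<in>test_fun. sob_sq (real m) (\<lambda>z. b z * \<phi> z) \<le> C * sob_sq (real m) \<phi>"
  using assms
proof (induction m arbitrary: b)
  case 0
  obtain B where B: "\<And>z. cmod (b z) \<le> B" using test_fun_bounded[OF 0] by blast
  have "sob_sq 0 (\<lambda>z. b z * \<phi> z) \<le> B\<^sup>2 * sob_sq 0 \<phi>" if \<phi>: "\<phi> \<in> test_fun" for \<phi>
  proof -
    have "sob_sq 0 (\<lambda>z. b z * \<phi> z) \<le> torus_mean (\<lambda>z. B\<^sup>2 * (cmod (\<phi> z))\<^sup>2)"
      unfolding sob_sq_0[OF test_fun_mult[OF 0 \<phi>]]
    proof (rule torus_mean_mono)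
      show "continuous_on UNIV (\<lambda>z. (cmod (b z * \<phi> z))\<^sup>2)" "continuous_on UNIV (\<lambda>z. B\<^sup>2 * (cmod (\<phi> z))\<^sup>2)"
        by (intro continuous_intros test_fun_continuous \<phi> 0)+
      show "(cmod (b z * \<phi> z))\<^sup>2 \<le> B\<^sup>2 * (cmod (\<phi> z))\<^sup>2" for z
        unfolding norm_mult power_mult_distrib
        by (intro mult_right_mono power_mono B) auto
    qed
    also have "\<dots> = B\<^sup>2 * sob_sq 0 \<phi>"
      unfolding sob_sq_0[OF \<phi>] torus_mean_def by simp
    finally show ?thesis .
  qed
  then show ?case by (intro exI[of _ "B\<^sup>2"]) simp
next
  case (Suc m)
  note b = Suc.prems
  obtain C where C: "0 \<le> C" "\<And>\<phi>. \<phi> \<in> test_fun \<Longrightarrow> sob_sq (real m) (\<lambda>z. b z * \<phi> z) \<le> C * sob_sq (real m) \<phi>"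
    using Suc.IH[OF b] by blast
  obtain Ct where Ct: "0 \<le> Ct" "\<And>\<phi>. \<phi> \<in> test_fun \<Longrightarrow> sob_sq (real m) (\<lambda>z. partial_t b z * \<phi> z) \<le> Ct * sob_sq (real m) \<phi>"
    using Suc.IH[OF test_fun_dir_deriv[OF b]] by blast
  obtain Cx where Cx: "0 \<le> Cx" "\<And>\<phi>. \<phi> \<in> test_fun \<Longrightarrow> sob_sq (real m) (\<lambda>z. partial_x b z * \<phi> z) \<le> Cx * sob_sq (real m) \<phi>"
    using Suc.IH[OF test_fun_dir_deriv[OF b]] by blast
  \<comment> \<open>The function itself contributes \<open>C\<close>, and the two partial
    derivatives contribute \<open>2 * C + 2 * Ct\<close> and \<open>2 * C + 2 * Cx\<close>; the
    factors 2 come from splitting squares of sums.\<close>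
  have "sob_sq (real (Suc m)) (\<lambda>z. b z * \<phi> z) \<le> (5 * C + 2 * Ct + 2 * Cx) * sob_sq (real (Suc m)) \<phi>"
    if \<phi>: "\<phi> \<in> test_fun" for \<phi>
  proof -
    define q where "q = sob_sq (real m)"
    define Q where "Q = sob_sq (real m + 1) \<phi>"
    have qQ: "q \<phi> \<le> Q" "q (partial_t \<phi>) \<le> Q" "q (partial_x \<phi>) \<le> Q"
      using sob_sq_Suc_ge[OF \<phi>] by (auto simp: q_def Q_def)
    have d: "q (dir_deriv v (\<lambda>z. b z * \<phi> z)) \<le> 2 * (C * Q) + 2 * (D * Q)"
      if D: "0 \<le> D" "q (\<lambda>z. dir_deriv v b z * \<phi> z) \<le> D * q \<phi>" and v: "q (dir_deriv v \<phi>) \<le> Q" for v D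
    proof -
      have "q (dir_deriv v (\<lambda>z. b z * \<phi> z)) \<le> 2 * q (\<lambda>z. b z * dir_deriv v \<phi> z) + 2 * q (\<lambda>z. dir_deriv v b z * \<phi> z)"
        unfolding dir_deriv_mult[OF test_funD(1)[OF b] test_funD(1)[OF \<phi>]] q_def
        by (rule sob_sq_add) (intro test_fun_mult test_fun_dir_deriv b \<phi>)+
      moreover have "q (\<lambda>z. b z * dir_deriv v \<phi> z) \<le> C * Q"
        using C(2)[OF test_fun_dir_deriv[OF \<phi>], of v] mult_left_mono[OF v C(1)] by (simp add: q_def)
      moreover have "q (\<lambda>z. dir_deriv v b z * \<phi> z) \<le> D * Q"
        using D(2) mult_left_mono[OF qQ(1) D(1)] by simp
      ultimately show ?thesis by linarith
    qed
    have "q (\<lambda>z. b z * \<phi> z) \<le> C * Q"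
      using C(2)[OF \<phi>] mult_left_mono[OF qQ(1) C(1)] by (simp add: q_def)
    moreover have "sob_sq (real m + 1) (\<lambda>z. b z * \<phi> z) = q (\<lambda>z. b z * \<phi> z)
        + q (partial_t (\<lambda>z. b z * \<phi> z)) + q (partial_x (\<lambda>z. b z * \<phi> z))"
      unfolding q_def by (rule sob_sq_Suc[OF test_fun_mult[OF b \<phi>]])
    ultimately have "sob_sq (real m + 1) (\<lambda>z. b z * \<phi> z) \<le> (5 * C + 2 * Ct + 2 * Cx) * Q"
      using d[OF Ct(1) _ qQ(2)] d[OF Cx(1) _ qQ(3)] Ct(2)[OF \<phi>] Cx(2)[OF \<phi>]
      by (simp add: q_def algebra_simps)
    then show ?thesis by (simp add: Q_def add.commute)
  qed
  then show ?case
    using C(1) Ct(1) Cx(1) by (intro exI[of _ "5 * C + 2 * Ct + 2 * Cx"]) simp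
qed

text \<open>At order 0 the shear preserves the mean of the squared modulus. Raising the order by one
  uses the chain rule, whose extra term is a product with the smooth function \<open>b\<close>, the
  derivative of \<open>A\<close>.\<close>

lemma sob_sq_shear_le_nat:
  assumes A: "A \<in> smooth_circle"
  shows "\<exists>C\<ge>0. \<forall>\<phi>\<in>test_fun. sob_sq (real m) (shear A \<phi>) \<le> C * sob_sq (real m) \<phi>"
proof (induction m)
  case 0
  have "sob_sq 0 (shear A \<phi>) = sob_sq 0 \<phi>" if \<phi>: "\<phi> \<in> test_fun" for \<phi>
  proof -
    have "(\<lambda>(t, x). (cmod (\<phi> (t, x + A t)))\<^sup>2) = (\<lambda>z. (cmod (shear A \<phi> z))\<^sup>2)"
      by (auto simp: shear_def)
    then show ?thesis
      using torus_mean_shear[of "\<lambda>z. (cmod (\<phi> z))\<^sup>2" A] test_fun_continuous[OF \<phi>]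
        smooth_fun_continuous[OF smooth_circleD(1)[OF A]] test_funD(3)[OF \<phi>]
      by (simp add: sob_sq_0 \<phi> test_fun_shear[OF A] continuous_on_power continuous_on_norm)
  qed
  then show ?case by (intro exI[of _ 1]) simp
next
  case (Suc m)
  then obtain C where C: "0 \<le> C" "\<And>\<phi>. \<phi> \<in> test_fun \<Longrightarrow> sob_sq (real m) (shear A \<phi>) \<le> C * sob_sq (real m) \<phi>"
    by blast
  define b :: "real \<times> real \<Rightarrow> complex" where "b = (\<lambda>z. of_real (dir_deriv 1 A (fst z)))"
  have b: "b \<in> test_fun"
    unfolding b_def by (rule test_fun_circle[OF smooth_circle_deriv[OF A]])
  obtain D where D: "0 \<le> D" "\<And>\<phi>. \<phi> \<in> test_fun \<Longrightarrow> sob_sq (real m) (\<lambda>z. b z * \<phi> z) \<le> D * sob_sq (real m) \<phi>"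
    using sob_sq_mult_le[OF b] by blast
  \<comment> \<open>The function and its \<open>x\<close>-derivative give \<open>C\<close> each, and
    the \<open>t\<close>-derivative gives \<open>2 * C + 2 * (D * C)\<close>.\<close>
  have "sob_sq (real (Suc m)) (shear A \<phi>) \<le> (4 * C + 2 * (D * C)) * sob_sq (real (Suc m)) \<phi>"
    if \<phi>: "\<phi> \<in> test_fun" for \<phi>
  proof -
    define q where "q = sob_sq (real m)"
    define Q where "Q = sob_sq (real m + 1) \<phi>"
    have qQ: "q \<phi> \<le> Q" "q (partial_t \<phi>) \<le> Q" "q (partial_x \<phi>) \<le> Q"
      using sob_sq_Suc_ge[OF \<phi>] by (auto simp: q_def Q_def)
    have S: "q (shear A \<psi>) \<le> C * Q" if "\<psi> \<in> test_fun" "q \<psi> \<le> Q" for \<psi>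
      using C(2)[OF that(1)] mult_left_mono[OF that(2) C(1)] by (simp add: q_def)
    note S' = S[OF \<phi> qQ(1)] S[OF test_fun_dir_deriv[OF \<phi>] qQ(2)] S[OF test_fun_dir_deriv[OF \<phi>] qQ(3)]
    have tx: "shear A (dir_deriv v \<phi>) \<in> test_fun" for v
      by (intro test_fun_shear[OF A] test_fun_dir_deriv \<phi>)
    have "q (partial_t (shear A \<phi>)) \<le> 2 * q (shear A (partial_t \<phi>)) + 2 * q (\<lambda>z. b z * shear A (partial_x \<phi>) z)"
      unfolding partial_shear(2)[OF A \<phi>] q_def b_def[THEN fun_cong, symmetric]
      by (rule sob_sq_add[OF tx test_fun_mult[OF b tx]])
    moreover have "q (\<lambda>z. b z * shear A (partial_x \<phi>) z) \<le> D * (C * Q)"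
      using D(2)[OF tx, of "(0, 1)"] mult_left_mono[OF S'(3) D(1)] by (simp add: q_def)
    moreover have "sob_sq (real m + 1) (shear A \<phi>) = q (shear A \<phi>)
        + q (partial_t (shear A \<phi>)) + q (shear A (partial_x \<phi>))"
      unfolding q_def by (subst sob_sq_Suc[OF test_fun_shear[OF A \<phi>]]) (simp add: partial_shear(1)[OF A \<phi>])
    ultimately have "sob_sq (real m + 1) (shear A \<phi>) \<le> (4 * C + 2 * (D * C)) * Q"
      using S' by (simp add: algebra_simps)
    then show ?thesis by (simp add: Q_def add.commute)
  qed
  then show ?case
    using C(1) D(1) by (intro exI[of _ "4 * C + 2 * (D * C)"]) simp
qed

section \<open>Interpolation\<close>

lemma has_sum_sum:
  fixes f :: "'i \<Rightarrow> 'a \<Rightarrow> real"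
  assumes "finite J" "\<And>j. j \<in> J \<Longrightarrow> (f j has_sum S j) A"
  shows "((\<lambda>k. \<Sum>j\<in>J. f j k) has_sum (\<Sum>j\<in>J. S j)) A"
  using assms by (induction J rule: finite_induct) (auto intro: has_sum_add)

text \<open>The real method of interpolation, with a dyadic sum in place of the usual integral over the
  parameter: up to constants independent of \<open>J\<close>, the weight below is \<open>x powr \<sigma>\<close>.\<close>

definition dyadic_weight :: "nat \<Rightarrow> real \<Rightarrow> nat \<Rightarrow> real \<Rightarrow> real" where
  "dyadic_weight m \<sigma> J x = (\<Sum>j<J. min (x ^ m) (2 ^ (j * m)) * 2 powr (real j * (\<sigma> - real m)))"

lemma dyadic_bracket:
  assumes "1 \<le> (x::real)" obtains j :: nat where "2 ^ j \<le> x" "x < 2 ^ Suc j"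
proof -
  obtain n where "x < 2 ^ n" using real_arch_pow[of 2 x] by auto
  define j where "j = (LEAST n. x < 2 ^ n)"
  have j: "x < 2 ^ j" unfolding j_def by (rule LeastI[of _ n]) fact
  then obtain i where i: "j = Suc i" using assms by (cases j) auto
  have "\<not> x < 2 ^ i" unfolding j_def using not_less_Least[of i "\<lambda>n. x < 2 ^ n"] i j_def by simp
  then show ?thesis using that[of i] j i by simp
qed

text \<open>Below the dyadic scale of \<open>x\<close> the terms are at most powers of
  \<open>q\<close>, above it at most \<open>x ^ m\<close> times powers of \<open>p\<close>. Since
  \<sigma> lies strictly between 0 and \<open>m\<close>, we have \<open>q > 1\<close> and
  \<open>p < 1\<close>. Both geometric sums are thus comparable to their terms at the scale of
  \<open>x\<close>, which have size \<open>x powr \<sigma>\<close>, uniformly in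
  \<open>J\<close>.\<close>

lemma dyadic_weight_le:
  assumes \<sigma>: "0 < \<sigma>" "\<sigma> < real m"
  obtains K where "0 \<le> K" "\<And>J x. 1 \<le> x \<Longrightarrow> dyadic_weight m \<sigma> J x \<le> K * x powr \<sigma>"
proof -
  define q p where "q = (2::real) powr \<sigma>" and "p = (2::real) powr (\<sigma> - real m)"
  have q: "1 < q" using \<sigma> by (simp add: q_def)
  have p: "0 < p" "p < 1" using \<sigma> by (auto simp: p_def intro!: powr_less_one)
  have qj: "q ^ j = (2 ^ j) powr \<sigma>" and pj: "p ^ j = (2 ^ j) powr (\<sigma> - real m)" for j
    by (simp_all add: q_def p_def powr_power powr_realpow[symmetric] powr_powr mult.commute)
  have pj': "2 powr (real j * (\<sigma> - real m)) = p ^ j" for j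
    by (simp add: p_def powr_power mult.commute)
  define K where "K = q / (q - 1) + 1 / (1 - p)"
  have "dyadic_weight m \<sigma> J x \<le> K * x powr \<sigma>" if x: "1 \<le> x" for J x
  proof -
    obtain i where i: "2 ^ i \<le> x" "x < 2 ^ Suc i" using dyadic_bracket[OF x] by blast
    have low: "min (x ^ m) (2 ^ (j * m)) * p ^ j \<le> q ^ j" for j
    proof -
      have "2 ^ (j * m) * p ^ j = q ^ j"
        unfolding qj pj by (simp add: power_mult powr_diff powr_realpow)
      moreover have "min (x ^ m) (2 ^ (j * m)) * p ^ j \<le> 2 ^ (j * m) * p ^ j"
        using p by (intro mult_right_mono) auto
      ultimately show ?thesis by simp
    qed
    have high: "min (x ^ m) (2 ^ (j * m)) * p ^ j \<le> x ^ m * p ^ j" for j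
      using p by (intro mult_right_mono) auto
    \<comment> \<open>The range of summation is enlarged by nonnegative terms so that it splits at
      the scale of \<open>x\<close> whatever the relation between \<open>i\<close> and
      \<open>J\<close>.\<close>
    have "dyadic_weight m \<sigma> J x \<le> (\<Sum>j\<in>{..<Suc i} \<union> {Suc i..<Suc i + J}. min (x ^ m) (2 ^ (j * m)) * p ^ j)"
      unfolding dyadic_weight_def pj' using x p by (intro sum_mono2) auto
    also have "\<dots> = (\<Sum>j<Suc i. min (x ^ m) (2 ^ (j * m)) * p ^ j)
        + (\<Sum>j\<in>{Suc i..<Suc i + J}. min (x ^ m) (2 ^ (j * m)) * p ^ j)"
      by (rule sum.union_disjoint) auto
    also have "\<dots> \<le> (\<Sum>j<Suc i. q ^ j) + (\<Sum>j\<in>{Suc i..<Suc i + J}. x ^ m * p ^ j)"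
      by (intro add_mono sum_mono low high)
    also have "(\<Sum>j<Suc i. q ^ j) \<le> q / (q - 1) * x powr \<sigma>"
    proof -
      have "(\<Sum>j<Suc i. q ^ j) = (q ^ Suc i - 1) / (q - 1)"
        using q by (subst geometric_sum) auto
      also have "\<dots> \<le> q * q ^ i / (q - 1)"
        using q by (intro divide_right_mono) auto
      also have "\<dots> \<le> q * x powr \<sigma> / (q - 1)"
        using q i x \<sigma> unfolding qj by (intro divide_right_mono mult_left_mono powr_mono2) auto
      finally show ?thesis by simp
    qed
    also have "(\<Sum>j\<in>{Suc i..<Suc i + J}. x ^ m * p ^ j) \<le> 1 / (1 - p) * x powr \<sigma>"
    proof -
      have "(\<Sum>j\<in>{Suc i..<Suc i + J}. x ^ m * p ^ j) = (\<Sum>j<J. x ^ m * p ^ (j + Suc i))"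
        by (rule sum.reindex_bij_witness[of _ "\<lambda>j. j + Suc i" "\<lambda>j. j - Suc i"]) auto
      also have "\<dots> = x ^ m * p ^ Suc i * (\<Sum>j<J. p ^ j)"
        by (simp add: sum_distrib_left power_add mult_ac)
      also have "(\<Sum>j<J. p ^ j) = (1 - p ^ J) / (1 - p)"
        using p by (subst sum_gp_strict) auto
      also have "x ^ m * p ^ Suc i * ((1 - p ^ J) / (1 - p)) \<le> x ^ m * x powr (\<sigma> - real m) * (1 / (1 - p))"
      proof (intro mult_mono)
        show "p ^ Suc i \<le> x powr (\<sigma> - real m)"
          unfolding pj using i x \<sigma> by (intro powr_mono2') auto
        show "(1 - p ^ J) / (1 - p) \<le> 1 / (1 - p)"
          using p by (intro divide_right_mono) auto
        show "0 \<le> (1 - p ^ J) / (1 - p)"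
          using p by (intro divide_nonneg_nonneg) (auto simp: power_le_one)
      qed (use x p in auto)
      also have "x ^ m * x powr (\<sigma> - real m) = x powr \<sigma>"
        using x by (simp add: powr_diff powr_realpow)
      finally show ?thesis by simp
    qed
    finally show ?thesis by (simp add: K_def algebra_simps)
  qed
  moreover have "0 \<le> K" using q p by (simp add: K_def)
  ultimately show ?thesis using that by blast
qed

text \<open>The single term at the scale \<open>i\<close> of \<open>x\<close> already suffices, and
  the upper bound on \<open>x\<close> ensures that this index occurs in the sum.\<close>

lemma dyadic_weight_ge:
  assumes \<sigma>: "0 < \<sigma>" "\<sigma> < real m" and x: "1 \<le> x" "x < 2 ^ J"
  shows "x powr \<sigma> \<le> 2 powr \<sigma> * dyadic_weight m \<sigma> J x"
proof -
  obtain i where i: "2 ^ i \<le> x" "x < 2 ^ Suc i" using dyadic_bracket[OF x(1)] by blast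
  have "(2::real) ^ i < 2 ^ J" using i x by linarith
  then have iJ: "i < J" by simp
  have "2 ^ (i * m) \<le> x ^ m"
    unfolding power_mult using i by (intro power_mono) auto
  then have "min (x ^ m) (2 ^ (i * m)) * 2 powr (real i * (\<sigma> - real m)) = 2 ^ (i * m) * 2 powr (real i * (\<sigma> - real m))"
    by simp
  also have "\<dots> = 2 powr (real (i * m) + real i * (\<sigma> - real m))"
    by (simp add: powr_add powr_realpow[symmetric])
  also have "\<dots> = 2 powr (real i * \<sigma>)"
    by (simp add: algebra_simps)
  finally have eq: "min (x ^ m) (2 ^ (i * m)) * 2 powr (real i * (\<sigma> - real m)) = 2 powr (real i * \<sigma>)" .
  have "x powr \<sigma> \<le> (2 ^ Suc i) powr \<sigma>"
    using i x \<sigma> by (intro powr_mono2) auto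
  also have "\<dots> = 2 powr \<sigma> * 2 powr (real i * \<sigma>)"
    by (simp add: powr_mult powr_realpow[symmetric] powr_powr)
  also have "2 powr (real i * \<sigma>) \<le> dyadic_weight m \<sigma> J x"
    unfolding dyadic_weight_def eq[symmetric]
    by (rule member_le_sum) (use iJ x in auto)
  finally show ?thesis by simp
qed

text \<open>Up to a constant factor, this is the infimum of
  \<open>sob_sq (real m) f + \<mu> * sob_sq 0 g\<close> over all decompositions of \<phi> into
  \<open>f + g\<close>: at each frequency the cheaper of the two norms is charged.\<close>

definition K_functional :: "nat \<Rightarrow> real \<Rightarrow> (real \<times> real \<Rightarrow> complex) \<Rightarrow> real" where
  "K_functional m \<mu> \<phi> = (\<Sum>\<^sub>\<infinity>k. min (weight k ^ m) \<mu> * (cmod (torus_coeff \<phi> k))\<^sup>2)"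

lemma summable_K_functional:
  assumes "\<phi> \<in> test_fun" "0 \<le> \<mu>"
  shows "(\<lambda>k. min (weight k ^ m) \<mu> * (cmod (torus_coeff \<phi> k))\<^sup>2) summable_on UNIV"
proof (rule summable_on_comparison_test[OF summable_sob_sq[OF assms(1), of "real m"]])
  show "min (weight k ^ m) \<mu> * (cmod (torus_coeff \<phi> k))\<^sup>2 \<le> weight k powr real m * (cmod (torus_coeff \<phi> k))\<^sup>2" for k
    by (intro mult_right_mono) (auto simp: powr_realpow)
qed (use assms in auto)

lemma K_functional_le:
  assumes \<phi>: "\<phi> \<in> test_fun" and \<mu>: "0 \<le> \<mu>"
  shows "K_functional m \<mu> \<phi> \<le> sob_sq (real m) \<phi>" "K_functional m \<mu> \<phi> \<le> \<mu> * sob_sq 0 \<phi>"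
proof -
  show "K_functional m \<mu> \<phi> \<le> sob_sq (real m) \<phi>"
    unfolding K_functional_def sob_sq_def
    by (intro infsum_mono summable_K_functional summable_sob_sq assms mult_right_mono)
       (auto simp: powr_realpow)
  have "K_functional m \<mu> \<phi> \<le> (\<Sum>\<^sub>\<infinity>k. \<mu> * (weight k powr 0 * (cmod (torus_coeff \<phi> k))\<^sup>2))"
    unfolding K_functional_def
    by (intro infsum_mono summable_K_functional summable_on_cmult_right summable_sob_sq assms)
       (auto intro: mult_right_mono)
  then show "K_functional m \<mu> \<phi> \<le> \<mu> * sob_sq 0 \<phi>"
    by (simp add: sob_sq_def infsum_cmult_right')
qed

lemma finite_weight_le: "finite {k. weight k \<le> x}"
proof (rule finite_subset)
  have abs: "\<bar>real_of_int n\<bar> \<le> (real_of_int n)\<^sup>2" for n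
  proof -
    have "\<bar>n\<bar> \<le> n\<^sup>2"
    proof (cases "n = 0")
      case False
      then have "1 \<le> \<bar>n\<bar>" by simp
      from mult_left_mono[OF this abs_ge_zero[of n]] show ?thesis by (simp add: power2_eq_square)
    qed simp
    then have "real_of_int \<bar>n\<bar> \<le> real_of_int (n\<^sup>2)" by (simp only: of_int_le_iff)
    then show ?thesis by simp
  qed
  show "{k. weight k \<le> x} \<subseteq> {-\<lceil>x\<rceil>..\<lceil>x\<rceil>} \<times> {-\<lceil>x\<rceil>..\<lceil>x\<rceil>}"
  proof
    fix k assume "k \<in> {k. weight k \<le> x}"
    then have "\<bar>real_of_int (fst k)\<bar> \<le> x" "\<bar>real_of_int (snd k)\<bar> \<le> x"
      using abs[of "fst k"] abs[of "snd k"] zero_le_power2[of "real_of_int (fst k)"]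
        zero_le_power2[of "real_of_int (snd k)"] unfolding weight_def mem_Collect_eq by linarith+
    then have "\<bar>fst k\<bar> \<le> \<lceil>x\<rceil>" "\<bar>snd k\<bar> \<le> \<lceil>x\<rceil>" by linarith+
    then show "k \<in> {-\<lceil>x\<rceil>..\<lceil>x\<rceil>} \<times> {-\<lceil>x\<rceil>..\<lceil>x\<rceil>}" by (cases k) auto
  qed
qed simp

text \<open>A sharp cutoff where \<open>weight k ^ m\<close> passes \<mu> puts each frequency into
  the part where it is cheaper. Only finitely many frequencies lie below the cutoff, so
  \<open>f\<close> is a trigonometric polynomial and both parts are test functions.\<close>

lemma K_functional_split:
  assumes \<phi>: "\<phi> \<in> test_fun" and \<mu>: "0 \<le> \<mu>" and m: "0 < m"
  obtains f g where "f \<in> test_fun" "g \<in> test_fun" "\<phi> = (\<lambda>z. f z + g z)"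
    "K_functional m \<mu> \<phi> = sob_sq (real m) f + \<mu> * sob_sq 0 g"
proof -
  define L where "L = {k. weight k ^ m \<le> \<mu>}"
  have "weight k \<le> weight k ^ m" for k
    using power_increasing[of 1 m "weight k"] m weight_ge_1 by simp
  then have "L \<subseteq> {k. weight k \<le> \<mu>}" unfolding L_def using order_trans by blast
  then have L: "finite L" using finite_weight_le finite_subset by blast
  define f where "f = (\<lambda>z. \<Sum>k\<in>L. torus_coeff \<phi> k * trig k z)"
  define g where "g = (\<lambda>z. \<phi> z + (-1) * f z)"
  have f: "f \<in> test_fun" unfolding f_def by (intro test_fun_sum test_fun_cmult test_fun_trig)
  have g: "g \<in> test_fun" unfolding g_def by (intro test_fun_add test_fun_cmult f \<phi>)
  have cf: "torus_coeff f k = (if k \<in> L then torus_coeff \<phi> k else 0)" for k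
    unfolding f_def by (rule torus_coeff_trig_sum[OF L])
  have cg: "torus_coeff g k = (if k \<in> L then 0 else torus_coeff \<phi> k)" for k
    unfolding g_def by (subst torus_coeff_add[OF \<phi> test_fun_cmult[OF f]]) (simp only: torus_coeff_cmult, simp add: cf)
  have "(\<Sum>\<^sub>\<infinity>k. weight k powr real m * (cmod (torus_coeff f k))\<^sup>2 + \<mu> * (weight k powr 0 * (cmod (torus_coeff g k))\<^sup>2))
      = sob_sq (real m) f + \<mu> * sob_sq 0 g"
    unfolding sob_sq_def
    by (subst infsum_add[OF summable_sob_sq[OF f] summable_on_cmult_right[OF summable_sob_sq[OF g]]])
       (simp only: infsum_cmult_right')
  moreover have "K_functional m \<mu> \<phi> =
      (\<Sum>\<^sub>\<infinity>k. weight k powr real m * (cmod (torus_coeff f k))\<^sup>2 + \<mu> * (weight k powr 0 * (cmod (torus_coeff g k))\<^sup>2))"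
    unfolding K_functional_def
    by (rule infsum_cong) (auto simp: cf cg L_def powr_realpow min_def)
  ultimately have "K_functional m \<mu> \<phi> = sob_sq (real m) f + \<mu> * sob_sq 0 g" by simp
  moreover have "\<phi> = (\<lambda>z. f z + g z)" by (simp add: g_def)
  ultimately show ?thesis using that f g by blast
qed

text \<open>Splitting at level \<mu> and applying an endpoint bound to each part controls the
  K-functional of \<open>T \<phi>\<close> by that of \<phi>, with a constant independent of \<mu>.
  Adding these estimates over the levels \<open>2 ^ (j * m)\<close>, with the factors
  \<open>p j\<close>, assembles the weight of order \<sigma> on both sides.\<close>

theorem sob_sq_interpolation:
  assumes T: "\<And>\<phi>. \<phi> \<in> test_fun \<Longrightarrow> T \<phi> \<in> test_fun"
    and add: "\<And>\<phi> \<psi>. \<phi> \<in> test_fun \<Longrightarrow> \<psi> \<in> test_fun \<Longrightarrow> T (\<lambda>z. \<phi> z + \<psi> z) = (\<lambda>z. T \<phi> z + T \<psi> z)"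
    and C: "0 \<le> C" "\<And>\<phi>. \<phi> \<in> test_fun \<Longrightarrow> sob_sq 0 (T \<phi>) \<le> C * sob_sq 0 \<phi>"
      "\<And>\<phi>. \<phi> \<in> test_fun \<Longrightarrow> sob_sq (real m) (T \<phi>) \<le> C * sob_sq (real m) \<phi>"
    and \<sigma>: "0 < \<sigma>" "\<sigma> < real m"
  shows "\<exists>C\<ge>0. \<forall>\<phi>\<in>test_fun. sob_sq \<sigma> (T \<phi>) \<le> C * sob_sq \<sigma> \<phi>"
proof -
  have m: "0 < m" using \<sigma> by (cases m) auto
  have KT: "K_functional m \<mu> (T \<phi>) \<le> 2 * C * K_functional m \<mu> \<phi>" if \<phi>: "\<phi> \<in> test_fun" and \<mu>: "0 \<le> \<mu>" for \<mu> \<phi>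
  proof -
    obtain f g where f: "f \<in> test_fun" and g: "g \<in> test_fun" and fg: "\<phi> = (\<lambda>z. f z + g z)"
      and K: "K_functional m \<mu> \<phi> = sob_sq (real m) f + \<mu> * sob_sq 0 g"
      using K_functional_split[OF \<phi> \<mu> m] by blast
    have "K_functional m \<mu> (T \<phi>) \<le> 2 * K_functional m \<mu> (T f) + 2 * K_functional m \<mu> (T g)"
      unfolding K_functional_def fg add[OF f g] torus_coeff_add[OF T[OF f] T[OF g]]
      by (rule infsum_add_le) (auto intro: summable_K_functional T f g \<mu> simp: \<mu>)
    moreover have "K_functional m \<mu> (T f) \<le> C * sob_sq (real m) f"
      using K_functional_le(1)[OF T[OF f] \<mu>] C(3)[OF f] by (rule order_trans)
    moreover have "K_functional m \<mu> (T g) \<le> C * (\<mu> * sob_sq 0 g)"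
      using K_functional_le(2)[OF T[OF g] \<mu>, of m] mult_left_mono[OF C(2)[OF g] \<mu>] by (simp add: mult_ac)
    ultimately show ?thesis unfolding K by (simp add: algebra_simps)
  qed
  obtain B where B: "0 \<le> B" "\<And>J x. 1 \<le> x \<Longrightarrow> dyadic_weight m \<sigma> J x \<le> B * x powr \<sigma>"
    using dyadic_weight_le[OF \<sigma>] by blast
  define D where "D = 2 powr \<sigma> * (2 * C * B)"
  have "sob_sq \<sigma> (T \<phi>) \<le> D * sob_sq \<sigma> \<phi>" if \<phi>: "\<phi> \<in> test_fun" for \<phi>
  proof -
    let ?c = "\<lambda>k. (cmod (torus_coeff \<phi> k))\<^sup>2" and ?d = "\<lambda>k. (cmod (torus_coeff (T \<phi>) k))\<^sup>2"
    show ?thesis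
      unfolding sob_sq_def[of \<sigma> "T \<phi>"]
    proof (rule infsum_le_finite_sums[OF summable_sob_sq[OF T[OF \<phi>]]])
      fix F :: "(int \<times> int) set" assume F: "finite F"
      define x where "x = Max (insert 1 (weight ` F))"
      have x: "weight k \<le> x" if "k \<in> F" for k
        unfolding x_def using F that by (intro Max_ge) auto
      \<comment> \<open>The number of levels depends on the finite set \<open>F\<close>, as the
        lower bound on the dyadic weight requires; the upper bound with \<open>B\<close> is uniform
        in it, so the final constant is too.\<close>
      obtain J where J: "x < 2 ^ J" using real_arch_pow[of 2 x] by auto
      define p where "p j = 2 powr (real j * (\<sigma> - real m))" for j
      have W: "dyadic_weight m \<sigma> J (weight k) * y = (\<Sum>j<J. p j * (min (weight k ^ m) (2 ^ (j * m)) * y))" for k y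
        unfolding dyadic_weight_def p_def sum_distrib_right by (simp only: mult_ac)
      have hs: "((\<lambda>k. dyadic_weight m \<sigma> J (weight k) * (cmod (torus_coeff \<psi> k))\<^sup>2) has_sum
          (\<Sum>j<J. p j * K_functional m (2 ^ (j * m)) \<psi>)) UNIV" if "\<psi> \<in> test_fun" for \<psi>
        unfolding W K_functional_def
        by (intro has_sum_sum has_sum_cmult_right has_sum_infsum summable_K_functional that) auto
      have "(\<Sum>k\<in>F. weight k powr \<sigma> * ?d k) \<le> (\<Sum>k\<in>F. 2 powr \<sigma> * (dyadic_weight m \<sigma> J (weight k) * ?d k))"
      proof (rule sum_mono)
        fix k assume "k \<in> F"
        then have "weight k < 2 ^ J" using x J by fastforce
        from mult_right_mono[OF dyadic_weight_ge[OF \<sigma> weight_ge_1 this], of "?d k"]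
        show "weight k powr \<sigma> * ?d k \<le> 2 powr \<sigma> * (dyadic_weight m \<sigma> J (weight k) * ?d k)"
          by (simp add: mult.assoc)
      qed
      also have "\<dots> = 2 powr \<sigma> * (\<Sum>k\<in>F. dyadic_weight m \<sigma> J (weight k) * ?d k)"
        by (rule sum_distrib_left[symmetric])
      also have "(\<Sum>k\<in>F. dyadic_weight m \<sigma> J (weight k) * ?d k) \<le> (\<Sum>j<J. p j * K_functional m (2 ^ (j * m)) (T \<phi>))"
        using F by (intro finite_sum_le_has_sum[OF hs[OF T[OF \<phi>]]])
          (auto simp: dyadic_weight_def intro!: mult_nonneg_nonneg sum_nonneg)
      also have "\<dots> \<le> (\<Sum>j<J. p j * (2 * C * K_functional m (2 ^ (j * m)) \<phi>))"
        by (intro sum_mono mult_left_mono KT \<phi>) (auto simp: p_def)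
      also have "\<dots> = 2 * C * (\<Sum>j<J. p j * K_functional m (2 ^ (j * m)) \<phi>)"
        by (simp add: sum_distrib_left mult_ac)
      also have "(\<Sum>j<J. p j * K_functional m (2 ^ (j * m)) \<phi>) \<le> B * sob_sq \<sigma> \<phi>"
      proof (rule has_sum_mono[OF hs[OF \<phi>]])
        show "((\<lambda>k. B * (weight k powr \<sigma> * ?c k)) has_sum B * sob_sq \<sigma> \<phi>) UNIV"
          unfolding sob_sq_def by (intro has_sum_cmult_right has_sum_infsum summable_sob_sq \<phi>)
        show "dyadic_weight m \<sigma> J (weight k) * ?c k \<le> B * (weight k powr \<sigma> * ?c k)" for k
          using mult_right_mono[OF B(2)[OF weight_ge_1[of k]], of "?c k" J] by (simp add: mult.assoc)
      qed
      finally have "(\<Sum>k\<in>F. weight k powr \<sigma> * ?d k) \<le> 2 powr \<sigma> * (2 * C * (B * sob_sq \<sigma> \<phi>))"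
        using C(1) by (simp add: mult_left_mono)
      then show "(\<Sum>k\<in>F. weight k powr \<sigma> * ?d k) \<le> D * sob_sq \<sigma> \<phi>"
        by (simp add: D_def mult_ac)
    qed
  qed
  moreover have "0 \<le> D" using C(1) B(1) by (simp add: D_def)
  ultimately show ?thesis by blast
qed

text \<open>For negative order, argue by duality: the transpose of a shear is the inverse shear.\<close>

theorem sob_sq_shear_le:
  assumes A: "A \<in> smooth_circle"
  obtains C where "0 \<le> C" "\<And>\<phi>. \<phi> \<in> test_fun \<Longrightarrow> sob_sq s (shear A \<phi>) \<le> C * sob_sq s \<phi>"
proof -
  have pos: "\<exists>C\<ge>0. \<forall>\<phi>\<in>test_fun. sob_sq s (shear A \<phi>) \<le> C * sob_sq s \<phi>"
    if A: "A \<in> smooth_circle" and s: "0 < s" for A s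
  proof -
    \<comment> \<open>Any integer above \<open>s\<close> can serve as the upper endpoint, 0 being
      the lower one.\<close>
    obtain m where m: "s < real m" using reals_Archimedean2 by blast
    obtain C0 where C0: "0 \<le> C0" "\<And>\<phi>. \<phi> \<in> test_fun \<Longrightarrow> sob_sq 0 (shear A \<phi>) \<le> C0 * sob_sq 0 \<phi>"
      using sob_sq_shear_le_nat[OF A, of 0] by auto
    obtain C1 where C1: "0 \<le> C1" "\<And>\<phi>. \<phi> \<in> test_fun \<Longrightarrow> sob_sq (real m) (shear A \<phi>) \<le> C1 * sob_sq (real m) \<phi>"
      using sob_sq_shear_le_nat[OF A, of m] by auto
    show ?thesis
    proof (rule sob_sq_interpolation[where T = "shear A" and C = "C0 + C1" and m = m])
      show "sob_sq 0 (shear A \<phi>) \<le> (C0 + C1) * sob_sq 0 \<phi>" if "\<phi> \<in> test_fun" for \<phi>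
        using C0(2)[OF that] mult_nonneg_nonneg[OF C1(1) sob_sq_nonneg[of 0 \<phi>]] by (simp add: distrib_right)
      show "sob_sq (real m) (shear A \<phi>) \<le> (C0 + C1) * sob_sq (real m) \<phi>" if "\<phi> \<in> test_fun" for \<phi>
        using C1(2)[OF that] mult_nonneg_nonneg[OF C0(1) sob_sq_nonneg[of "real m" \<phi>]] by (simp add: distrib_right)
      show "shear A (\<lambda>z. \<phi> z + \<psi> z) = (\<lambda>z. shear A \<phi> z + shear A \<psi> z)" for \<phi> \<psi>
        by (simp add: shear_def[abs_def])
      show "0 \<le> C0 + C1" using C0(1) C1(1) by simp
    qed (fact m s test_fun_shear[OF A])+
  qed
  consider "0 < s" | "s = 0" | "s < 0" by linarith
  then have "\<exists>C\<ge>0. \<forall>\<phi>\<in>test_fun. sob_sq s (shear A \<phi>) \<le> C * sob_sq s \<phi>"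
  proof cases
    case 1
    then show ?thesis by (rule pos[OF A])
  next
    case 2
    then show ?thesis using sob_sq_shear_le_nat[OF A, of 0] by simp
  next
    case 3
    let ?B = "shear (\<lambda>t. - A t)"
    note B = test_fun_shear[OF smooth_circle_uminus[OF A]]
    obtain C where C: "0 \<le> C" "\<And>\<psi>. \<psi> \<in> test_fun \<Longrightarrow> sob_sq (- s) (?B \<psi>) \<le> C * sob_sq (- s) \<psi>"
      using pos[OF smooth_circle_uminus[OF A], of "- s"] 3 by auto
    have "sob_sq s (shear A \<phi>) \<le> C * sob_sq s \<phi>" if \<phi>: "\<phi> \<in> test_fun" for \<phi>
    proof -
      \<comment> \<open>Pairing with the sheared function: bounding this functional at order
        \<open>- s\<close> bounds the norm of order \<open>s\<close> of
        \<open>shear A \<phi>\<close>.\<close>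
      define u where "u \<psi> = torus_mean (\<lambda>z. shear A \<phi> z * \<psi> z)" for \<psi>
      note h = test_fun_shear[OF A \<phi>]
      have lin: "linear_functional u"
        unfolding linear_functional_def
      proof (intro conjI ballI allI)
        fix \<psi> \<rho> assume "\<psi> \<in> test_fun" "\<rho> \<in> test_fun"
        then show "u (\<lambda>z. \<psi> z + \<rho> z) = u \<psi> + u \<rho>"
          unfolding u_def distrib_left by (intro torus_mean_add test_fun_continuous test_fun_mult h)
      next
        fix c \<psi> show "u (\<lambda>z. c * \<psi> z) = c * u \<psi>"
          using torus_mean_cmult[of c "\<lambda>z. shear A \<phi> z * \<psi> z"] by (simp add: u_def mult_ac)
      qed
      have bound: "(cmod (u \<psi>))\<^sup>2 \<le> (C * sob_sq s \<phi>) * sob_sq (- s) \<psi>" if \<psi>: "\<psi> \<in> test_fun" for \<psi>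
      proof -
        \<comment> \<open>Invariance of the mean moves the shear to the other factor as its inverse,
          where the estimate at the positive order \<open>- s\<close> applies.\<close>
        have "(\<lambda>z. shear A \<phi> z * \<psi> z) = shear A (\<lambda>z. \<phi> z * ?B \<psi> z)"
          by (auto simp: shear_def fun_eq_iff)
        then have "u \<psi> = torus_mean (\<lambda>z. \<phi> z * ?B \<psi> z)"
          unfolding u_def using torus_mean_shear_test_fun[OF A test_fun_mult[OF \<phi> B[OF \<psi>]]] by simp
        also have "\<dots> = (\<Sum>\<^sub>\<infinity>k. torus_coeff \<phi> k * torus_coeff (?B \<psi>) (- k))"
          using torus_mean_mult[OF \<phi> B[OF \<psi>]] by (simp add: infsumI)
        finally have u_eq: "u \<psi> = (\<Sum>\<^sub>\<infinity>k. torus_coeff \<phi> k * torus_coeff (?B \<psi>) (- k))" .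
        have bij: "bij_betw uminus (UNIV :: (int \<times> int) set) UNIV"
          by (rule bij_betwI[where g = uminus]) auto
        let ?q = "\<lambda>k. weight k powr (- s) * (cmod (torus_coeff (?B \<psi>) k))\<^sup>2"
        have "(\<lambda>k. ?q (- k)) summable_on UNIV"
          using summable_on_reindex_bij_betw[OF bij, of ?q] summable_sob_sq[OF B[OF \<psi>]] by simp
        moreover have "infsum (\<lambda>k. ?q (- k)) UNIV = sob_sq (- s) (?B \<psi>)"
          using infsum_reindex_bij_betw[OF bij, of ?q] by (simp add: sob_sq_def)
        ultimately have "(cmod (u \<psi>))\<^sup>2 \<le> sob_sq (- s) (?B \<psi>) * sob_sq s \<phi>"
          using Cauchy_Schwarz_weight(2)[OF \<phi>, of "- s" "\<lambda>k. torus_coeff (?B \<psi>) (- k)"] by (simp add: u_eq)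
        also have "\<dots> \<le> (C * sob_sq (- s) \<psi>) * sob_sq s \<phi>"
          by (intro mult_right_mono C \<psi> sob_sq_nonneg)
        finally show ?thesis by (simp add: mult_ac)
      qed
      have u_trig: "u (trig k) = torus_coeff (shear A \<phi>) (- k)" for k
        by (simp add: u_def torus_coeff_def)
      show ?thesis
        unfolding sob_sq_def[of s "shear A \<phi>"]
      proof (rule infsum_le_finite_sums[OF summable_sob_sq[OF h]])
        fix F :: "(int \<times> int) set" assume "finite F"
        \<comment> \<open>The reflection is needed because \<open>u (trig k)\<close> is the
          coefficient of the sheared function at \<open>- k\<close>.\<close>
        have "(\<Sum>k\<in>uminus ` F. weight k powr s * (cmod (u (trig k)))\<^sup>2) \<le> C * sob_sq s \<phi>"
          using \<open>finite F\<close> C(1) sob_sq_nonneg by (intro sum_weight_le[OF lin _ bound]) auto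
        then show "(\<Sum>k\<in>F. weight k powr s * (cmod (torus_coeff (shear A \<phi>) k))\<^sup>2) \<le> C * sob_sq s \<phi>"
          by (subst (asm) sum.reindex) (auto simp: u_trig inj_on_def)
      qed
    qed
    then show ?thesis using C(1) by blast
  qed
  then show ?thesis using that by blast
qed

lemma sob_bounded_shear:
  assumes A: "A \<in> smooth_circle" and u: "sob_bounded s u"
  shows "sob_bounded s (\<lambda>\<phi>. u (shear A \<phi>))"
proof -
  obtain C where C: "0 \<le> C" "\<And>\<phi>. \<phi> \<in> test_fun \<Longrightarrow> (cmod (u \<phi>))\<^sup>2 \<le> C * sob_sq s \<phi>"
    using sob_boundedE[OF u] by blast
  obtain D where D: "0 \<le> D" "\<And>\<phi>. \<phi> \<in> test_fun \<Longrightarrow> sob_sq s (shear A \<phi>) \<le> D * sob_sq s \<phi>"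
    using sob_sq_shear_le[OF A] by blast
  have "(cmod (u (shear A \<phi>)))\<^sup>2 \<le> (C * D) * sob_sq s \<phi>" if "\<phi> \<in> test_fun" for \<phi>
    using C(2)[OF test_fun_shear[OF A that]] mult_left_mono[OF D(2)[OF that] C(1)] by simp
  moreover have "shear A (\<lambda>z. \<phi> z + \<psi> z) = (\<lambda>z. shear A \<phi> z + shear A \<psi> z)"
    "shear A (\<lambda>z. c * \<phi> z) = (\<lambda>z. c * shear A \<phi> z)" for \<phi> \<psi> c
    by (auto simp: shear_def)
  ultimately show ?thesis
    using u test_fun_shear[OF A] unfolding sob_bounded_def linear_functional_def by (auto intro!: exI)
qed

section \<open>Periodic primitive of the coefficient and Diophantine bounds for the divisors\<close>

lemma circle_antiderivative:
  assumes a: "a \<in> smooth_circle"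
  obtains A where "A \<in> smooth_circle" "\<And>t. dir_deriv 1 A t = a t - circle_mean a"
proof -
  define b where "b t = a t + (- circle_mean a)" for t
  have b: "smooth_fun b"
    unfolding b_def[abs_def] by (intro smooth_fun_add smooth_fun_const smooth_circleD[OF a])
  have per: "b (t + 2 * pi) = b t" for t by (simp add: b_def smooth_circleD[OF a])
  obtain A where A: "\<And>t. (A has_vector_derivative b t) (at t)"
    using continuous_antiderivative[OF smooth_fun_continuous[OF b]] by blast
  have D: "dir_deriv v A = (\<lambda>t. v * b t)" for v
    using dir_deriv_eqI[of A "\<lambda>t v. v * b t" v] A by (simp add: has_vector_derivative_def)
  have "A differentiable_on UNIV"
    using A unfolding differentiable_on_def differentiable_def has_vector_derivative_def by blast
  then have "smooth_fun A"
    by (subst smooth_fun_iff) (auto simp: D intro: smooth_fun_mult smooth_fun_const b)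
  moreover have "A (t + 2 * pi) = A t" for t
  proof -
    \<comment> \<open>Removing the mean makes the integral over a period vanish, which is exactly
      what makes the primitive periodic.\<close>
    have "integral {0..2 * pi} b = 0"
      unfolding b_def using smooth_fun_continuous[OF smooth_circleD(1)[OF a]]
      by (subst integral_add) (auto intro: integrable_continuous_real simp: circle_mean_def)
    then have "integral {t..t + 2 * pi} b = 0"
      using integral_periodic_shift[OF smooth_fun_continuous[OF b] per, of t 0] by simp
    moreover have "(b has_integral A (t + 2 * pi) - A t) {t..t + 2 * pi}"
      by (rule fundamental_theorem_of_calculus) (auto intro: has_vector_derivative_at_within A)
    ultimately show ?thesis by (simp add: integral_unique)
  qed
  ultimately have "A \<in> smooth_circle" by (simp add: smooth_circle_def)
  then show ?thesis using that D[of 1] by (simp add: b_def)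
qed

text \<open>For every \<open>q\<close>, rounding \<alpha> times \<open>q\<close> gives a fraction at
  distance less than \<open>1 / q\<close>. The purpose is to guarantee \<open>1 < r\<close>, hence a
  negative exponent \<open>1 - r\<close>, for every \<open>r\<close> above the measure.\<close>

lemma irrationality_measure_ge_1: "1 \<le> irrationality_measure \<alpha>"
proof -
  let ?E = "{(p :: int, q :: nat). q > 0 \<and> \<bar>\<alpha> - of_int p / of_nat q\<bar> < of_nat q powr (- 1)}"
  have "(\<lambda>q. (round (\<alpha> * of_nat q), q)) ` {0<..} \<subseteq> ?E"
  proof
    fix z assume "z \<in> (\<lambda>q. (round (\<alpha> * of_nat q), q)) ` {0 :: nat<..}"
    then obtain q where z: "z = (round (\<alpha> * of_nat q), q)" and q: "0 < q" by auto
    have "\<bar>of_int (round (\<alpha> * of_nat q)) - \<alpha> * of_nat q\<bar> < 1"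
      using of_int_round_abs_le[of "\<alpha> * of_nat q"] by linarith
    moreover have "\<alpha> - of_int (round (\<alpha> * of_nat q)) / of_nat q
        = - (of_int (round (\<alpha> * of_nat q)) - \<alpha> * of_nat q) / of_nat q"
      using q by (simp add: field_simps)
    ultimately have "\<bar>\<alpha> - of_int (round (\<alpha> * of_nat q)) / of_nat q\<bar> < 1 / of_nat q"
      using q by (simp add: abs_divide divide_strict_right_mono)
    then show "z \<in> ?E"
      using q by (simp add: z powr_minus_divide)
  qed
  moreover have "infinite ((\<lambda>q. (round (\<alpha> * of_nat q), q)) ` {0::nat<..})"
    by (subst finite_image_iff) (auto simp: inj_on_def infinite_Ioi)
  ultimately have "infinite ?E" using finite_subset by blast
  then have "ereal 1 \<le> irrationality_measure \<alpha>"
    unfolding irrationality_measure_def by (intro Sup_upper) (auto intro!: exI[of _ 1])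
  then show ?thesis by (simp add: one_ereal_def)
qed

text \<open>Outside a finite set of pairs, |\<alpha> - p / q| is at least
  \<open>q powr (- r)\<close>; multiplying by \<open>q\<close> gives the power \<open>1 - r\<close>.
  Since the square of \<open>q\<close> is at most \<open>weight k\<close> and the exponent is
  negative, \<open>q\<close> may be replaced by the root of the weight.\<close>

lemma small_divisor_bound:
  assumes irr: "\<alpha> \<notin> \<rat>" and r: "irrationality_measure \<alpha> < ereal r"
  obtains c where "0 < c" "\<And>k. k \<noteq> 0 \<Longrightarrow> c * weight k powr ((1 - r) / 2) \<le> \<bar>of_int (fst k) - \<alpha> * of_int (snd k)\<bar>"
proof -
  have "1 < ereal r" using le_less_trans[OF irrationality_measure_ge_1 r] .
  then have r1: "1 < r" by (simp add: one_ereal_def)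
  define E where "E = {(p :: int, q :: nat). q > 0 \<and> \<bar>\<alpha> - of_int p / of_nat q\<bar> < of_nat q powr (- r)}"
  have E: "finite E"
  proof (rule ccontr)
    assume "infinite E"
    then have "ereal r \<le> irrationality_measure \<alpha>"
      unfolding irrationality_measure_def E_def using r1 by (intro Sup_upper) auto
    then show False using r by simp
  qed
  \<comment> \<open>The exceptional pairs are absorbed into the constant, which stays positive
    because \<alpha> is irrational; the entry 1 serves all other pairs.\<close>
  define d where "d = Min (insert 1 ((\<lambda>(p, q). \<bar>of_int p - \<alpha> * of_nat q\<bar>) ` E))"
  have "of_int p - \<alpha> * of_nat q \<noteq> 0" if "0 < q" for p :: int and q :: nat
  proof
    assume "of_int p - \<alpha> * of_nat q = 0"
    then have "\<alpha> = of_int p / of_nat q" using that by (simp add: field_simps)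
    then show False using irr by auto
  qed
  then have d0: "0 < d" unfolding d_def using E by (subst Min_gr_iff) (auto simp: E_def)
  have d1: "d \<le> 1" unfolding d_def using E by (intro Min_le) auto
  have main: "d * weight k powr ((1 - r) / 2) \<le> \<bar>of_int p - \<alpha> * of_nat q\<bar>"
    if q: "0 < q" and k: "(real q)\<^sup>2 \<le> weight k" for p :: int and q :: nat and k
  proof -
    have "weight k powr ((1 - r) / 2) \<le> (real q)\<^sup>2 powr ((1 - r) / 2)"
      using q k r1 by (intro powr_mono2') auto
    also have "(real q)\<^sup>2 = real q powr 2" using q by (simp add: powr_numeral)
    also have "(real q powr 2) powr ((1 - r) / 2) = real q powr (1 - r)"
    proof -
      have "2 * ((1 - r) / 2) = 1 - r" by (simp add: field_simps)
      then show ?thesis by (simp only: powr_powr)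
    qed
    finally have w: "weight k powr ((1 - r) / 2) \<le> real q powr (1 - r)" .
    show ?thesis
    proof (cases "(p, q) \<in> E")
      case True
      then have "d \<le> \<bar>of_int p - \<alpha> * of_nat q\<bar>"
        unfolding d_def using E by (intro Min_le) force+
      moreover have "d * weight k powr ((1 - r) / 2) \<le> d * 1"
        using d0 r1 weight_ge_1[of k] powr_mono[of "(1 - r) / 2" 0 "weight k"] by (intro mult_left_mono) auto
      ultimately show ?thesis by simp
    next
      case False
      then have "real q powr (- r) \<le> \<bar>\<alpha> - of_int p / of_nat q\<bar>"
        using q by (auto simp: E_def)
      then have "real q * real q powr (- r) \<le> real q * \<bar>\<alpha> - of_int p / of_nat q\<bar>"
        by (rule mult_left_mono) simp
      also have "\<dots> = \<bar>real q * (\<alpha> - of_int p / of_nat q)\<bar>" by (simp add: abs_mult)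
      also have "real q * (\<alpha> - of_int p / of_nat q) = - (of_int p - \<alpha> * of_nat q)"
        using q by (simp add: field_simps)
      finally have "real q * real q powr (- r) \<le> \<bar>of_int p - \<alpha> * of_nat q\<bar>" by simp
      moreover have "real q powr (1 - r) = real q * real q powr (- r)"
        using q powr_add[of "real q" 1 "- r"] by simp
      moreover have "d * weight k powr ((1 - r) / 2) \<le> 1 * real q powr (1 - r)"
        using d0 d1 w by (intro mult_mono) auto
      ultimately show ?thesis by linarith
    qed
  qed
  have "d * weight k powr ((1 - r) / 2) \<le> \<bar>of_int (fst k) - \<alpha> * of_int (snd k)\<bar>" if k: "k \<noteq> 0" for k
  proof -
    consider "0 < snd k" | "snd k < 0" | "snd k = 0" by linarith
    then show ?thesis
    proof cases
      case 1
      then show ?thesis using main[of "nat (snd k)" k "fst k"] by (simp add: weight_def)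
    next
      case 2
      then show ?thesis using main[of "nat (- snd k)" k "- fst k"] by (simp add: weight_def abs_minus_commute)
    next
      case 3
      \<comment> \<open>Without an \<open>x\<close>-frequency the divisor is a nonzero integer, and
        no approximation is involved.\<close>
      then have "1 \<le> \<bar>fst k\<bar>" using k by (cases k) (auto simp: zero_prod_def)
      then have "1 \<le> \<bar>real_of_int (fst k)\<bar>" by linarith
      moreover have "d * weight k powr ((1 - r) / 2) \<le> 1 * 1"
        using d0 d1 r1 weight_ge_1[of k] powr_mono[of "(1 - r) / 2" 0 "weight k"] by (intro mult_mono) auto
      ultimately show ?thesis using 3 by simp
    qed
  qed
  then show ?thesis using that d0 by blast
qed

section \<open>The transport equation\<close>

definition transport_const :: "real \<Rightarrow> (real \<times> real \<Rightarrow> complex) \<Rightarrow> real \<times> real \<Rightarrow> complex" where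
  "transport_const \<alpha> \<phi> z = partial_t \<phi> z + (- of_real \<alpha>) * partial_x \<phi> z"

definition transport_symbol :: "real \<Rightarrow> int \<times> int \<Rightarrow> complex" where
  "transport_symbol \<alpha> k = \<i> * of_real (of_int (fst k) - \<alpha> * of_int (snd k))"

lemma transport_symbol_nonzero:
  assumes "\<alpha> \<notin> \<rat>" "k \<noteq> 0" shows "transport_symbol \<alpha> k \<noteq> 0"
proof
  assume "transport_symbol \<alpha> k = 0"
  then have "complex_of_real (of_int (fst k) - \<alpha> * of_int (snd k)) = 0"
    by (simp add: transport_symbol_def del: of_real_diff)
  then have eq: "of_int (fst k) = \<alpha> * of_int (snd k)" by (simp only: of_real_eq_0_iff right_minus_eq)
  have "snd k \<noteq> 0" using eq assms(2) by (auto simp: prod_eq_iff)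
  then have "\<alpha> = of_int (fst k) / of_int (snd k)" using eq by simp
  then show False using assms(1) by auto
qed

lemma test_fun_transport_const: "\<phi> \<in> test_fun \<Longrightarrow> transport_const \<alpha> \<phi> \<in> test_fun"
  unfolding transport_const_def[abs_def] by (intro test_fun_add test_fun_cmult test_fun_dir_deriv)

lemma torus_coeff_transport_const:
  assumes "\<phi> \<in> test_fun"
  shows "torus_coeff (transport_const \<alpha> \<phi>) k = transport_symbol \<alpha> k * torus_coeff \<phi> k"
  unfolding transport_const_def[abs_def]
  by (subst torus_coeff_add[OF test_fun_dir_deriv[OF assms] test_fun_cmult[OF test_fun_dir_deriv[OF assms]]])
     (simp only: torus_coeff_cmult torus_coeff_partial[OF assms], simp add: transport_symbol_def algebra_simps)

lemma transport_const_trig: "transport_const \<alpha> (trig k) = (\<lambda>z. transport_symbol \<alpha> k * trig k z)"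
  by (simp add: transport_const_def[abs_def] dir_deriv_trig transport_symbol_def algebra_simps)

text \<open>The conjugation in transposed form, on test functions. As \<open>a\<close> does not
  depend on \<open>x\<close>, the \<open>x\<close>-derivative commutes with multiplication by
  \<open>a\<close>, and the derivative of \<open>A\<close> then turns \<open>a\<close> into
  \<alpha>.\<close>

lemma transport_op_shear:
  assumes a: "a \<in> smooth_circle" and A: "A \<in> smooth_circle" "\<And>t. dir_deriv 1 A t = a t - \<alpha>"
    and u: "linear_functional u" and \<phi>: "\<phi> \<in> test_fun"
  shows "transport_op a u (shear A \<phi>) = - u (shear A (transport_const \<alpha> \<phi>))"
proof -
  let ?g = "\<lambda>z :: real \<times> real. complex_of_real (a (fst z))" and ?\<psi> = "shear A \<phi>"
  note g = test_fun_circle[OF a] and \<psi> = test_fun_shear[OF A(1) \<phi>]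
  note g\<psi> = test_fun_mult[OF g test_fun_dir_deriv[OF \<psi>]]
  have "((\<lambda>z. complex_of_real (a (fst z))) has_derivative (\<lambda>v. of_real (dir_deriv (fst v) a (fst z)))) (at z)"
    for z :: "real \<times> real"
    using has_derivative_compose[OF bounded_linear_imp_has_derivative[OF bounded_linear_fst]
        smooth_fun_has_derivative[OF smooth_circleD(1)[OF a]], of z UNIV]
    by (intro bounded_linear.has_derivative[OF bounded_linear_of_real]) simp
  moreover have "dir_deriv 0 a t = 0" for t
    using linear_0[OF has_derivative_linear[OF smooth_fun_has_derivative[OF smooth_circleD(1)[OF a]]]] .
  ultimately have "partial_x ?g = (\<lambda>z. 0)"
    using dir_deriv_eqI[of ?g "\<lambda>z v. of_real (dir_deriv (fst v) a (fst z))" "(0, 1)"] by simp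
  then have px: "partial_x (\<lambda>z. ?g z * ?\<psi> z) = (\<lambda>z. ?g z * partial_x ?\<psi> z)"
    by (simp add: dir_deriv_mult[OF test_funD(1)[OF g] test_funD(1)[OF \<psi>]])
  have "dist_mult (\<lambda>(t, x). of_real (a t)) (dist_deriv_x u) ?\<psi> = - u (\<lambda>z. ?g z * partial_x ?\<psi> z)"
    using \<psi> test_fun_mult[OF g \<psi>] by (simp add: dist_mult_def dist_deriv_x_def case_prod_beta px)
  then have "transport_op a u ?\<psi> = - (u (partial_t ?\<psi>) + (-1) * u (\<lambda>z. ?g z * partial_x ?\<psi> z))"
    using \<psi> by (simp add: transport_op_def dist_minus_def dist_deriv_t_def)
  also have "\<dots> = - u (\<lambda>z. partial_t ?\<psi> z + (-1) * (?g z * partial_x ?\<psi> z))"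
    by (simp only: linear_functionalD(1)[OF u test_fun_dir_deriv[OF \<psi>] test_fun_cmult[OF g\<psi>]]
        linear_functionalD(2)[OF u g\<psi>])
  also have "(\<lambda>z. partial_t ?\<psi> z + (-1) * (?g z * partial_x ?\<psi> z)) = shear A (transport_const \<alpha> \<phi>)"
    unfolding partial_shear[OF A(1) \<phi>] A(2)
    by (simp add: fun_eq_iff shear_def transport_const_def algebra_simps)
  finally show ?thesis .
qed

lemma shear_surj_test_fun:
  assumes "A \<in> smooth_circle" "\<phi> \<in> test_fun"
  obtains \<psi> where "\<psi> \<in> test_fun" "\<phi> = shear A \<psi>"
  using that[of "shear (\<lambda>t. - A t) \<phi>"] test_fun_shear[OF smooth_circle_uminus] assms
  by (simp add: shear_uminus_shear)

text \<open>Every test function is a shear of another one, so testing against sheared functions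
  loses nothing; outside the test functions both sides are undefined by extensionality.\<close>

lemma transport_op_eq_iff:
  assumes a: "a \<in> smooth_circle" and A: "A \<in> smooth_circle" "\<And>t. dir_deriv 1 A t = a t - \<alpha>"
    and u: "linear_functional u" and f: "f \<in> extensional test_fun"
  shows "transport_op a u = f \<longleftrightarrow>
    (\<forall>\<phi>\<in>test_fun. u (shear A (transport_const \<alpha> \<phi>)) = - f (shear A \<phi>))"
proof
  assume "transport_op a u = f"
  then show "\<forall>\<phi>\<in>test_fun. u (shear A (transport_const \<alpha> \<phi>)) = - f (shear A \<phi>)"
    using transport_op_shear[OF a A u] by auto
next
  assume R: "\<forall>\<phi>\<in>test_fun. u (shear A (transport_const \<alpha> \<phi>)) = - f (shear A \<phi>)"
  show "transport_op a u = f"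
  proof (rule extensionalityI[where A = test_fun])
    show "transport_op a u \<in> extensional test_fun"
      by (simp add: transport_op_def dist_minus_def)
    fix \<phi> assume "\<phi> \<in> test_fun"
    then obtain \<psi> where "\<psi> \<in> test_fun" "\<phi> = shear A \<psi>"
      using shear_surj_test_fun[OF A(1)] by blast
    then show "transport_op a u \<phi> = f \<phi>"
      using transport_op_shear[OF a A u] R by simp
  qed (rule f)
qed

text \<open>Dividing by the symbol multiplies squared coefficients by at most a constant times
  \<open>weight k powr (r - 1)\<close>, a loss of \<open>r - 1\<close> derivatives.\<close>

lemma summable_small_divisors:
  assumes irr: "\<alpha> \<notin> \<rat>" and r: "irrationality_measure \<alpha> < ereal r"
    and g: "(\<lambda>k. weight k powr s * (cmod (g k))\<^sup>2) summable_on UNIV"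
    and c: "\<And>k. transport_symbol \<alpha> k * c k = - g k"
  shows "(\<lambda>k. weight k powr (s + 1 - r) * (cmod (c k))\<^sup>2) summable_on UNIV"
proof -
  obtain d where d: "0 < d"
    "\<And>k. k \<noteq> 0 \<Longrightarrow> d * weight k powr ((1 - r) / 2) \<le> \<bar>of_int (fst k) - \<alpha> * of_int (snd k)\<bar>"
    using small_divisor_bound[OF irr r] by blast
  let ?h = "\<lambda>k. weight k powr (s + 1 - r) * (cmod (c k))\<^sup>2"
  let ?q = "\<lambda>k. weight k powr s * (cmod (g k))\<^sup>2"
  have le: "?h k \<le> 1 / d\<^sup>2 * ?q k" if "k \<noteq> 0" for k
  proof -
    have "d * weight k powr ((1 - r) / 2) * cmod (c k)
        \<le> \<bar>of_int (fst k) - \<alpha> * of_int (snd k)\<bar> * cmod (c k)"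
      by (rule mult_right_mono[OF d(2)[OF that]]) simp
    also have "\<dots> = cmod (transport_symbol \<alpha> k * c k)"
      unfolding transport_symbol_def norm_mult norm_of_real by simp
    also have "\<dots> = cmod (g k)" by (simp add: c)
    finally have "(d * weight k powr ((1 - r) / 2) * cmod (c k))\<^sup>2 \<le> (cmod (g k))\<^sup>2"
      using d(1) by (intro power_mono) auto
    moreover have "(weight k powr ((1 - r) / 2))\<^sup>2 = weight k powr (1 - r)"
      by (simp add: power2_eq_square flip: powr_add)
    ultimately have "d\<^sup>2 * weight k powr (1 - r) * (cmod (c k))\<^sup>2 \<le> (cmod (g k))\<^sup>2"
      by (simp add: power_mult_distrib)
    then have "weight k powr s * (d\<^sup>2 * weight k powr (1 - r) * (cmod (c k))\<^sup>2) \<le> ?q k"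
      by (rule mult_left_mono) simp
    moreover have "weight k powr (s + 1 - r) = weight k powr s * weight k powr (1 - r)"
      by (simp add: add_diff_eq flip: powr_add)
    ultimately have "d\<^sup>2 * ?h k \<le> ?q k" by (simp add: mult_ac)
    then show ?thesis using d(1) by (simp add: field_simps)
  qed
  \<comment> \<open>The symbol vanishes at 0, so the equation says nothing about \<open>c 0\<close>;
    its single term is added to the majorant.\<close>
  have "(\<lambda>k. 1 / d\<^sup>2 * ?q k + (if k = 0 then ?h 0 else 0)) summable_on UNIV"
    by (intro summable_on_add summable_on_cmult_right g finite_nonzero_values_imp_summable_on)
       (auto intro: finite_subset[of _ "{0}"])
  then show ?thesis
  proof (rule summable_on_comparison_test)
    show "?h k \<le> 1 / d\<^sup>2 * ?q k + (if k = 0 then ?h 0 else 0)" for k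
      using le[of k] by (cases "k = 0") auto
  qed simp
qed

lemma sob_bounded_cong:
  assumes "sob_bounded s u" "\<And>\<phi>. \<phi> \<in> test_fun \<Longrightarrow> v \<phi> = u \<phi>" shows "sob_bounded s v"
  using assms unfolding sob_bounded_def linear_functional_def
  by (simp add: test_fun_add test_fun_cmult)

text \<open>Realizes a prescribed sequence \<open>c\<close> as the values on exponentials of a
  functional of the matching order; this is how solutions are constructed.\<close>

lemma sob_bounded_series:
  assumes c: "(\<lambda>k. weight k powr s * (cmod (c k))\<^sup>2) summable_on UNIV"
  shows "sob_bounded (- s) (\<lambda>\<phi>. \<Sum>\<^sub>\<infinity>k. torus_coeff \<phi> k * c k)"
  unfolding sob_bounded_def linear_functional_def
proof (intro conjI ballI allI exI)
  fix \<phi> assume \<phi>: "\<phi> \<in> test_fun"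
  note S = Cauchy_Schwarz_weight(1)[OF _ c]
  show "(cmod (\<Sum>\<^sub>\<infinity>k. torus_coeff \<phi> k * c k))\<^sup>2
      \<le> (\<Sum>\<^sub>\<infinity>k. weight k powr s * (cmod (c k))\<^sup>2) * sob_sq (- s) \<phi>"
    by (rule Cauchy_Schwarz_weight(2)[OF \<phi> c])
  show "(\<Sum>\<^sub>\<infinity>k. torus_coeff (\<lambda>z. a * \<phi> z) k * c k) = a * (\<Sum>\<^sub>\<infinity>k. torus_coeff \<phi> k * c k)" for a
    unfolding torus_coeff_cmult mult.assoc by (rule infsum_cmult_right')
  fix \<psi> assume \<psi>: "\<psi> \<in> test_fun"
  show "(\<Sum>\<^sub>\<infinity>k. torus_coeff (\<lambda>z. \<phi> z + \<psi> z) k * c k)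
      = (\<Sum>\<^sub>\<infinity>k. torus_coeff \<phi> k * c k) + (\<Sum>\<^sub>\<infinity>k. torus_coeff \<psi> k * c k)"
    unfolding torus_coeff_add[OF \<phi> \<psi>] distrib_right by (rule infsum_add[OF S[OF \<phi>] S[OF \<psi>]])
qed

lemma fourier_coeff_0_iff: "fourier_coeff u (0, 0) = 0 \<longleftrightarrow> u (trig 0) = 0"
  by (simp add: fourier_coeff_eq zero_prod_def)

theorem corollary6p8:
  fixes a :: "real \<Rightarrow> real" and s :: real and f :: functional
  assumes "a \<in> smooth_circle"
    and "f \<in> sobolev s"
    and "circle_mean a \<notin> \<rat>"
    and "irrationality_measure (circle_mean a) < \<infinity>"
  shows "(\<forall>u\<in>distributions. transport_op a u = f \<longrightarrow>
            (\<forall>r::real. ereal r > irrationality_measure (circle_mean a) \<longrightarrow> u \<in> sobolev (s + 1 - r)))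
       \<and> (fourier_coeff f (0, 0) = 0 \<longrightarrow>
            (\<exists>!u. u \<in> distributions \<and> transport_op a u = f \<and> fourier_coeff u (0, 0) = 0) \<and>
            (\<forall>u. u \<in> distributions \<and> transport_op a u = f \<and> fourier_coeff u (0, 0) = 0 \<longrightarrow>
              (\<forall>r::real. ereal r > irrationality_measure (circle_mean a) \<longrightarrow>
                 u \<in> sobolev (s + 1 - r))))"
proof -
  let ?\<alpha> = "circle_mean a"
  obtain A where A: "A \<in> smooth_circle" "\<And>t. dir_deriv 1 A t = a t - ?\<alpha>"
    using circle_antiderivative[OF assms(1)] by blast
  note A' = smooth_circle_uminus[OF A(1)]
  have f: "f \<in> extensional test_fun" and fb: "sob_bounded (- s) f"
    using assms(2) by (auto simp: sobolev_iff)
  define g where "g \<phi> = f (shear A \<phi>)" for \<phi>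
  have gb: "sob_bounded (- s) g"
    unfolding g_def[abs_def] by (rule sob_bounded_shear[OF A(1) fb])
  have g: "(\<lambda>k. weight k powr s * (cmod (g (trig k)))\<^sup>2) summable_on UNIV"
    using sob_bounded_iff[OF gb, of s] gb by simp
  \<comment> \<open>Constants are fixed by every shear, so the normalization at frequency (0, 0) and
    the condition on \<open>f\<close> have the same form before and after the shear.\<close>
  have shear_trig_0: "shear B (trig 0) = trig 0" for B
    by (simp add: shear_def[abs_def] trig_def[abs_def])

  \<comment> \<open>Testing the conjugated equation on an exponential diagonalizes it.\<close>
  have solution: "transport_symbol ?\<alpha> k * u (shear A (trig k)) = - g (trig k)"
    if "u \<in> distributions" "transport_op a u = f" for u k
  proof -
    obtain \<sigma> where ub: "sob_bounded \<sigma> u" using \<open>u \<in> distributions\<close> by (auto simp: distributions_iff)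
    then have lin: "linear_functional u" by (simp add: sob_bounded_def)
    have "u (shear A (transport_const ?\<alpha> (trig k))) = - g (trig k)"
      using transport_op_eq_iff[OF assms(1) A lin f] that(2) test_fun_trig by (simp add: g_def)
    moreover have "shear A (transport_const ?\<alpha> (trig k)) = (\<lambda>z. transport_symbol ?\<alpha> k * shear A (trig k) z)"
      unfolding transport_const_trig by (simp add: shear_def[abs_def])
    ultimately show ?thesis
      by (simp only: linear_functionalD(2)[OF lin test_fun_shear[OF A(1) test_fun_trig]])
  qed

  have regular: "u \<in> sobolev (s + 1 - r)"
    if u: "u \<in> distributions" "transport_op a u = f" and r: "irrationality_measure ?\<alpha> < ereal r" for u r
  proof -
    obtain \<sigma> where ub: "sob_bounded \<sigma> u" using u(1) by (auto simp: distributions_iff)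
    have "(\<lambda>k. weight k powr (s + 1 - r) * (cmod (u (shear A (trig k))))\<^sup>2) summable_on UNIV"
      by (rule summable_small_divisors[OF assms(3) r g solution[OF u]])
    then have "sob_bounded (- (s + 1 - r)) (\<lambda>\<phi>. u (shear A \<phi>))"
      using sob_bounded_iff[OF sob_bounded_shear[OF A(1) ub]] by blast
    \<comment> \<open>The order is found for the sheared functional; the inverse shear transfers it
      to \<open>u\<close>.\<close>
    from sob_bounded_shear[OF A' this] have "sob_bounded (- (s + 1 - r)) u"
      by (simp add: shear_uminus_shear)
    then show ?thesis using u(1) by (simp add: sobolev_iff distributions_iff)
  qed

  have unique: "u = v"
    if u: "u \<in> distributions" "transport_op a u = f" "u (trig 0) = 0"
      and v: "v \<in> distributions" "transport_op a v = f" "v (trig 0) = 0" for u v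
  proof (rule extensionalityI[where A = test_fun])
    show "u \<in> extensional test_fun" "v \<in> extensional test_fun"
      using u(1) v(1) by (simp_all add: distributions_iff)
    fix \<phi> assume "\<phi> \<in> test_fun"
    then obtain \<psi> where \<psi>: "\<psi> \<in> test_fun" "\<phi> = shear A \<psi>"
      using shear_surj_test_fun[OF A(1)] by blast
    obtain \<sigma> \<rho> where ub: "sob_bounded \<sigma> u" and vb: "sob_bounded \<rho> v"
      using u(1) v(1) by (auto simp: distributions_iff)
    have "u (shear A (trig k)) = v (shear A (trig k))" for k
    proof (cases "k = 0")
      case True
      then show ?thesis using u(3) v(3) by (simp add: shear_trig_0)
    next
      case False
      \<comment> \<open>Away from 0 the nonzero symbol determines the coefficient, and at 0 the
        normalization does. Equal values on exponentials then give equal functionals.\<close>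
      from transport_symbol_nonzero[OF assms(3) this]
      show ?thesis
        using solution[OF u(1,2), of k] solution[OF v(1,2), of k] by (metis mult_left_cancel)
    qed
    then show "u \<phi> = v \<phi>"
      using has_sum_unique[OF sob_bounded_has_sum[OF sob_bounded_shear[OF A(1) ub] \<psi>(1)]]
        sob_bounded_has_sum[OF sob_bounded_shear[OF A(1) vb] \<psi>(1)] \<psi>(2) by simp
  qed

  have existence: "\<exists>u. u \<in> distributions \<and> transport_op a u = f \<and> u (trig 0) = 0" if f0: "f (trig 0) = 0"
  proof -
    \<comment> \<open>Finiteness of the irrationality measure provides a real exponent, hence
      polynomial bounds that make the formal series a distribution.\<close>
    obtain r where r: "irrationality_measure ?\<alpha> < ereal r"
      using ereal_dense2[OF assms(4)] by blast
    \<comment> \<open>The value 0 at the origin imposes the normalization. There the equation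
      reduces to \<open>g (trig 0) = 0\<close>, which is the condition that the coefficient of
      \<open>f\<close> at (0, 0) vanishes.\<close>
    define c where "c k = (if k = 0 then 0 else - g (trig k) / transport_symbol ?\<alpha> k)" for k
    have gc: "transport_symbol ?\<alpha> k * c k = - g (trig k)" for k
      using transport_symbol_nonzero[OF assms(3), of k] f0 by (simp add: c_def g_def shear_trig_0)
    define v where "v \<phi> = (\<Sum>\<^sub>\<infinity>k. torus_coeff \<phi> k * c k)" for \<phi>
    have vb: "sob_bounded (- (s + 1 - r)) v"
      unfolding v_def[abs_def] by (rule sob_bounded_series[OF summable_small_divisors[OF assms(3) r g gc]])
    \<comment> \<open>Undoing the shear on the test function makes \<open>u (shear A \<phi>)\<close>
      equal to \<open>v \<phi>\<close>; the restriction supplies extensionality.\<close>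
    define u where "u = restrict (\<lambda>\<phi>. v (shear (\<lambda>t. - A t) \<phi>)) test_fun"
    have ub: "sob_bounded (- (s + 1 - r)) u"
      by (rule sob_bounded_cong[OF sob_bounded_shear[OF A' vb]]) (simp add: u_def)
    then have lin: "linear_functional u" by (simp add: sob_bounded_def)
    have us: "u (shear A \<phi>) = v \<phi>" if "\<phi> \<in> test_fun" for \<phi>
      using test_fun_shear[OF A(1) that] by (simp add: u_def shear_uminus_shear)
    have "v (transport_const ?\<alpha> \<phi>) = - g \<phi>" if \<phi>: "\<phi> \<in> test_fun" for \<phi>
    proof -
      have "v (transport_const ?\<alpha> \<phi>) = (\<Sum>\<^sub>\<infinity>k. - (torus_coeff \<phi> k * g (trig k)))"
        unfolding v_def torus_coeff_transport_const[OF \<phi>]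
        by (rule infsum_cong) (metis gc mult.assoc mult.commute mult_minus_right)
      also have "\<dots> = - g \<phi>"
        using infsumI[OF sob_bounded_has_sum[OF gb \<phi>]] by (simp add: infsum_uminus)
      finally show ?thesis .
    qed
    then have "transport_op a u = f"
      using transport_op_eq_iff[OF assms(1) A lin f] by (simp add: us test_fun_transport_const g_def)
    moreover have "u \<in> distributions"
      using ub by (auto simp: distributions_iff u_def)
    moreover have "u (trig 0) = 0"
    proof -
      have "u (trig 0) = v (trig 0)" using us[OF test_fun_trig, of 0] by (simp add: shear_trig_0)
      also have "\<dots> = 0" unfolding v_def by (rule infsum_0) (simp add: torus_coeff_trig c_def)
      finally show ?thesis .
    qed
    ultimately show ?thesis by blast
  qed

  have "\<exists>!u. u \<in> distributions \<and> transport_op a u = f \<and> fourier_coeff u (0, 0) = 0"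
    if "fourier_coeff f (0, 0) = 0"
    using existence unique that unfolding fourier_coeff_0_iff by blast
  then show ?thesis using regular by blast
qed

end
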